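(* Let $K$ be a field of any characteristic. (i) A linear $K[z]$-automorphism $\varphi$ of $K\langle x,y,z\rangle$ is tame (as a $K[z]$-automorphism) if and only if its Jacobian matrix $J_{K[z]}(\varphi)$ belongs to the group $GE_2(K[z_1,z_2])$. (ii) Every linear $K[z]$-automorphism of $K\langle x,y,z\rangle$ induces a tame automorphism of the polynomial algebra $K[x,y,z]$. (iii) For $n>2$ and $X=\{x_1,\ldots,x_n\}$, every linear $K[z]$-automorphism of $K\langle X,z\rangle$ is tame (as a $K[z]$-automorphism).
   Context: $K$ is a field, $X=\{x_1,\ldots,x_n\}$ with $n\ge 2$, $z$ is one more variable, and $K\langle X,z\rangle$ is the free associative (unital) $K$-algebra on $X\cup\{z\}$. For $n=2$ write $x=x_1$, $y=x_2$. A $K[z]$-endomorphism (resp. $K[z]$-automorphism) of $K\langle X,z\rangle$ is a $K$-algebra endomorphism (resp. automorphism) $\varphi$ with $\varphi(z)=z$; it is written $\varphi=(f_1,\ldots,f_n)$ with $f_j=\varphi(x_j)$. It is called linear if every $f_j$ is linear with respect to $X$, i.e. $f_j=\sum_{i=1}^n\sum_{p=1}^{k_{ij}} b_{ijp}(z)\,x_i\,c_{ijp}(z)$ with $b_{ijp},c_{ijp}\in K[z]$. The Jacobian matrix of such a linear $\varphi$ is the $n\times n$ matrix $J_{K[z]}(\varphi)=(a_{ij})$ over the commutative polynomial ring $K[z_1,z_2]$ with $a_{ij}=\sum_{p} b_{ijp}(z_1)c_{ijp}(z_2)$. Tame $K[z]$-automorphisms of $K\langle X,z\rangle$: the group of elementary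 linear automorphisms is generated by the automorphisms $(\alpha_1x_1,\ldots,\alpha_nx_n)$ with $\alpha_j\in K^*$ and $(x_1,\ldots,x_{j-1},x_j+a(z)x_ib(z),x_{j+1},\ldots,x_n)$ with $i\ne j$, $a,b\in K[z]$. The triangular $K[z]$-automorphisms are $(\alpha_1x_1+f_1(x_2,\ldots,x_n,z),\ldots,\alpha_{n-1}x_{n-1}+f_{n-1}(x_n,z),\alpha_nx_n+f_n(z))$ with $\alpha_j\in K^*$ and $f_j$ an element of the free algebra on $x_{j+1},\ldots,x_n,z$. A $K[z]$-automorphism is tame if it lies in the group generated by the elementary linear automorphisms and the triangular $K[z]$-automorphisms. Tame automorphisms of a polynomial algebra $K[y_1,\ldots,y_m]$ are the elements of the group generated by the affine automorphisms (each $y_j\mapsto\sum_i\alpha_{ij}y_i+\beta_j$, with $(\alpha_{ij})$ an invertible matrix over $K$ and $\beta_j\in K$) and the triangular automorphisms (each $y_j\mapsto\alpha_jy_j+f_j(y_{j+1},\ldots,y_m)$, with $\alpha_j\in K^*$ and $f_j\in K[y_{j+1},\ldots,y_m]$). An automorphism of $K\langle x,y,z\rangle$ induces an automorphism of $K[x,y,z]$ via the abelianization $K\langle x,y,z\rangle\to K[x,y,z]$. For a commutative ring $R$, $GE_n(R)$ is the subgroup of $GL_n(R)$ generated by the invertible diagonal matrices and the elementary matrices (identity matrix plus one off-diagonal entry from $R$). *)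

theory Defs
  imports
    "HOL-Algebra.Generated_Groups"
    "HOL-Library.Poly_Mapping"
    "HOL-Analysis.Cartesian_Space"
    "HOL-Computational_Algebra.Polynomial"
begin

section \<open>Free associative algebras and polynomial algebras\<close>

datatype 'v free_monoid = Word (letters: "'v list")

instantiation free_monoid :: (type) monoid_add
begin

definition zero_free_monoid :: "'a free_monoid"
  where "0 = Word []"

definition plus_free_monoid :: "'a free_monoid \<Rightarrow> 'a free_monoid \<Rightarrow> 'a free_monoid"
  where "u + v = Word (letters u @ letters v)"

instance
  by intro_classes (simp_all add: zero_free_monoid_def plus_free_monoid_def)

end

text \<open>Both algebras are monoid algebras, with the (convolution) product of
  \<open>Poly_Mapping\<close>: the monoid consists of the words in the variables, respectively
  of the commutative monomials (exponent functions).\<close>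

type_synonym ('v, 'k) free_algebra = "'v free_monoid \<Rightarrow>\<^sub>0 'k"
type_synonym ('v, 'k) poly_algebra = "('v \<Rightarrow>\<^sub>0 nat) \<Rightarrow>\<^sub>0 'k"

definition const :: "'k::field \<Rightarrow> ('m::monoid_add \<Rightarrow>\<^sub>0 'k)"
  where "const c = Poly_Mapping.single 0 c"

definition fvar :: "'v \<Rightarrow> ('v, 'k::field) free_algebra"
  where "fvar v = Poly_Mapping.single (Word [v]) 1"

definition pvar :: "'v \<Rightarrow> ('v, 'k::field) poly_algebra"
  where "pvar v = Poly_Mapping.single (Poly_Mapping.single v 1) 1"

text \<open>The free (respectively polynomial) subalgebra on the variables in \<open>S\<close>.\<close>

definition free_subalgebra :: "'v set \<Rightarrow> ('v, 'k::field) free_algebra set"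
  where "free_subalgebra S = {p. \<forall>w\<in>Poly_Mapping.keys p. set (letters w) \<subseteq> S}"

definition poly_subalgebra :: "'v set \<Rightarrow> ('v, 'k::field) poly_algebra set"
  where "poly_subalgebra S = {p. \<forall>m\<in>Poly_Mapping.keys p. Poly_Mapping.keys m \<subseteq> S}"

text \<open>Unital \<open>K\<close>-algebra homomorphisms; fixing the constants gives both unitality and
  \<open>K\<close>-linearity.\<close>

definition alg_hom :: "(('a::monoid_add \<Rightarrow>\<^sub>0 'k::field) \<Rightarrow> ('b::monoid_add \<Rightarrow>\<^sub>0 'k)) \<Rightarrow> bool"
  where "alg_hom \<phi> \<longleftrightarrow>
    (\<forall>p q. \<phi> (p + q) = \<phi> p + \<phi> q) \<and>
    (\<forall>p q. \<phi> (p * q) = \<phi> p * \<phi> q) \<and>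
    (\<forall>c. \<phi> (const c) = const c)"

definition alg_automorphism :: "(('a::monoid_add \<Rightarrow>\<^sub>0 'k::field) \<Rightarrow> ('a \<Rightarrow>\<^sub>0 'k)) \<Rightarrow> bool"
  where "alg_automorphism \<phi> \<longleftrightarrow> alg_hom \<phi> \<and> bij \<phi>"

definition abelianization :: "('v, 'k::field) free_algebra \<Rightarrow> ('v, 'k) poly_algebra"
  where "abelianization p =
    (\<Sum>w\<in>Poly_Mapping.keys p.
      Poly_Mapping.single (\<Sum>v\<leftarrow>letters w. Poly_Mapping.single v 1) (Poly_Mapping.lookup p w))"

definition induces :: "(('v, 'k::field) free_algebra \<Rightarrow> ('v, 'k) free_algebra) \<Rightarrow>
    (('v, 'k) poly_algebra \<Rightarrow> ('v, 'k) poly_algebra) \<Rightarrow> bool"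
  where "induces \<phi> \<psi> \<longleftrightarrow> (\<forall>p. \<psi> (abelianization p) = abelianization (\<phi> p))"


section \<open>The variables \<open>x\<^sub>1, \<dots>, x\<^sub>n, z\<close>\<close>

text \<open>The index set \<open>1 < \<dots> < n\<close> is an arbitrary finite linearly ordered type \<open>'n\<close>
  with \<open>CARD('n) = n\<close>.  The variables are ordered as \<open>x\<^sub>1 < \<dots> < x\<^sub>n < z\<close>.\<close>

datatype 'n gvar = X 'n | Z

instance gvar :: (finite) finite
proof
  have "(UNIV :: 'a gvar set) = insert Z (range X)"
    by (auto intro: gvar.exhaust)
  then show "finite (UNIV :: 'a gvar set)"
    by (metis finite finite_imageI finite_insert)
qed

instantiation gvar :: (linorder) linorder
begin

fun less_eq_gvar :: "'a gvar \<Rightarrow> 'a gvar \<Rightarrow> bool" where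
  "X i \<le> X j \<longleftrightarrow> i \<le> j"
| "X i \<le> Z \<longleftrightarrow> True"
| "Z \<le> X j \<longleftrightarrow> False"
| "Z \<le> Z \<longleftrightarrow> True"

definition less_gvar :: "'a gvar \<Rightarrow> 'a gvar \<Rightarrow> bool"
  where "u < v \<longleftrightarrow> u \<le> v \<and> \<not> v \<le> (u :: 'a gvar)"

instance
proof
  fix u v w :: "'a gvar"
  show "u < v \<longleftrightarrow> u \<le> v \<and> \<not> v \<le> u" by (rule less_gvar_def)
  show "u \<le> u" by (cases u) auto
  show "u \<le> v \<Longrightarrow> v \<le> w \<Longrightarrow> u \<le> w" by (cases u; cases v; cases w) auto
  show "u \<le> v \<Longrightarrow> v \<le> u \<Longrightarrow> u = v" by (cases u; cases v) auto
  show "u \<le> v \<or> v \<le> u" by (cases u; cases v) auto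
qed

end


section \<open>Linear \<open>K[z]\<close>-automorphisms and their Jacobian matrices\<close>

definition Kz_automorphism ::
    "(('n gvar, 'k::field) free_algebra \<Rightarrow> ('n gvar, 'k) free_algebra) \<Rightarrow> bool"
  where "Kz_automorphism \<phi> \<longleftrightarrow> alg_automorphism \<phi> \<and> \<phi> (fvar Z) = fvar Z"

definition at_z :: "'k::field poly \<Rightarrow> ('n gvar, 'k) free_algebra"
  where "at_z p = (\<Sum>k\<le>degree p. const (coeff p k) * fvar Z ^ k)"

text \<open>The list \<open>B i j\<close> consists of the pairs \<open>(b\<^sub>i\<^sub>j\<^sub>p, c\<^sub>i\<^sub>j\<^sub>p)\<close>.\<close>

definition represents :: "('n \<Rightarrow> 'n \<Rightarrow> ('k poly \<times> 'k poly) list) \<Rightarrow>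
    (('n::finite gvar, 'k::field) free_algebra \<Rightarrow> ('n gvar, 'k) free_algebra) \<Rightarrow> bool"
  where "represents B \<phi> \<longleftrightarrow>
    (\<forall>j. \<phi> (fvar (X j)) =
      (\<Sum>i\<in>UNIV. \<Sum>(b, c)\<leftarrow>B i j. at_z b * fvar (X i) * at_z c))"

definition linear_Kz_automorphism ::
    "(('n::finite gvar, 'k::field) free_algebra \<Rightarrow> ('n gvar, 'k) free_algebra) \<Rightarrow> bool"
  where "linear_Kz_automorphism \<phi> \<longleftrightarrow> Kz_automorphism \<phi> \<and> (\<exists>B. represents B \<phi>)"

text \<open>\<open>K[z\<^sub>1, z\<^sub>2]\<close> is \<open>K[z\<^sub>1][z\<^sub>2]\<close>.\<close>

definition at_z1 :: "'k::field poly \<Rightarrow> 'k poly poly"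
  where "at_z1 b = [:b:]"

definition at_z2 :: "'k::field poly \<Rightarrow> 'k poly poly"
  where "at_z2 c = map_poly (\<lambda>a. [:a:]) c"

definition jacobian_of :: "('n \<Rightarrow> 'n \<Rightarrow> ('k poly \<times> 'k poly) list) \<Rightarrow>
    'k::field poly poly ^ 'n::finite ^ 'n"
  where "jacobian_of B = (\<chi> i j. \<Sum>(b, c)\<leftarrow>B i j. at_z1 b * at_z2 c)"

text \<open>The \<open>b\<^sub>i\<^sub>j\<^sub>p, c\<^sub>i\<^sub>j\<^sub>p\<close> are not determined by \<open>\<phi>\<close>, but the matrix is; see
  \<open>jacobian_eq\<close> below.\<close>

definition jacobian ::
    "(('n::finite gvar, 'k::field) free_algebra \<Rightarrow> ('n gvar, 'k) free_algebra) \<Rightarrow>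
     'k poly poly ^ 'n ^ 'n"
  where "jacobian \<phi> = (THE J. \<exists>B. represents B \<phi> \<and> J = jacobian_of B)"


section \<open>Tame automorphisms\<close>

definition Kz_aut_group ::
    "(('n gvar, 'k::field) free_algebra \<Rightarrow> ('n gvar, 'k) free_algebra) monoid"
  where "Kz_aut_group = \<lparr>carrier = {\<phi>. Kz_automorphism \<phi>}, monoid.mult = (\<circ>), one = id\<rparr>"

definition diagonal_Kz_automorphisms ::
    "(('n gvar, 'k::field) free_algebra \<Rightarrow> ('n gvar, 'k) free_algebra) set"
  where "diagonal_Kz_automorphisms = {\<phi>. Kz_automorphism \<phi> \<and>
    (\<exists>\<alpha>. \<forall>j. \<alpha> j \<noteq> 0 \<and> \<phi> (fvar (X j)) = const (\<alpha> j) * fvar (X j))}"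

definition transvection_Kz_automorphisms ::
    "(('n gvar, 'k::field) free_algebra \<Rightarrow> ('n gvar, 'k) free_algebra) set"
  where "transvection_Kz_automorphisms = {\<phi>. Kz_automorphism \<phi> \<and>
    (\<exists>i j a b. i \<noteq> j \<and>
      \<phi> (fvar (X j)) = fvar (X j) + at_z a * fvar (X i) * at_z b \<and>
      (\<forall>l. l \<noteq> j \<longrightarrow> \<phi> (fvar (X l)) = fvar (X l)))}"

definition elementary_linear_Kz_automorphisms ::
    "(('n gvar, 'k::field) free_algebra \<Rightarrow> ('n gvar, 'k) free_algebra) set"
  where "elementary_linear_Kz_automorphisms =
    generate Kz_aut_group (diagonal_Kz_automorphisms \<union> transvection_Kz_automorphisms)"

definition triangular_Kz_automorphisms ::
    "(('n::linorder gvar, 'k::field) free_algebra \<Rightarrow> ('n gvar, 'k) free_algebra) set"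
  where "triangular_Kz_automorphisms = {\<phi>. Kz_automorphism \<phi> \<and>
    (\<exists>\<alpha> f. \<forall>j. \<alpha> j \<noteq> 0 \<and> f j \<in> free_subalgebra (X ` {j<..} \<union> {Z}) \<and>
      \<phi> (fvar (X j)) = const (\<alpha> j) * fvar (X j) + f j)}"

definition tame_Kz_automorphisms ::
    "(('n::linorder gvar, 'k::field) free_algebra \<Rightarrow> ('n gvar, 'k) free_algebra) set"
  where "tame_Kz_automorphisms =
    generate Kz_aut_group (elementary_linear_Kz_automorphisms \<union> triangular_Kz_automorphisms)"

definition poly_aut_group ::
    "(('v, 'k::field) poly_algebra \<Rightarrow> ('v, 'k) poly_algebra) monoid"
  where "poly_aut_group = \<lparr>carrier = {\<psi>. alg_automorphism \<psi>}, monoid.mult = (\<circ>), one = id\<rparr>"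

definition affine_automorphisms ::
    "(('v::finite, 'k::field) poly_algebra \<Rightarrow> ('v, 'k) poly_algebra) set"
  where "affine_automorphisms = {\<psi>. alg_automorphism \<psi> \<and>
    (\<exists>(A :: 'k ^ 'v ^ 'v) \<beta>. invertible A \<and>
      (\<forall>j. \<psi> (pvar j) = (\<Sum>i\<in>UNIV. const (A $ i $ j) * pvar i) + const (\<beta> j)))}"

definition triangular_automorphisms ::
    "(('v::linorder, 'k::field) poly_algebra \<Rightarrow> ('v, 'k) poly_algebra) set"
  where "triangular_automorphisms = {\<psi>. alg_automorphism \<psi> \<and>
    (\<exists>\<alpha> f. \<forall>j. \<alpha> j \<noteq> 0 \<and> f j \<in> poly_subalgebra {j<..} \<and>
      \<psi> (pvar j) = const (\<alpha> j) * pvar j + f j)}"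

definition tame_automorphisms ::
    "(('v::{finite,linorder}, 'k::field) poly_algebra \<Rightarrow> ('v, 'k) poly_algebra) set"
  where "tame_automorphisms =
    generate poly_aut_group (affine_automorphisms \<union> triangular_automorphisms)"


section \<open>The group \<open>GE\<^sub>n(R)\<close>\<close>

definition GL_group :: "('r::comm_ring_1 ^ 'n::finite ^ 'n) monoid"
  where "GL_group = \<lparr>carrier = {A. invertible A}, monoid.mult = (**), one = mat 1\<rparr>"

definition diagonal_matrices :: "('r::comm_ring_1 ^ 'n::finite ^ 'n) set"
  where "diagonal_matrices = {A. \<forall>i j. i \<noteq> j \<longrightarrow> A $ i $ j = 0}"

definition elementary_matrix :: "'n \<Rightarrow> 'n \<Rightarrow> 'r \<Rightarrow> 'r::comm_ring_1 ^ 'n::finite ^ 'n"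
  where "elementary_matrix i j r = mat 1 + (\<chi> k l. if k = i \<and> l = j then r else 0)"

definition GE :: "('r::comm_ring_1 ^ 'n::finite ^ 'n) set"
  where "GE = generate GL_group
    ({A \<in> diagonal_matrices. invertible A} \<union> {elementary_matrix i j r | i j r. i \<noteq> j})"


section \<open>Well-definedness\<close>

lemma group_Kz_aut_group: "group Kz_aut_group"
proof (rule groupI)
  fix \<phi> :: "('n gvar, 'k::field) free_algebra \<Rightarrow> ('n gvar, 'k) free_algebra"
  assume "\<phi> \<in> carrier Kz_aut_group"
  then have *: "alg_hom \<phi>" "bij \<phi>" "\<phi> (fvar Z) = fvar Z"
    by (auto simp: Kz_aut_group_def Kz_automorphism_def alg_automorphism_def)
  let ?\<psi> = "inv_into UNIV \<phi>"
  have inv: "?\<psi> (\<phi> p) = p" "\<phi> (?\<psi> p) = p" for p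
    using *(2) by (simp_all add: bij_def surj_f_inv_f)
  have hom: "\<phi> (p + q) = \<phi> p + \<phi> q" "\<phi> (p * q) = \<phi> p * \<phi> q" "\<phi> (const c) = const c" for p q c
    using *(1) unfolding alg_hom_def by blast+
  have "alg_hom ?\<psi>"
    unfolding alg_hom_def using hom inv by metis
  moreover have "?\<psi> (fvar Z) = fvar Z"
    using *(3) inv by metis
  moreover have "bij ?\<psi>"
    using *(2) by (rule bij_imp_bij_inv)
  moreover have "?\<psi> \<circ> \<phi> = id"
    using inv by (simp add: fun_eq_iff)
  ultimately show "\<exists>\<psi>\<in>carrier Kz_aut_group. \<psi> \<otimes>\<^bsub>Kz_aut_group\<^esub> \<phi> = \<one>\<^bsub>Kz_aut_group\<^esub>"
    by (auto simp: Kz_aut_group_def Kz_automorphism_def alg_automorphism_def)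
qed (auto simp: Kz_aut_group_def Kz_automorphism_def alg_automorphism_def alg_hom_def
       intro: bij_comp)

lemma group_poly_aut_group: "group poly_aut_group"
proof (rule groupI)
  fix \<phi> :: "('v, 'k::field) poly_algebra \<Rightarrow> ('v, 'k) poly_algebra"
  assume "\<phi> \<in> carrier poly_aut_group"
  then have *: "alg_hom \<phi>" "bij \<phi>"
    by (auto simp: poly_aut_group_def alg_automorphism_def)
  let ?\<psi> = "inv_into UNIV \<phi>"
  have inv: "?\<psi> (\<phi> p) = p" "\<phi> (?\<psi> p) = p" for p
    using *(2) by (simp_all add: bij_def surj_f_inv_f)
  have hom: "\<phi> (p + q) = \<phi> p + \<phi> q" "\<phi> (p * q) = \<phi> p * \<phi> q" "\<phi> (const c) = const c" for p q c
    using *(1) unfolding alg_hom_def by blast+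
  have "alg_hom ?\<psi>"
    unfolding alg_hom_def using hom inv by metis
  moreover have "bij ?\<psi>"
    using *(2) by (rule bij_imp_bij_inv)
  moreover have "?\<psi> \<circ> \<phi> = id"
    using inv by (simp add: fun_eq_iff)
  ultimately show "\<exists>\<psi>\<in>carrier poly_aut_group. \<psi> \<otimes>\<^bsub>poly_aut_group\<^esub> \<phi> = \<one>\<^bsub>poly_aut_group\<^esub>"
    by (auto simp: poly_aut_group_def alg_automorphism_def)
qed (auto simp: poly_aut_group_def alg_automorphism_def alg_hom_def intro: bij_comp)

lemma group_GL_group: "group GL_group"
proof (rule groupI)
  fix A B :: "'r::comm_ring_1 ^ 'n::finite ^ 'n"
  assume "A \<in> carrier GL_group" "B \<in> carrier GL_group"
  then show "A \<otimes>\<^bsub>GL_group\<^esub> B \<in> carrier GL_group"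
    by (simp add: GL_group_def invertible_mult)
next
  fix A :: "'r::comm_ring_1 ^ 'n::finite ^ 'n"
  assume "A \<in> carrier GL_group"
  then show "\<exists>B\<in>carrier GL_group. B \<otimes>\<^bsub>GL_group\<^esub> A = \<one>\<^bsub>GL_group\<^esub>"
    unfolding GL_group_def invertible_def by auto
qed (auto simp: GL_group_def matrix_mul_assoc invertible_def intro: exI[of _ "mat 1"])

lemma abelianization_superset:
  assumes "finite S" "Poly_Mapping.keys p \<subseteq> S"
  shows "abelianization p =
    (\<Sum>w\<in>S. Poly_Mapping.single (\<Sum>v\<leftarrow>letters w. Poly_Mapping.single v 1) (Poly_Mapping.lookup p w))"
  unfolding abelianization_def
  by (rule sum.mono_neutral_left) (use assms in \<open>auto simp: in_keys_iff\<close>)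

lemma abelianization_single [simp]:
  "abelianization (Poly_Mapping.single w c) =
    Poly_Mapping.single (\<Sum>v\<leftarrow>letters w. Poly_Mapping.single v 1) c"
  by (subst abelianization_superset[of "{w}"]) auto

lemma abelianization_add: "abelianization (p + q) = abelianization p + abelianization q"
  using keys_add[of p q]
  by (simp add: abelianization_superset[of "Poly_Mapping.keys p \<union> Poly_Mapping.keys q"] lookup_add single_add sum.distrib)

lemma abelianization_zero: "abelianization 0 = 0"
  by (simp add: abelianization_def)

lemma abelianization_fvar: "abelianization (fvar v) = pvar v"
  by (simp add: fvar_def pvar_def)

lemma free_algebra_sum_singles:
  "p = (\<Sum>w\<in>Poly_Mapping.keys p. Poly_Mapping.single w (Poly_Mapping.lookup p w))"
  by (rule poly_mapping_eqI) (simp add: lookup_sum lookup_single when_def in_keys_iff)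

lemma abelianization_sum: "abelianization (sum f S) = (\<Sum>s\<in>S. abelianization (f s))"
  by (induction S rule: infinite_finite_induct)
     (simp_all add: abelianization_add abelianization_zero)

lemma alg_hom_abelianization: "alg_hom abelianization"
proof -
  have "abelianization (p * q) = abelianization p * abelianization q"
    for p q :: "('v, 'k::field) free_algebra"
  proof -
    have "abelianization (p * q) = abelianization
      ((\<Sum>w\<in>Poly_Mapping.keys p. Poly_Mapping.single w (Poly_Mapping.lookup p w)) *
       (\<Sum>w\<in>Poly_Mapping.keys q. Poly_Mapping.single w (Poly_Mapping.lookup q w)))"
      using free_algebra_sum_singles by metis
    also have "\<dots> = abelianization p * abelianization q"
      unfolding abelianization_def[of p] abelianization_def[of q]
      by (simp add: sum_product abelianization_sum mult_single plus_free_monoid_def)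
    finally show ?thesis .
  qed
  then show ?thesis
    by (auto simp: alg_hom_def abelianization_add const_def zero_free_monoid_def)
qed

lemma fvar_Z_power:
  "fvar Z ^ k = Poly_Mapping.single (Word (replicate k Z)) (1::'k::field)"
  by (induction k)
     (simp_all add: fvar_def mult_single plus_free_monoid_def zero_free_monoid_def
        flip: single_one)

lemma at_z_altdef:
  "at_z p = (\<Sum>k\<le>degree p. Poly_Mapping.single (Word (replicate k Z)) (coeff p k))"
  by (simp add: at_z_def fvar_Z_power const_def mult_single)

lemma replicate_Z_X_eq_iff:
  "replicate k Z @ X i # replicate l Z = replicate k' Z @ X i' # replicate l' Z \<longleftrightarrow>
     k = k' \<and> i = i' \<and> l = l'"
proof (induction k arbitrary: k')
  case 0
  then show ?case by (cases k') auto
next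
  case (Suc k)
  then show ?case by (cases k') auto
qed

lemma lookup_linear_term:
  "Poly_Mapping.lookup (at_z b * fvar (X i) * at_z c) (Word (replicate k Z @ X i' # replicate l Z)) =
     (if i = i' then coeff b k * coeff c l else (0::'k::field))"
proof -
  have "Poly_Mapping.lookup (at_z b * fvar (X i) * at_z c) (Word (replicate k Z @ X i' # replicate l Z)) =
    (\<Sum>r\<le>degree b. \<Sum>s\<le>degree c. if r = k \<and> i = i' \<and> s = l then coeff b r * coeff c s else 0)"
    unfolding at_z_altdef
    by (simp add: sum_distrib_right sum_distrib_left fvar_def mult_single
          plus_free_monoid_def lookup_sum lookup_single when_def replicate_Z_X_eq_iff
          cong: if_cong)
       (rule sum.swap)
  also have "\<dots> = (\<Sum>r\<le>degree b. if r = k then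
      (\<Sum>s\<le>degree c. if s = l then (if i = i' then coeff b r * coeff c s else 0) else 0) else 0)"
    by (intro sum.cong refl) auto
  also have "\<dots> = (if i = i' then coeff b k * coeff c l else 0)"
    by (auto simp: coeff_eq_0 not_le)
  finally show ?thesis .
qed

lemma coeff_linear_term: "coeff (coeff (at_z1 b * at_z2 c) l) k = coeff b k * coeff c l"
  by (simp add: at_z1_def at_z2_def coeff_map_poly mult.commute)

lemma jacobian_entry:
  assumes "represents B \<phi>"
  shows "coeff (coeff (jacobian_of B $ i $ j) l) k =
    Poly_Mapping.lookup (\<phi> (fvar (X j))) (Word (replicate k Z @ X i # replicate l Z))"
proof -
  have 1: "coeff (coeff (\<Sum>(b, c)\<leftarrow>xs. at_z1 b * at_z2 c) l) k =
      (\<Sum>(b, c)\<leftarrow>xs. coeff b k * coeff c l)" for xs :: "('b poly \<times> 'b poly) list"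
    by (induction xs) (auto simp: coeff_linear_term)
  have 2: "Poly_Mapping.lookup (\<Sum>(b, c)\<leftarrow>xs. at_z b * fvar (X i') * at_z c)
        (Word (replicate k Z @ X i # replicate l Z)) =
      (if i' = i then (\<Sum>(b, c)\<leftarrow>xs. coeff b k * coeff c l) else 0)"
    for xs :: "('b poly \<times> 'b poly) list" and i'
    by (induction xs) (auto simp: lookup_add lookup_linear_term)
  show ?thesis
    using assms by (simp add: represents_def jacobian_of_def 1 2 lookup_sum)
qed

lemma jacobian_eq:
  assumes "represents B \<phi>"
  shows "jacobian \<phi> = jacobian_of B"
  unfolding jacobian_def
proof (rule the_equality)
  fix J assume "\<exists>B. represents B \<phi> \<and> J = jacobian_of B"
  with assms show "J = jacobian_of B"
    by (auto simp: vec_eq_iff poly_eq_iff jacobian_entry)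
qed (use assms in blast)

end

theory Submission
  imports Defs "HOL-Computational_Algebra.Polynomial_Factorial"
begin

text \<open>The matrix of Fox derivatives at a point \<open>a \<in> K[z]\<^sup>n\<close> satisfies a chain rule in which only the
  point changes.  It lies in \<open>GE\<^sub>2\<close> for the generators of the tame group at every point, hence for every
  tame automorphism, and for a linear automorphism it is the Jacobian matrix.  Conversely a
  factorization of the Jacobian matrix in \<open>GE\<^sub>n(K[z\<^sub>1, z\<^sub>2])\<close> is a factorization into elementary linear
  automorphisms.  Setting \<open>z\<^sub>1 = z\<^sub>2 = z\<close> gives an invertible matrix over the Euclidean ring \<open>K[z]\<close>, whence
  (ii).

  Part (iii) is Suslin's theorem \<open>GL\<^sub>n(K[x, y]) = GE\<^sub>n(K[x, y])\<close> for \<open>n \<ge> 3\<close>.  Nagata's substitution makes a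
  chosen entry monic in \<open>y\<close>.  Over \<open>R[y]\<close>, where \<open>R\<close> is a localization of \<open>K[x]\<close> at a maximal ideal, a unimodular
  row with a monic entry is elementarily equivalent to a unit vector, and the Mennicke symbol of a
  pair with a monic entry is trivial, both by induction on the degree.  A local-global argument
  replaces \<open>y\<close> by \<open>0\<close>, which leads to matrices over \<open>K[x]\<close>.\<close>

section \<open>Groups of elementary matrices\<close>

text \<open>Both inductions on the degree need a unit among certain coefficients. A local
  coefficient ring guarantees one, because a sum of non-units is a non-unit there; this is why the
  argument leaves \<open>K[x]\<close> and has to be patched together afterwards. The condition
  \<open>n >= 3\<close> enters as a third index: it receives the combination of lower degree when a
  row is reduced, it makes Mennicke symbols multiplicative, and it turns an elementary matrix into a
  commutator when denominators are absorbed. A localization is a subset of the fraction field, so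
  matrices over different rings share one type and differ by membership in \<open>El I S\<close>.
  For (i), a linear automorphism may be a product of nonlinear triangular ones, whose Fox matrices
  depend on the point; so the invariant carried along is membership in \<open>GE\<close> at all
  points simultaneously. Multiplications by \<open>z\<close> from the left and from the right
  commute, which is why the coefficients form the commutative ring
  \<open>K[z\<^sub>1, z\<^sub>2]\<close>.\<close>

definition unital_subring :: "'r::comm_ring_1 set \<Rightarrow> bool"
  where "unital_subring S \<longleftrightarrow> 1 \<in> S \<and> (\<forall>a\<in>S. \<forall>b\<in>S. a - b \<in> S \<and> a * b \<in> S)"

lemma unital_subringD:
  assumes "unital_subring S"
  shows "1 \<in> S" "0 \<in> S" "a \<in> S \<Longrightarrow> b \<in> S \<Longrightarrow> a - b \<in> S" "a \<in> S \<Longrightarrow> b \<in> S \<Longrightarrow> a * b \<in> S"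
    "a \<in> S \<Longrightarrow> - a \<in> S" "a \<in> S \<Longrightarrow> b \<in> S \<Longrightarrow> a + b \<in> S"
proof -
  have d: "a - b \<in> S" if "a \<in> S" "b \<in> S" for a b
    using assms that by (auto simp: unital_subring_def)
  show 1: "1 \<in> S" and "a \<in> S \<Longrightarrow> b \<in> S \<Longrightarrow> a * b \<in> S"
    using assms by (auto simp: unital_subring_def)
  show 0: "0 \<in> S" using d[OF 1 1] by simp
  show "a \<in> S \<Longrightarrow> b \<in> S \<Longrightarrow> a - b \<in> S" by (rule d)
  have m: "- b \<in> S" if "b \<in> S" for b using d[OF 0 that] by simp
  show "a \<in> S \<Longrightarrow> - a \<in> S" by (rule m)
  show "a \<in> S \<Longrightarrow> b \<in> S \<Longrightarrow> a + b \<in> S" using d[of a "- b"] m by simp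
qed

lemma unital_subring_UNIV [simp]: "unital_subring UNIV"
  by (simp add: unital_subring_def)

lemma elementary_matrix_nth:
  "elementary_matrix i j r $ k $ l = (if k = l then 1 else 0) + (if k = i \<and> l = j then r else 0)"
  by (simp add: elementary_matrix_def mat_def)

lemma matrix_mult_elementary_nth:
  "(M ** elementary_matrix i j r) $ k $ l = M $ k $ l + (if l = j then M $ k $ i * r else 0)"
  for M :: "'r::comm_ring_1 ^ 'n::finite ^ 'n"
proof -
  have "(M ** elementary_matrix i j r) $ k $ l =
    (\<Sum>m\<in>UNIV. (if m = l then M $ k $ m else 0) +
      (if m = i then (if l = j then M $ k $ m * r else 0) else 0))"
    unfolding matrix_matrix_mult_def
    by (auto simp: elementary_matrix_nth algebra_simps intro!: sum.cong)
  then show ?thesis by (simp add: sum.distrib)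
qed

lemma elementary_mult_matrix_nth:
  "(elementary_matrix i j r ** M) $ k $ l = M $ k $ l + (if k = i then r * M $ j $ l else 0)"
  for M :: "'r::comm_ring_1 ^ 'n::finite ^ 'n"
proof -
  have "(elementary_matrix i j r ** M) $ k $ l =
    (\<Sum>m\<in>UNIV. (if m = k then M $ m $ l else 0) +
      (if m = j then (if k = i then r * M $ m $ l else 0) else 0))"
    unfolding matrix_matrix_mult_def
    by (auto simp: elementary_matrix_nth algebra_simps intro!: sum.cong)
  then show ?thesis by (simp add: sum.distrib)
qed

lemma vector_mult_elementary_nth:
  "(v v* elementary_matrix i j r) $ l = v $ l + (if l = j then v $ i * r else 0)"
  for v :: "'r::comm_ring_1 ^ 'n::finite"
proof -
  have "(v v* elementary_matrix i j r) $ l =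
    (\<Sum>m\<in>UNIV. (if m = l then v $ m else 0) +
      (if m = i then (if l = j then v $ m * r else 0) else 0))"
    unfolding vector_matrix_mult_def
    by (auto simp: elementary_matrix_nth algebra_simps intro!: sum.cong)
  then show ?thesis by (simp add: sum.distrib)
qed

lemma elementary_matrix_0 [simp]: "elementary_matrix i j 0 = mat 1"
  by (simp add: vec_eq_iff elementary_matrix_nth mat_def)

lemma elementary_matrix_add:
  assumes "i \<noteq> j"
  shows "elementary_matrix i j a ** elementary_matrix i j b = elementary_matrix i j (a + b)"
  using assms by (auto simp: vec_eq_iff matrix_mult_elementary_nth elementary_matrix_nth)

lemma row_matrix_mult: "(M ** N) $ i = M $ i v* N"
  for M N :: "'r::comm_ring_1 ^ 'n::finite ^ 'n"
  by (simp add: vec_eq_iff matrix_matrix_mult_def vector_matrix_mult_def mult.commute)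

lemma vector_matrix_mult_assoc: "(v v* M) v* N = v v* (M ** N)"
  for M N :: "'r::comm_ring_1 ^ 'n::finite ^ 'n"
proof -
  have "((\<chi> r::'n. v) ** M) ** N = (\<chi> r. v) ** (M ** N)"
    by (simp add: matrix_mul_assoc)
  then have "(((\<chi> r::'n. v) ** M) ** N) $ undefined = ((\<chi> r::'n. v) ** (M ** N)) $ undefined"
    by simp
  then show ?thesis by (simp only: row_matrix_mult vec_lambda_beta)
qed

text \<open>Appending one factor at a time makes induction over a product of elementary matrices
  immediate. \<open>S\<close> may be any set of entries: a ring such as \<open>polys\<close>, or an
  ideal such as \<open>multiples t\<close>, which measures how close a matrix is to the identity.
  \<open>I\<close> confines all operations to a block of indices.\<close>

inductive_set El :: "'n::finite set \<Rightarrow> 'r::comm_ring_1 set \<Rightarrow> ('r ^ 'n ^ 'n) set"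
  for I S where
  one: "mat 1 \<in> El I S"
| step: "M \<in> El I S \<Longrightarrow> i \<in> I \<Longrightarrow> j \<in> I \<Longrightarrow> i \<noteq> j \<Longrightarrow> r \<in> S \<Longrightarrow> M ** elementary_matrix i j r \<in> El I S"

lemma El_elementary: "i \<in> I \<Longrightarrow> j \<in> I \<Longrightarrow> i \<noteq> j \<Longrightarrow> r \<in> S \<Longrightarrow> elementary_matrix i j r \<in> El I S"
  using El.step[OF El.one] by (metis matrix_mul_lid)

lemma El_mult:
  assumes "M \<in> El I S" "N \<in> El I S"
  shows "M ** N \<in> El I S"
  using assms(2,1) by induction (auto simp: matrix_mul_assoc intro: El.step)

lemma El_mono: "M \<in> El I S \<Longrightarrow> I \<subseteq> J \<Longrightarrow> S \<subseteq> T \<Longrightarrow> M \<in> El J T"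
  by (induction M rule: El.induct) (auto intro: El.intros)

lemma El_inverse:
  assumes "M \<in> El I S" "\<And>r. r \<in> S \<Longrightarrow> - r \<in> S"
  obtains N where "N \<in> El I S" "M ** N = mat 1" "N ** M = mat 1"
proof -
  have "\<exists>N\<in>El I S. M ** N = mat 1 \<and> N ** M = mat 1"
    using assms(1)
  proof induction
    case one
    then show ?case by (intro bexI[of _ "mat 1"]) (auto intro: El.one)
  next
    case (step M i j r)
    then obtain N where N: "N \<in> El I S" "M ** N = mat 1" "N ** M = mat 1" by blast
    let ?e = "elementary_matrix i j"
    have e: "?e r ** ?e (- r) = mat 1" "?e (- r) ** ?e r = mat 1"
      using step.hyps by (simp_all add: elementary_matrix_add)
    have "?e (- r) ** N \<in> El I S"
      using step.hyps assms(2) N(1) by (intro El_mult El_elementary) auto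
    moreover have "(M ** ?e r) ** (?e (- r) ** N) = M ** (?e r ** ?e (- r)) ** N"
      "(?e (- r) ** N) ** (M ** ?e r) = ?e (- r) ** (N ** M) ** ?e r"
      by (simp_all only: matrix_mul_assoc)
    ultimately show ?case
      using e N by (intro bexI[of _ "?e (- r) ** N"]) simp_all
  qed
  then show ?thesis using that by blast
qed

definition supported_on :: "'n::finite set \<Rightarrow> 'r::comm_ring_1 ^ 'n ^ 'n \<Rightarrow> bool"
  where "supported_on I M \<longleftrightarrow> (\<forall>k l. k \<notin> I \<or> l \<notin> I \<longrightarrow> M $ k $ l = (if k = l then 1 else 0))"

lemma supported_on_UNIV [simp]: "supported_on UNIV M"
  by (simp add: supported_on_def)

lemma El_right_supported_on:
  assumes "N \<in> El I S" "supported_on I M"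
  shows "supported_on I (M ** N)"
  using assms
  by (induction N rule: El.induct)
     (auto simp: supported_on_def matrix_mult_elementary_nth matrix_mul_assoc)

section \<open>Elementary operations on unimodular rows\<close>

definition reach :: "'n::finite set \<Rightarrow> 'r::comm_ring_1 set \<Rightarrow> 'r ^ 'n \<Rightarrow> 'r ^ 'n \<Rightarrow> bool"
  where "reach I S v w \<longleftrightarrow> (\<exists>M\<in>El I S. v v* M = w)"

lemma reach_refl: "reach I S v v"
  unfolding reach_def by (rule bexI[OF _ El.one]) simp

lemma reach_trans [trans]: "reach I S u v \<Longrightarrow> reach I S v w \<Longrightarrow> reach I S u w"
  unfolding reach_def using El_mult vector_matrix_mult_assoc by metis

lemma reach_elementary:
  assumes "i \<in> I" "j \<in> I" "i \<noteq> j" "r \<in> S"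
  shows "reach I S v (\<chi> l. v $ l + (if l = j then v $ i * r else 0))"
  unfolding reach_def
  by (rule bexI[OF _ El_elementary[OF assms]]) (simp add: vec_eq_iff vector_mult_elementary_nth)

lemma reach_add_multiples:
  assumes "i \<in> I" "J \<subseteq> I - {i}" "\<And>j. j \<in> J \<Longrightarrow> r j \<in> S"
  shows "reach I S v (\<chi> l. v $ l + (if l \<in> J then v $ i * r l else 0))"
proof -
  have "finite J" by simp
  then show ?thesis
    using assms(2,3)
  proof (induction J rule: finite_induct)
    case empty
    then show ?case by (simp add: reach_refl)
  next
    case (insert j J)
    let ?w = "\<chi> l. v $ l + (if l \<in> J then v $ i * r l else 0)"
    have "reach I S v ?w"
      using insert by auto
    also have "reach I S ?w (\<chi> l. ?w $ l + (if l = j then ?w $ i * r j else 0))"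
      using insert assms(1) by (intro reach_elementary) auto
    also have "\<dots> = (\<chi> l. v $ l + (if l \<in> insert j J then v $ i * r l else 0))"
      using insert by (auto simp: vec_eq_iff)
    finally show ?case .
  qed
qed

lemma reach_axis_of_one:
  assumes "k \<in> I" "v $ k = 1" "\<And>l. l \<notin> I \<Longrightarrow> v $ l = 0" "\<And>l. v $ l \<in> S" "unital_subring S"
  shows "reach I S v (axis k 1)"
proof -
  have "reach I S v (\<chi> l. v $ l + (if l \<in> I - {k} then v $ k * (- v $ l) else 0))"
    using assms by (intro reach_add_multiples) (auto intro: unital_subringD)
  also have "\<dots> = axis k 1"
    using assms by (auto simp: vec_eq_iff axis_def)
  finally show ?thesis .
qed

lemma reach_axis_of_unit:
  assumes "i \<in> I" "k \<in> I" "v $ i * u = 1" "u \<in> S" "\<And>l. l \<notin> I \<Longrightarrow> v $ l = 0" "\<And>l. v $ l \<in> S"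
    "unital_subring S" "card I \<ge> 2"
  shows "reach I S v (axis k 1)"
proof -
  note S = unital_subringD[OF assms(7)]
  have main: "reach I S v (axis k 1)"
    if "i \<in> I" "k \<in> I" "v $ i * u = 1" "u \<in> S" "\<And>l. l \<notin> I \<Longrightarrow> v $ l = 0" "\<And>l. v $ l \<in> S" "i \<noteq> k"
    for i k u v
  proof -
    let ?w = "\<chi> l. v $ l + (if l = k then v $ i * (u * (1 - v $ k)) else 0)"
    have "reach I S v ?w"
      using that S by (intro reach_elementary) auto
    also have "reach I S ?w (axis k 1)"
      using that S assms(7)
      by (intro reach_axis_of_one) (auto simp flip: mult.assoc)
    finally show ?thesis .
  qed
  show ?thesis
  proof (cases "i = k")
    case False
    then show ?thesis using main assms by blast
  next
    case True
    \<comment> \<open>Scaling \<open>v $ k\<close> to 1 is not an elementary operation; a detour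
      over a second index \<open>j\<close> replaces it.\<close>
    obtain j where j: "j \<in> I" "j \<noteq> i"
      using assms(1,8) by (metis card_le_Suc0_iff_eq finite not_less_eq_eq numeral_2_eq_2)
    have "reach I S v (axis j 1)"
      using main[of i j v u] j assms by blast
    also have "reach I S (axis j 1) (axis k 1)"
    proof (rule main[of j k _ 1])
      show "\<And>l. l \<notin> I \<Longrightarrow> axis j 1 $ l = 0" "\<And>l. axis j 1 $ l \<in> S"
        using j S by (auto simp: axis_def)
    qed (use j assms True S in auto)
    finally show ?thesis .
  qed
qed

definition unimodular :: "'r::comm_ring_1 set \<Rightarrow> 'r ^ 'n::finite \<Rightarrow> bool"
  where "unimodular S v \<longleftrightarrow> (\<exists>w. (\<forall>i. w $ i \<in> S) \<and> (\<Sum>i\<in>UNIV. v $ i * w $ i) = 1)"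

lemma unimodular_elementary:
  assumes "unimodular S v" "unital_subring S" "r \<in> S" "i \<noteq> j"
  shows "unimodular S (v v* elementary_matrix i j r)"
proof -
  note S = unital_subringD[OF assms(2)]
  obtain w where w: "\<And>i. w $ i \<in> S" "(\<Sum>i\<in>UNIV. v $ i * w $ i) = 1"
    using assms(1) by (auto simp: unimodular_def)
  \<comment> \<open>The inverse elementary matrix, applied to the column \<open>w\<close>, preserves
    the pairing.\<close>
  let ?w = "\<chi> l. w $ l - (if l = i then r * w $ j else 0)"
  have "(\<Sum>l\<in>UNIV. (v v* elementary_matrix i j r) $ l * ?w $ l) =
    (\<Sum>l\<in>UNIV. v $ l * w $ l + (if l = j then v $ i * r * w $ j else 0)
       - (if l = i then v $ i * r * w $ j else 0))"
    using assms(4) by (intro sum.cong) (auto simp: vector_mult_elementary_nth algebra_simps)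
  also have "\<dots> = 1"
    by (simp add: sum.distrib sum_subtractf w)
  finally show ?thesis
    unfolding unimodular_def using w S assms(3) by (intro exI[of _ ?w]) auto
qed

lemma unimodular_reach:
  assumes "reach I S v w" "unimodular S v" "unital_subring S"
  shows "unimodular S w"
proof -
  obtain M where M: "M \<in> El I S" "v v* M = w" using assms(1) by (auto simp: reach_def)
  from M(1) have "unimodular S (v v* M)"
    by induction (use assms in \<open>auto simp: unimodular_elementary simp flip: vector_matrix_mult_assoc\<close>)
  with M show ?thesis by simp
qed

lemma El_add_row_multiples:
  fixes M :: "'r::comm_ring_1 ^ 'n::finite ^ 'n"
  assumes "i \<notin> J"
  shows "\<exists>P\<in>El UNIV UNIV. P ** M = (\<chi> k l. M $ k $ l + (if k \<in> J then r k * M $ i $ l else 0))"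
proof -
  have "finite J" by simp
  then show ?thesis
    using assms
  proof (induction J rule: finite_induct)
    case empty
    then show ?case by (intro bexI[of _ "mat 1"]) (auto simp: vec_eq_iff El.one)
  next
    case (insert j J)
    then obtain P where P: "P \<in> El UNIV UNIV"
      "P ** M = (\<chi> k l. M $ k $ l + (if k \<in> J then r k * M $ i $ l else 0))" by auto
    let ?e = "elementary_matrix j i (r j)"
    have "?e ** P \<in> El UNIV UNIV"
      using P insert by (intro El_mult El_elementary) auto
    moreover have "?e ** P ** M = (\<chi> k l. M $ k $ l + (if k \<in> insert j J then r k * M $ i $ l else 0))"
      using insert by (auto simp: vec_eq_iff elementary_mult_matrix_nth P simp flip: matrix_mul_assoc)
    ultimately show ?case by blast
  qed
qed

lemma invertible_El: "M \<in> El I S \<Longrightarrow> invertible M"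
  unfolding invertible_def using El_inverse[of M UNIV UNIV] El_mono[of M I S UNIV UNIV] by blast

lemma invertible_row_unimodular:
  fixes M :: "'r::comm_ring_1 ^ 'n::finite ^ 'n"
  assumes "invertible M"
  shows "unimodular UNIV (M $ i)"
proof -
  obtain N where N: "M ** N = mat 1" using assms by (auto simp: invertible_def)
  then have "(M ** N) $ i $ i = 1" by (simp add: mat_def)
  then show ?thesis
    unfolding unimodular_def by (intro exI[of _ "\<chi> k. N $ k $ i"]) (auto simp: matrix_matrix_mult_def)
qed

text \<open>Column operations turn row \<open>i\<close> of the block into a unit vector, row
  operations then clear column \<open>i\<close>, and the block loses the index \<open>i\<close>.
  This goes on while at least \<open>c\<close> indices are left. It is applied with
  \<open>c = 2\<close>, where a diagonal matrix remains, and with \<open>c = 3\<close>, where a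
  two-by-two block remains.\<close>

lemma reduce_support:
  fixes M :: "'r::comm_ring_1 ^ 'n::finite ^ 'n"
  assumes rows: "\<And>J k v. c \<le> card J \<Longrightarrow> k \<in> J \<Longrightarrow> (\<And>l. l \<notin> J \<Longrightarrow> v $ l = 0) \<Longrightarrow> unimodular UNIV v \<Longrightarrow>
      reach J UNIV v (axis k 1 :: 'r ^ 'n)"
    and M: "invertible M"
    and c: "c \<ge> 1"
  obtains P Q J where "P \<in> El UNIV UNIV" "Q \<in> El UNIV UNIV" "card J < c" "supported_on J (P ** M ** Q)"
proof -
  have "\<exists>P\<in>El UNIV UNIV. \<exists>Q\<in>El UNIV UNIV. \<exists>J. card J < c \<and> supported_on J (P ** M ** Q)"
    if "supported_on I M" "invertible M" for I and M :: "'r ^ 'n ^ 'n"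
    using that
  proof (induction "card I" arbitrary: I M rule: less_induct)
    case less
    show ?case
    proof (cases "card I < c")
      case True
      then show ?thesis
        using less by (intro bexI[of _ "mat 1"] exI[of _ I]) (auto intro: El.one)
    next
      case False
      then obtain i where i: "i \<in> I" using c by fastforce
      have "reach I UNIV (M $ i) (axis i 1)"
        using less.prems i False
        by (intro rows invertible_row_unimodular) (auto simp: supported_on_def)
      then obtain Q where Q: "Q \<in> El I UNIV" "(M ** Q) $ i = axis i 1"
        by (auto simp: reach_def row_matrix_mult)
      define N where "N = M ** Q"
      have sN: "supported_on I N"
        unfolding N_def using Q less by (blast intro: El_right_supported_on)
      have Ni: "N $ i $ l = (if l = i then 1 else 0)" for l
        unfolding N_def Q(2) by (simp add: axis_def)
      obtain P where P: "P \<in> El UNIV UNIV" "P ** N = (\<chi> k l. N $ k $ l +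
          (if k \<in> I - {i} then - N $ k $ i * N $ i $ l else 0))"
        using El_add_row_multiples[of i "I - {i}" N "\<lambda>k. - N $ k $ i"] by auto
      have e: "(P ** N) $ k $ l = N $ k $ l - (if k \<in> I - {i} \<and> l = i then N $ k $ i else 0)" for k l
        unfolding P(2) by (simp add: Ni)
      have sN': "N $ k $ l = (if k = l then 1 else 0)" if "k \<notin> I \<or> l \<notin> I" for k l
        using sN that by (simp only: supported_on_def)
      have "(P ** N) $ k $ l = (if k = l then 1 else 0)" if "k \<notin> I - {i} \<or> l \<notin> I - {i}" for k l
        unfolding e using that i by (cases "k = i"; cases "k \<in> I"; cases "l = i"; cases "l \<in> I")
          (simp_all add: Ni sN')
      then have s: "supported_on (I - {i}) (P ** (M ** Q))"
        unfolding N_def[symmetric] supported_on_def by blast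
      have "invertible (P ** (M ** Q))"
        using P Q less by (blast intro: invertible_mult invertible_El)
      moreover have "card (I - {i}) < card I"
        using i by (intro card_Diff1_less) simp_all
      ultimately obtain P' Q' J where "P' \<in> El UNIV UNIV" "Q' \<in> El UNIV UNIV" "card J < c"
        "supported_on J (P' ** (P ** (M ** Q)) ** Q')"
        using less(1)[OF _ s] by blast
      moreover have "P' ** (P ** (M ** Q)) ** Q' = (P' ** P) ** M ** (Q ** Q')"
        by (simp only: matrix_mul_assoc)
      moreover have "Q \<in> El UNIV UNIV" using Q by (blast intro: El_mono)
      ultimately show ?thesis
        using P by (metis El_mult)
    qed
  qed
  from this[of UNIV M] M that show ?thesis by auto
qed

section \<open>The group \<open>GE\<close>\<close>

lemma GL_group_simps [simp]:
  "A \<otimes>\<^bsub>GL_group\<^esub> B = A ** B" "\<one>\<^bsub>GL_group\<^esub> = mat 1" "A \<in> carrier GL_group \<longleftrightarrow> invertible A"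
  by (simp_all add: GL_group_def)

lemma inverse_in_GL_group:
  assumes "A ** B = mat 1" "B ** A = mat 1"
  shows "inv\<^bsub>GL_group\<^esub> A = B"
  using group.inv_equality[OF group_GL_group, of B A] assms by (auto simp: invertible_def)

lemma elementary_in_GE: "i \<noteq> j \<Longrightarrow> elementary_matrix i j r \<in> GE"
  unfolding GE_def by (rule generate.incl) auto

lemma diagonal_in_GE: "A \<in> diagonal_matrices \<Longrightarrow> invertible A \<Longrightarrow> A \<in> GE"
  unfolding GE_def by (rule generate.incl) auto

lemma GE_mult: "A \<in> GE \<Longrightarrow> B \<in> GE \<Longrightarrow> A ** B \<in> GE"
  unfolding GE_def using generate.eng by fastforce

lemma one_in_GE: "mat 1 \<in> GE"
  unfolding GE_def using generate.one[of GL_group] by simp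

lemma El_subset_GE: "El I S \<subseteq> GE"
proof
  fix M assume "M \<in> El I S"
  then show "M \<in> GE"
    by induction (auto intro!: GE_mult elementary_in_GE one_in_GE)
qed

lemma diagonal_inverse:
  fixes A :: "'r::comm_ring_1 ^ 'n::finite ^ 'n"
  assumes "A \<in> diagonal_matrices" "invertible A"
  obtains B where "B \<in> diagonal_matrices" "invertible B" "A ** B = mat 1" "B ** A = mat 1"
proof -
  obtain B where B: "A ** B = mat 1" "B ** A = mat 1"
    using assms by (auto simp: invertible_def)
  have "B \<in> diagonal_matrices"
    unfolding diagonal_matrices_def
  proof (clarify)
    fix i j :: 'n assume ij: "i \<noteq> j"
    have s: "(\<Sum>k\<in>UNIV. A $ i $ k * B $ k $ l) = A $ i $ i * B $ i $ l" for l
      using assms(1) by (subst sum.remove[of _ i]) (auto simp: diagonal_matrices_def intro!: sum.neutral)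
    have s': "(\<Sum>k\<in>UNIV. B $ l $ k * A $ k $ i) = B $ l $ i * A $ i $ i" for l
      using assms(1) by (subst sum.remove[of _ i]) (auto simp: diagonal_matrices_def intro!: sum.neutral)
    have "(A ** B) $ i $ j = 0" "(B ** A) $ i $ i = 1"
      using B ij by (simp_all add: mat_def)
    then have "A $ i $ i * B $ i $ j = 0" "B $ i $ i * A $ i $ i = 1"
      using s s' by (simp_all add: matrix_matrix_mult_def)
    then show "B $ i $ j = 0"
      by (metis mult.assoc mult_1 mult_zero_right)
  qed
  then show ?thesis using that B by (auto simp: invertible_def)
qed

text \<open>The generators are closed under inverses and the identity is diagonal, so the inverse
  and unit cases of \<open>generate\<close> disappear from the induction.\<close>

lemma GE_induct [consumes 1, case_names elementary diagonal mult]: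
  fixes A :: "'r::comm_ring_1 ^ 'n::finite ^ 'n"
  assumes "A \<in> GE"
    and elementary: "\<And>i j r. i \<noteq> j \<Longrightarrow> P (elementary_matrix i j r)"
    and diagonal: "\<And>D. D \<in> diagonal_matrices \<Longrightarrow> invertible D \<Longrightarrow> P D"
    and mult: "\<And>A B. A \<in> GE \<Longrightarrow> B \<in> GE \<Longrightarrow> P A \<Longrightarrow> P B \<Longrightarrow> P (A ** B)"
  shows "P A"
  using assms(1) unfolding GE_def
proof induction
  case one
  have "invertible (mat 1 :: 'r ^ 'n ^ 'n)"
    by (auto simp: invertible_def intro: exI[of _ "mat 1"])
  then show ?case
    by (auto intro!: diagonal simp: diagonal_matrices_def mat_def)
next
  case (incl A)
  then show ?case using elementary diagonal by auto
next
  case (inv A)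
  then consider "A \<in> diagonal_matrices" "invertible A"
    | i j r where "i \<noteq> j" "A = elementary_matrix i j r" by auto
  then show ?case
  proof cases
    case 1
    then show ?thesis using diagonal_inverse diagonal inverse_in_GL_group by metis
  next
    case 2
    then have "inv\<^bsub>GL_group\<^esub> A = elementary_matrix i j (- r)"
      by (intro inverse_in_GL_group) (simp_all add: elementary_matrix_add)
    then show ?thesis using 2 elementary by simp
  qed
next
  case (eng A B)
  then show ?case using mult unfolding GE_def by simp
qed

lemma invertible_GE: "A \<in> GE \<Longrightarrow> invertible A"
proof (induction rule: GE_induct)
  case (elementary i j r)
  have "elementary_matrix i j r \<in> El UNIV UNIV" using elementary by (intro El_elementary) auto
  then show ?case by (rule invertible_El)
qed (auto intro: invertible_mult)

lemma GE_inverse: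
  assumes "A \<in> GE" "A ** B = mat 1" "B ** A = mat 1"
  shows "B \<in> GE"
proof -
  let ?G = "{A \<in> diagonal_matrices. invertible A} \<union> {elementary_matrix i j r | i j r. i \<noteq> j}"
  have "?G \<subseteq> carrier (GL_group :: ('a ^ 'b ^ 'b) monoid)"
    using invertible_GE[OF elementary_in_GE] by auto
  then have "inv\<^bsub>GL_group\<^esub> A \<in> generate GL_group ?G"
    using assms(1) unfolding GE_def by (rule group.generate_m_inv_closed[OF group_GL_group])
  then show ?thesis
    using assms(2,3) by (simp add: GE_def inverse_in_GL_group)
qed

lemma GE_cancel:
  assumes "P \<in> El I S" "Q \<in> El J T" "P ** M ** Q \<in> GE"
  shows "M \<in> GE"
proof -
  obtain P' where P': "P' \<in> El UNIV UNIV" "P' ** P = mat 1"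
    using El_inverse[OF El_mono[OF assms(1), of UNIV UNIV]] by auto
  obtain Q' where Q': "Q' \<in> El UNIV UNIV" "Q ** Q' = mat 1"
    using El_inverse[OF El_mono[OF assms(2), of UNIV UNIV]] by auto
  have "M = (P' ** P) ** M ** (Q ** Q')" using P' Q' by simp
  also have "\<dots> = P' ** (P ** M ** Q) ** Q'" by (simp only: matrix_mul_assoc)
  also have "\<dots> \<in> GE" using P' Q' assms El_subset_GE by (blast intro: GE_mult)
  finally show ?thesis .
qed

section \<open>Change of rings\<close>

definition unital_ring_hom :: "('r::comm_ring_1 \<Rightarrow> 's::comm_ring_1) \<Rightarrow> bool"
  where "unital_ring_hom h \<longleftrightarrow> h 1 = 1 \<and> (\<forall>a b. h (a + b) = h a + h b \<and> h (a * b) = h a * h b)"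

lemma unital_ring_homD:
  assumes "unital_ring_hom h"
  shows "h 1 = 1" "h 0 = 0" "h (a + b) = h a + h b" "h (a * b) = h a * h b" "h (- a) = - h a"
    "h (a - b) = h a - h b" "h (sum f T) = (\<Sum>t\<in>T. h (f t))"
proof -
  show "h 1 = 1" "h (a * b) = h a * h b" using assms by (auto simp: unital_ring_hom_def)
  show add: "h (a + b) = h a + h b" for a b using assms by (auto simp: unital_ring_hom_def)
  show z: "h 0 = 0" using add[of 0 0] by simp
  show m: "h (- a) = - h a" for a using add[of a "- a"] z by (simp add: eq_neg_iff_add_eq_0 add.commute)
  show "h (a - b) = h a - h b" using add[of a "- b"] m by simp
  show "h (sum f T) = (\<Sum>t\<in>T. h (f t))"
    by (induction T rule: infinite_finite_induct) (auto simp: add z)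
qed

lemma map_matrix_mult:
  fixes M N :: "'r::comm_ring_1 ^ 'n::finite ^ 'n"
  assumes "unital_ring_hom h"
  shows "map_matrix h (M ** N) = map_matrix h M ** map_matrix h N"
  by (simp add: vec_eq_iff matrix_matrix_mult_def unital_ring_homD[OF assms])

lemma map_matrix_one:
  assumes "unital_ring_hom h"
  shows "map_matrix h (mat 1) = mat 1"
  by (simp add: vec_eq_iff mat_def unital_ring_homD[OF assms])

lemma map_matrix_elementary:
  assumes "unital_ring_hom h"
  shows "map_matrix h (elementary_matrix i j r) = elementary_matrix i j (h r)"
  by (simp add: vec_eq_iff elementary_matrix_nth unital_ring_homD[OF assms])

lemma map_matrix_El:
  assumes "unital_ring_hom h" "M \<in> El I S"
  shows "map_matrix h M \<in> El I (h ` S)"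
  using assms(2)
  by induction
    (auto simp: map_matrix_one map_matrix_mult map_matrix_elementary assms(1) intro: El.intros)

lemma invertible_map_matrix:
  fixes M :: "'r::comm_ring_1 ^ 'n::finite ^ 'n"
  assumes "unital_ring_hom h" "invertible M"
  shows "invertible (map_matrix h M)"
proof -
  obtain N where N: "M ** N = mat 1" "N ** M = mat 1" using assms(2) by (auto simp: invertible_def)
  have "map_matrix h (M ** N) = mat 1" "map_matrix h (N ** M) = mat 1"
    by (simp_all only: N map_matrix_one[OF assms(1)])
  then have "map_matrix h M ** map_matrix h N = mat 1" "map_matrix h N ** map_matrix h M = mat 1"
    by (simp_all only: map_matrix_mult[OF assms(1)])
  then show ?thesis by (auto simp: invertible_def)
qed

lemma map_matrix_GE:
  assumes "unital_ring_hom h" "M \<in> GE"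
  shows "map_matrix h M \<in> GE"
  using assms(2)
proof (induction rule: GE_induct)
  case (diagonal D)
  then show ?case
    using unital_ring_homD[OF assms(1)]
    by (intro diagonal_in_GE invertible_map_matrix assms(1)) (auto simp: diagonal_matrices_def)
qed (auto simp: map_matrix_elementary map_matrix_mult assms(1) elementary_in_GE GE_mult)

section \<open>Matrices over \<open>K[x]\<close>\<close>

text \<open>Euclid's algorithm: while two entries are nonzero, the one of larger degree is replaced
  by its remainder modulo the other. The measure gives a nonzero constant the weight 1 and zero the
  weight 0, so that killing a constant also counts as progress. A single remaining nonzero entry is
  a unit by unimodularity.\<close>

lemma reach_unimodular_poly:
  fixes v :: "'k::field poly ^ 'n::finite"
  assumes "card I \<ge> 2" "k \<in> I" "\<And>l. l \<notin> I \<Longrightarrow> v $ l = 0" "unimodular UNIV v"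
  shows "reach I UNIV v (axis k 1)"
  using assms(3,4)
proof (induction "\<Sum>l\<in>UNIV. if v $ l = 0 then 0 else Suc (degree (v $ l))" arbitrary: v rule: less_induct)
  case less
  show ?case
  proof (cases "\<exists>i j. i \<noteq> j \<and> v $ i \<noteq> 0 \<and> v $ j \<noteq> 0")
    case True
    then obtain i j where ij: "i \<noteq> j" "v $ i \<noteq> 0" "v $ j \<noteq> 0" "degree (v $ i) \<le> degree (v $ j)"
      by (metis linear)
    then have "i \<in> I" "j \<in> I" using less.prems by blast+
    define w where "w = (\<chi> l. v $ l + (if l = j then v $ i * (- (v $ j div v $ i)) else 0))"
    have wj: "w $ j = v $ j mod v $ i"
      by (simp add: w_def minus_mult_div_eq_mod)
    have eq: "w $ l = v $ l" if "l \<noteq> j" for l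
      using that by (simp add: w_def)
    have r: "reach I UNIV v w"
      unfolding w_def using ij \<open>i \<in> I\<close> \<open>j \<in> I\<close> by (intro reach_elementary) auto
    let ?m = "\<lambda>p::'k poly. if p = 0 then 0 else Suc (degree p)"
    have lt: "?m (w $ j) < ?m (v $ j)"
      unfolding wj using degree_mod_less[of "v $ i" "v $ j"] ij by auto
    moreover have "?m (w $ l) \<le> ?m (v $ l)" for l
      using lt eq[of l] by (cases "l = j") (simp_all split: if_splits)
    ultimately have "(\<Sum>l\<in>UNIV. ?m (w $ l)) < (\<Sum>l\<in>UNIV. ?m (v $ l))"
      by (intro sum_strict_mono_ex1 ballI bexI[of _ j]) (simp_all only: finite UNIV_I)
    moreover have "\<And>l. l \<notin> I \<Longrightarrow> w $ l = 0"
      using less.prems(1) \<open>j \<in> I\<close> eq by metis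
    moreover have "unimodular UNIV w"
      using unimodular_reach[OF r less.prems(2)] by simp
    ultimately have "reach I UNIV w (axis k 1)"
      using less.hyps by blast
    with r show ?thesis by (rule reach_trans)
  next
    case False
    obtain w where w: "(\<Sum>i\<in>UNIV. v $ i * w $ i) = 1"
      using less.prems(2) by (auto simp: unimodular_def)
    have "\<exists>i. v $ i \<noteq> 0"
    proof (rule ccontr)
      assume "\<nexists>i. v $ i \<noteq> 0"
      with w show False by simp
    qed
    then obtain i where i: "v $ i \<noteq> 0" by blast
    have "v $ l = 0" if "l \<noteq> i" for l
      using False i that by blast
    then have "(\<Sum>l\<in>UNIV. v $ l * w $ l) = v $ i * w $ i"
      by (subst sum.remove[of _ i]) (auto intro!: sum.neutral)
    with w have "v $ i * w $ i = 1" by simp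
    then show ?thesis
      using i less.prems assms(1,2) by (intro reach_axis_of_unit[of i I k v "w $ i"]) auto
  qed
qed

lemma supported_on_diagonal:
  assumes "supported_on J M" "card J \<le> 1"
  shows "M \<in> diagonal_matrices"
proof -
  have "k \<notin> J \<or> l \<notin> J" if "k \<noteq> l" for k l
    using assms(2) that card_le_Suc0_iff_eq[of J] by auto
  then show ?thesis using assms(1) by (auto simp: diagonal_matrices_def supported_on_def)
qed

theorem GL_poly_eq_GE:
  fixes M :: "'k::field poly ^ 'n::finite ^ 'n"
  assumes "invertible M"
  shows "M \<in> GE"
proof -
  have rows: "reach J UNIV v (axis k 1)"
    if "2 \<le> card J" "k \<in> J" "\<And>l. l \<notin> J \<Longrightarrow> v $ l = 0" "unimodular UNIV v"
    for J k and v :: "'k poly ^ 'n"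
    using that by (rule reach_unimodular_poly)
  obtain P Q J where PQ: "P \<in> El UNIV UNIV" "Q \<in> El UNIV UNIV" "card J < 2"
      "supported_on J (P ** M ** Q)"
    by (rule reduce_support[OF rows assms one_le_numeral])
  have "invertible (P ** M ** Q)"
    using PQ(1,2) assms by (intro invertible_mult) (auto intro: invertible_El)
  moreover have "P ** M ** Q \<in> diagonal_matrices"
    using PQ(3) by (intro supported_on_diagonal[OF PQ(4)]) simp
  ultimately have "P ** M ** Q \<in> GE"
    by (intro diagonal_in_GE)
  with PQ(1,2) show ?thesis by (rule GE_cancel)
qed

section \<open>Two-by-two blocks and Mennicke symbols\<close>

definition block :: "'n \<Rightarrow> 'n \<Rightarrow> 'r \<Rightarrow> 'r \<Rightarrow> 'r \<Rightarrow> 'r \<Rightarrow> 'r::comm_ring_1 ^ 'n::finite ^ 'n"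
  where "block i j a b c d = (\<chi> k l.
    if k = i then (if l = i then a else if l = j then b else 0)
    else if k = j then (if l = i then c else if l = j then d else 0)
    else if k = l then 1 else 0)"

lemma block_right_elementary:
  assumes "i \<noteq> j"
  shows "block i j a b c d ** elementary_matrix i j r = block i j a (b + a * r) c (d + c * r)"
    and "block i j a b c d ** elementary_matrix j i r = block i j (a + b * r) b (c + d * r) d"
  using assms by (auto simp: vec_eq_iff matrix_mult_elementary_nth block_def)

lemma block_left_elementary:
  assumes "i \<noteq> j"
  shows "elementary_matrix i j r ** block i j a b c d = block i j (a + r * c) (b + r * d) c d"
    and "elementary_matrix j i r ** block i j a b c d = block i j a b (c + r * a) (d + r * b)"
  using assms by (auto simp: vec_eq_iff elementary_mult_matrix_nth block_def)

lemma block_eq_elementary: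
  assumes "i \<noteq> j"
  shows "block i j 1 0 c 1 = elementary_matrix j i c"
  using assms by (auto simp: vec_eq_iff elementary_matrix_nth block_def)

lemma block_mult_nth:
  assumes "i \<noteq> j"
  shows "(block i j a b c d ** M) $ k $ l =
    (if k = i then a * M $ i $ l + b * M $ j $ l
     else if k = j then c * M $ i $ l + d * M $ j $ l else M $ k $ l)"
proof -
  have "(block i j a b c d ** M) $ k $ l =
    (\<Sum>m\<in>UNIV. (if m = i then (if k = i then a * M $ m $ l else if k = j then c * M $ m $ l else 0) else 0) +
      (if m = j then (if k = i then b * M $ m $ l else if k = j then d * M $ m $ l else 0) else 0) +
      (if m = k then (if k \<noteq> i \<and> k \<noteq> j then M $ m $ l else 0) else 0))"
    unfolding matrix_matrix_mult_def vec_lambda_beta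
    using assms by (intro sum.cong refl) (auto simp: block_def)
  then show ?thesis using assms by (simp add: sum.distrib)
qed

lemma El_cancel:
  assumes "P \<in> El I S" "Q \<in> El I S" "P ** M ** Q \<in> El I S" "unital_subring S"
  shows "M \<in> El I S"
proof -
  obtain P' where P': "P' \<in> El I S" "P' ** P = mat 1"
    using El_inverse[OF assms(1)] unital_subringD[OF assms(4)] by metis
  obtain Q' where Q': "Q' \<in> El I S" "Q ** Q' = mat 1"
    using El_inverse[OF assms(2)] unital_subringD[OF assms(4)] by metis
  have "M = (P' ** P) ** M ** (Q ** Q')" using P' Q' by simp
  also have "\<dots> = P' ** (P ** M ** Q) ** Q'" by (simp only: matrix_mul_assoc)
  also have "\<dots> \<in> El I S" using P' Q' assms by (blast intro: El_mult)
  finally show ?thesis .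
qed

text \<open>The condition says that the Mennicke symbol of \<open>a\<close> and \<open>b\<close> is trivial.\<close>

definition trivial_symbol :: "'n::finite set \<Rightarrow> 'r::comm_ring_1 set \<Rightarrow> 'r \<Rightarrow> 'r \<Rightarrow> bool"
  where "trivial_symbol I S a b \<longleftrightarrow>
    (\<forall>i\<in>I. \<forall>j\<in>I. \<forall>c\<in>S. \<forall>d\<in>S. i \<noteq> j \<longrightarrow> a * d - b * c = 1 \<longrightarrow> block i j a b c d \<in> El I S)"

text \<open>A column operation inside the block: the symbol depends on \<open>b\<close> only modulo
  \<open>a\<close>. The next lemma exchanges the roles.\<close>

lemma trivial_symbol_shift_right:
  assumes "trivial_symbol I S a (b + a * r)" "r \<in> S" "unital_subring S"
  shows "trivial_symbol I S a b"
  unfolding trivial_symbol_def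
proof (intro ballI impI)
  fix i j c d assume *: "i \<in> I" "j \<in> I" "c \<in> S" "d \<in> S" "i \<noteq> j" "a * d - b * c = 1"
  note S = unital_subringD[OF assms(3)]
  have "mat 1 ** block i j a b c d ** elementary_matrix i j r = block i j a (b + a * r) c (d + c * r)"
    using * by (simp add: block_right_elementary)
  also have "\<dots> \<in> El I S"
    using assms(1,2) * S by (simp add: trivial_symbol_def algebra_simps)
  finally show "block i j a b c d \<in> El I S"
    using * assms by (auto intro: El_cancel[of "mat 1", OF El.one El_elementary[of i I j r]])
qed

lemma trivial_symbol_shift_left:
  assumes "trivial_symbol I S (a + b * r) b" "r \<in> S" "unital_subring S"
  shows "trivial_symbol I S a b"
  unfolding trivial_symbol_def
proof (intro ballI impI)
  fix i j c d assume *: "i \<in> I" "j \<in> I" "c \<in> S" "d \<in> S" "i \<noteq> j" "a * d - b * c = 1"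
  note S = unital_subringD[OF assms(3)]
  have "mat 1 ** block i j a b c d ** elementary_matrix j i r = block i j (a + b * r) b (c + d * r) d"
    using * by (simp add: block_right_elementary)
  also have "\<dots> \<in> El I S"
    using assms(1,2) * S by (simp add: trivial_symbol_def algebra_simps)
  finally show "block i j a b c d \<in> El I S"
    using * assms by (auto intro: El_cancel[of "mat 1", OF El.one El_elementary[of j I i r]])
qed

text \<open>A unit \<open>b\<close> moves \<open>a\<close> to 1, after which \<open>b\<close> can be
  moved to 0; a block with first row \<open>(1, 0)\<close> and determinant one is an elementary
  matrix.\<close>

lemma trivial_symbol_unit_right:
  assumes "b * u = 1" "a \<in> S" "b \<in> S" "u \<in> S" "unital_subring S"
  shows "trivial_symbol I S a b"
proof -
  note S = unital_subringD[OF assms(5)]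
  have "trivial_symbol I S 1 0"
    unfolding trivial_symbol_def
  proof (intro ballI impI)
    fix i j c d assume *: "i \<in> I" "j \<in> I" "c \<in> S" "d \<in> S" "i \<noteq> j" "1 * d - 0 * c = 1"
    then have "block i j 1 0 c d = elementary_matrix j i c" by (simp add: block_eq_elementary)
    with * show "block i j 1 0 c d \<in> El I S" by (simp add: El_elementary)
  qed
  then have "trivial_symbol I S 1 b"
    using assms S by (intro trivial_symbol_shift_right[of I S 1 b "- b"]) auto
  moreover have "a + b * (u * (1 - a)) = 1"
    using assms(1) by (simp flip: mult.assoc)
  ultimately show ?thesis
    using assms S by (intro trivial_symbol_shift_left[of I S a b "u * (1 - a)"]) auto
qed

lemma trivial_symbol_unit_left:
  assumes "a * u = 1" "a \<in> S" "b \<in> S" "u \<in> S" "unital_subring S"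
  shows "trivial_symbol I S a b"
proof -
  note S = unital_subringD[OF assms(5)]
  have "trivial_symbol I S a 1"
    using assms S by (intro trivial_symbol_unit_right[of 1 1]) auto
  moreover have "b + a * (u * (1 - b)) = 1"
    using assms(1) by (simp flip: mult.assoc)
  ultimately show ?thesis
    using assms S by (intro trivial_symbol_shift_right[of I S a b "u * (1 - b)"]) auto
qed

text \<open>Multiplicativity of the Mennicke symbol as an explicit identity. The second block sits
  at \<open>(i, m)\<close>. The factor with \<open>d2\<close> builds the new second row in row
  \<open>m\<close>, the factors with entries 1, -1, 1 exchange the rows \<open>j\<close> and
  \<open>m\<close> up to sign, and the three factors on the right clear column \<open>m\<close> and
  then row \<open>m\<close>.\<close>

lemma block_product:
  fixes a1 :: "'r::comm_ring_1" and i j m :: "'n::finite"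
  assumes "i \<noteq> j" "i \<noteq> m" "j \<noteq> m" "a1 * d1 - b * c1 = 1"
  shows "elementary_matrix j m 1 ** (elementary_matrix m j (- 1) ** (elementary_matrix j m 1 **
      (elementary_matrix m j d2 ** (block i j a1 b c1 d1 ** block i m a2 b c2 d2)))) **
      elementary_matrix j m (- a1) ** elementary_matrix m i (c1 * a2) ** elementary_matrix m j d1 =
    block i j (a1 * a2) b (c2 + c1 * a2 * d2) (d1 * d2)"
proof -
  define N where "N = block i j a1 b c1 d1 ** block i m a2 b c2 d2"
  have N: "N $ k $ l =
    (if k = i then (if l = i then a1 * a2 else if l = j then b else if l = m then a1 * b else 0)
     else if k = j then (if l = i then c1 * a2 else if l = j then d1 else if l = m then c1 * b else 0)
     else if k = m then (if l = i then c2 else if l = m then d2 else 0)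
     else if k = l then 1 else 0)" for k l
    unfolding N_def block_mult_nth[OF assms(1)] using assms(1-3) by (auto simp: block_def)
  have ad: "a1 * d1 = 1 + b * c1" using assms(4) by (simp add: algebra_simps)
  have add: "a1 * (d1 * d2) = d2 + b * (c1 * d2)"
    unfolding mult.assoc[symmetric] ad by (simp add: algebra_simps)
  define N' where "N' = elementary_matrix m j d2 ** N"
  have N': "N' $ k $ l =
    (if k = i then (if l = i then a1 * a2 else if l = j then b else if l = m then a1 * b else 0)
     else if k = j then (if l = i then c1 * a2 else if l = j then d1 else if l = m then a1 * d1 - 1 else 0)
     else if k = m then (if l = i then c2 + c1 * a2 * d2 else if l = j then d1 * d2 else if l = m then a1 * d1 * d2 else 0)
     else if k = l then 1 else 0)" for k l
    unfolding N'_def elementary_mult_matrix_nth N using assms(1-3) by (auto simp: ad add algebra_simps)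
  define W where "W = elementary_matrix j m 1 ** (elementary_matrix m j (- 1) ** (elementary_matrix j m 1 ** N'))"
  have W: "W $ k $ l = (if k = j then N' $ m $ l else if k = m then - N' $ j $ l else N' $ k $ l)" for k l
    unfolding W_def elementary_mult_matrix_nth using assms(1-3) by auto
  show ?thesis
    unfolding N_def[symmetric] N'_def[symmetric] W_def[symmetric]
    using assms(1-3)
    by (auto simp: vec_eq_iff matrix_mult_elementary_nth W N' block_def algebra_simps)
qed

lemma trivial_symbol_mult:
  assumes "trivial_symbol I S a1 b" "trivial_symbol I S a2 b" "a1 \<in> S" "a2 \<in> S" "b \<in> S"
    "unital_subring S" "card I \<ge> 3"
  shows "trivial_symbol I S (a1 * a2) b"
  unfolding trivial_symbol_def
proof (intro ballI impI)
  fix i j c d assume *: "i \<in> I" "j \<in> I" "c \<in> S" "d \<in> S" "i \<noteq> j" "a1 * a2 * d - b * c = 1"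
  note S = unital_subringD[OF assms(6)]
  have "\<not> I \<subseteq> {i, j}"
    using card_mono[of "{i, j}" I] assms(7) * by auto
  then obtain m where m: "m \<in> I" "m \<noteq> i" "m \<noteq> j" by blast
  \<comment> \<open>Both blocks share \<open>c\<close>, and \<open>d\<close> is multiplied by the
    factor that the block lacks; so both determinants equal
    \<open>a1 * a2 * d - b * c\<close>.\<close>
  have "block i j a1 b c (a2 * d) \<in> El I S" "block i m a2 b c (a1 * d) \<in> El I S"
    using assms * m S by (simp_all add: trivial_symbol_def algebra_simps)
  moreover have "a1 * (a2 * d) - b * c = 1" using * by (simp add: algebra_simps)
  then have "block i j (a1 * a2) b (c + c * a2 * (a1 * d)) ((a2 * d) * (a1 * d)) =
      elementary_matrix j m 1 ** (elementary_matrix m j (- 1) ** (elementary_matrix j m 1 **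
      (elementary_matrix m j (a1 * d) ** (block i j a1 b c (a2 * d) ** block i m a2 b c (a1 * d))))) **
      elementary_matrix j m (- a1) ** elementary_matrix m i (c * a2) ** elementary_matrix m j (a2 * d)"
    using m * by (subst block_product) auto
  ultimately have M: "block i j (a1 * a2) b (c + c * a2 * (a1 * d)) ((a2 * d) * (a1 * d)) \<in> El I S"
    using m * assms S by (simp only:) (intro El_mult El_elementary; auto)
  \<comment> \<open>Two second rows that complete the same first row to determinant one differ by a
    multiple of the first row; here the factor is \<open>- c * d\<close>.\<close>
  let ?t = "- c * d"
  have "c + c * a2 * (a1 * d) + ?t * (a1 * a2) = c" by (simp add: algebra_simps)
  moreover have "a1 * a2 * d * d = d + b * c * d"
    using arg_cong[OF *(6), of "\<lambda>x. x * d"] by (simp add: algebra_simps)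
  then have "a2 * d * (a1 * d) + ?t * b = d" by (simp add: algebra_simps)
  ultimately have "block i j (a1 * a2) b c d =
    elementary_matrix j i ?t ** block i j (a1 * a2) b (c + c * a2 * (a1 * d)) ((a2 * d) * (a1 * d))"
    using * by (simp add: block_left_elementary)
  also have "\<dots> \<in> El I S"
    using M * S by (intro El_mult El_elementary) auto
  finally show "block i j (a1 * a2) b c d \<in> El I S" .
qed

section \<open>Polynomials over a local subring of a field\<close>

text \<open>\<open>local\<close> says that a sum of non-units is a non-unit, so that the non-units
  form the maximal ideal; inverses are taken in the surrounding field. The residue field is never
  formed: statements about it become statements about which coefficients are units.\<close>

locale local_subring =
  fixes S :: "'l::field set"
  assumes subring: "unital_subring S"
    and local: "a \<in> S \<Longrightarrow> b \<in> S \<Longrightarrow> a + b \<noteq> 0 \<Longrightarrow> inverse (a + b) \<in> S \<Longrightarrow>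
      (a \<noteq> 0 \<and> inverse a \<in> S) \<or> (b \<noteq> 0 \<and> inverse b \<in> S)"
begin

lemmas S = unital_subringD[OF subring]

definition unit :: "'l \<Rightarrow> bool"
  where "unit a \<longleftrightarrow> a \<in> S \<and> a \<noteq> 0 \<and> inverse a \<in> S"

definition polys :: "'l poly set"
  where "polys = {p. \<forall>k. coeff p k \<in> S}"

lemma sum_S: "(\<And>x. x \<in> A \<Longrightarrow> f x \<in> S) \<Longrightarrow> sum f A \<in> S"
  by (induction A rule: infinite_finite_induct) (auto intro: S)

lemma subring_polys: "unital_subring polys"
  unfolding unital_subring_def polys_def
  by (auto simp: coeff_mult coeff_pCons one_pCons split: nat.split intro: S sum_S)

lemmas polys = unital_subringD[OF subring_polys]

lemma coeff_polys: "p \<in> polys \<Longrightarrow> coeff p k \<in> S"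
  by (simp add: polys_def)

lemma const_polys: "a \<in> S \<Longrightarrow> [:a:] \<in> polys"
  by (auto simp: polys_def coeff_pCons S split: nat.split)

lemma pCons_polys: "a \<in> S \<Longrightarrow> p \<in> polys \<Longrightarrow> pCons a p \<in> polys"
  by (auto simp: polys_def coeff_pCons split: nat.split)

lemma smult_polys: "a \<in> S \<Longrightarrow> p \<in> polys \<Longrightarrow> smult a p \<in> polys"
  by (auto simp: polys_def S)

lemma monom_polys: "a \<in> S \<Longrightarrow> monom a n \<in> polys"
  by (auto simp: polys_def S)

lemma unit_S: "unit a \<Longrightarrow> a \<in> S" "unit a \<Longrightarrow> inverse a \<in> S" "unit a \<Longrightarrow> a \<noteq> 0"
  by (simp_all add: unit_def)

lemma divide_S: "a \<in> S \<Longrightarrow> unit b \<Longrightarrow> a / b \<in> S"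
  by (simp add: divide_inverse S unit_S)

lemma unit_1 [simp]: "unit 1"
  by (simp add: unit_def S)

lemma not_unit_0 [simp]: "\<not> unit 0"
  by (simp add: unit_def)

lemma unit_mult: "unit a \<Longrightarrow> unit b \<Longrightarrow> unit (a * b)"
  by (simp add: unit_def S)

lemma unit_multD:
  assumes "a \<in> S" "b \<in> S" "unit (a * b)"
  shows "unit a"
proof -
  have "inverse a = b * inverse (a * b)" using assms(3) by (auto simp: unit_def)
  then show ?thesis using assms S by (auto simp: unit_def simp del: inverse_mult_distrib)
qed

lemma unit_uminus [simp]: "unit (- a) \<longleftrightarrow> unit a"
  using S(5)[of a] S(5)[of "- a"] S(5)[of "inverse a"] S(5)[of "- inverse a"] by (auto simp: unit_def)

lemma unit_addD: "a \<in> S \<Longrightarrow> b \<in> S \<Longrightarrow> unit (a + b) \<Longrightarrow> unit a \<or> unit b"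
  using local by (auto simp: unit_def)

lemma unit_add_nonunit:
  assumes "unit a" "b \<in> S" "\<not> unit b"
  shows "unit (a + b)"
  using unit_addD[of "a + b" "- b"] assms S by (auto simp: unit_S)

lemma nonunit_sum:
  assumes "\<And>x. x \<in> A \<Longrightarrow> f x \<in> S" "\<And>x. x \<in> A \<Longrightarrow> \<not> unit (f x)"
  shows "\<not> unit (sum f A)"
  using assms
proof (induction A rule: infinite_finite_induct)
  case (insert x A)
  then show ?case using unit_addD[of "f x" "sum f A"] sum_S[of A f] by auto
qed auto

text \<open>The polynomials with only non-unit coefficients are the kernel of the reduction to the
  residue field, hence an ideal.\<close>

lemma nonunit_coeff_mult:
  assumes "p \<in> polys" "q \<in> polys" "\<And>k. \<not> unit (coeff p k)"
  shows "\<not> unit (coeff (p * q) k)"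
  unfolding coeff_mult
proof (rule nonunit_sum)
  fix m assume "m \<in> {..k}"
  show "coeff p m * coeff q (k - m) \<in> S" "\<not> unit (coeff p m * coeff q (k - m))"
    using assms by (auto intro: S coeff_polys dest: unit_multD[rotated 2])
qed

text \<open>Division with remainder by \<open>f\<close>. The bound on the remainder is expressed by
  coefficients because the zero polynomial has \<open>degree\<close> 0, which would spoil a strict
  inequality when \<open>f\<close> is constant.\<close>

lemma polys_division:
  assumes "f \<in> polys" "unit (lead_coeff f)" "g \<in> polys"
  obtains h where "h \<in> polys" "\<And>k. k \<ge> degree f \<Longrightarrow> coeff (g + f * h) k = 0"
proof -
  have "\<exists>h\<in>polys. \<forall>k\<ge>degree f. coeff (g + f * h) k = 0"
    if "g \<in> polys" "\<And>k. k \<ge> degree f + n \<Longrightarrow> coeff g k = 0" for n g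
    using that
  proof (induction n arbitrary: g)
    case 0
    then show ?case by (intro bexI[of _ 0]) (auto intro: polys)
  next
    case (Suc n)
    let ?h = "monom (- (coeff g (degree f + n) / lead_coeff f)) n"
    have "f \<noteq> 0" using assms(2) by auto
    have h: "?h \<in> polys" using Suc assms by (intro monom_polys S divide_S) (auto intro: coeff_polys)
    have vanish: "coeff (g + f * ?h) k = 0" if "k \<ge> degree f + n" for k
    proof (cases "k = degree f + n")
      case True
      then show ?thesis
        using \<open>f \<noteq> 0\<close> by (simp add: coeff_monom_mult mult.commute[of f])
    next
      case False
      then show ?thesis
        using that Suc.prems(2)[of k] by (simp add: coeff_monom_mult mult.commute[of f] coeff_eq_0)
    qed
    have "g + f * ?h \<in> polys"
      using Suc.prems(1) h assms(1) by (intro polys(4,6))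
    from Suc.IH[OF this vanish] obtain h' where
      h': "h' \<in> polys" "\<forall>k\<ge>degree f. coeff (g + f * ?h + f * h') k = 0" by blast
    have "g + f * ?h + f * h' = g + f * (?h + h')"
      by (simp only: distrib_left add.assoc)
    with h' h show ?case
      by (intro bexI[of _ "?h + h'"]) (simp_all only: polys(6))
  qed
  from this[of g "Suc (degree g)"] that assms(3) show ?thesis
    by (auto simp: coeff_eq_0)
qed

text \<open>A unit coefficient of \<open>g\<close> climbs to the position just below the degree of
  \<open>f\<close>: multiply by the variable, reduce modulo \<open>f\<close>, repeat. If the top
  coefficient of \<open>g\<close> is a unit, nothing has to be done; otherwise \<open>f\<close> is
  subtracted with a non-unit factor, and the unit coefficient survives the subtraction.\<close>

lemma exists_lower_degree:
  assumes "f \<in> polys" "unit (lead_coeff f)" "g \<in> polys" "\<And>k. k \<ge> degree f \<Longrightarrow> coeff g k = 0"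
    "unit (coeff g k)"
  obtains a b where "a \<in> polys" "b \<in> polys" "\<And>k. k \<ge> degree f \<Longrightarrow> coeff (f * a + g * b) k = 0"
    "unit (coeff (f * a + g * b) (degree f - 1))"
proof -
  have "\<exists>a\<in>polys. \<exists>b\<in>polys. (\<forall>k\<ge>degree f. coeff (f * a + g * b) k = 0) \<and>
      unit (coeff (f * a + g * b) (degree f - 1))"
    if "g \<in> polys" "\<And>k. k \<ge> degree f \<Longrightarrow> coeff g k = 0" "unit (coeff g k)" for g k
    using that
  proof (induction "degree f - k" arbitrary: g k rule: less_induct)
    case less
    have "k < degree f" using less.prems by (metis not_le not_unit_0)
    show ?case
    proof (cases "unit (coeff g (degree f - 1))")
      case True
      then show ?thesis using less.prems polys by (intro bexI[of _ 0] bexI[of _ 1]) auto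
    next
      case False
      let ?c = "coeff g (degree f - 1) / lead_coeff f"
      let ?g = "pCons 0 g - smult ?c f"
      have "?c * lead_coeff f = coeff g (degree f - 1)"
        using unit_S(3)[OF assms(2)] by simp
      note cf = this
      then have c: "?c \<in> S" "\<not> unit ?c"
        using False assms(2) less.prems(1) unit_mult[of ?c "lead_coeff f"]
        by (auto intro: divide_S coeff_polys)
      have "?g \<in> polys"
        using c assms less.prems by (intro polys(3) pCons_polys smult_polys) (auto intro: S)
      moreover have "coeff ?g n = 0" if "n \<ge> degree f" for n
      proof (cases n)
        case (Suc m)
        show ?thesis
        proof (cases "n = degree f")
          case True
          then have "degree f - 1 = m" "coeff f (Suc m) = lead_coeff f" using Suc by simp_all
          with cf show ?thesis
            unfolding Suc by (simp only: coeff_diff coeff_pCons_Suc coeff_smult diff_self)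
        next
          case False
          then show ?thesis using that less.prems(2)[of m] Suc by (simp add: coeff_eq_0)
        qed
      qed (use that \<open>k < degree f\<close> in simp)
      moreover have "unit (coeff ?g (Suc k))"
      proof -
        have "\<not> unit (?c * coeff f (Suc k))"
          using c assms unit_multD coeff_polys by blast
        moreover have "- (?c * coeff f (Suc k)) \<in> S"
          using c assms(1) by (intro S(4,5) coeff_polys)
        ultimately have "unit (coeff g k + - (?c * coeff f (Suc k)))"
          using less.prems(3) by (intro unit_add_nonunit) (simp_all only: unit_uminus not_False_eq_True)
        then show ?thesis
          by (simp only: coeff_diff coeff_pCons_Suc coeff_smult add_uminus_conv_diff)
      qed
      moreover have "degree f - Suc k < degree f - k" using \<open>k < degree f\<close> by simp
      ultimately obtain a b where ab: "a \<in> polys" "b \<in> polys"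
        "\<forall>k\<ge>degree f. coeff (f * a + ?g * b) k = 0" "unit (coeff (f * a + ?g * b) (degree f - 1))"
        using less.hyps by blast
      have "f * (a - smult ?c b) + g * pCons 0 b = f * a + ?g * b"
        by (simp add: algebra_simps)
      then show ?thesis
        using ab c by (intro bexI[of _ "a - smult ?c b"] bexI[of _ "pCons 0 b"])
          (simp_all only:, auto intro: polys smult_polys pCons_polys S)
    qed
  qed
  then show ?thesis using assms that by blast
qed

text \<open>If all other entries vanished over the residue field, \<open>v $ i\<close> would become
  a unit of a polynomial ring over a field, although its unit leading coefficient keeps its degree
  positive.\<close>

lemma exists_unit_coeff:
  assumes "unimodular polys v" "\<And>l. v $ l \<in> polys" "unit (lead_coeff (v $ i))" "degree (v $ i) > 0"
  shows "\<exists>j k. j \<noteq> i \<and> unit (coeff (v $ j) k)"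
proof (rule ccontr)
  assume contra: "\<not> ?thesis"
  obtain w where w: "\<And>l. w $ l \<in> polys" "(\<Sum>l\<in>UNIV. v $ l * w $ l) = 1"
    using assms(1) by (auto simp: unimodular_def)
  define u where "u = w $ i"
  define f where "f = v $ i"
  define s where "s = (\<Sum>l\<in>UNIV - {i}. v $ l * w $ l)"
  have fu: "f * u + s = 1"
    using w(2) by (simp add: f_def u_def s_def sum.remove[of UNIV i])
  have nu: "\<not> unit (coeff (v $ l * w $ l) k)" if "l \<noteq> i" for l k
    by (rule nonunit_coeff_mult) (use contra assms(2) w(1) that in auto)
  have vw: "coeff (v $ l * w $ l) k \<in> S" for l k
    using assms(2) w(1) by (intro coeff_polys polys)
  have s: "coeff s k \<in> S" "\<not> unit (coeff s k)" for k
    unfolding s_def coeff_sum by (intro sum_S vw) (rule nonunit_sum[OF vw nu], simp)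
  have u: "u \<in> polys" and f: "f \<in> polys" "unit (lead_coeff f)" "degree f > 0"
    using w assms by (auto simp: u_def f_def)
  have ex: "\<exists>k. unit (coeff u k)"
  proof (rule ccontr)
    assume "\<nexists>k. unit (coeff u k)"
    then have "\<not> unit (coeff (u * f) 0)" using u f by (intro nonunit_coeff_mult) auto
    moreover have "coeff (f * u) 0 + coeff s 0 = 1" using fu by (metis coeff_add lead_coeff_1 degree_1)
    then have "unit (coeff (f * u) 0 + coeff s 0)" by simp
    ultimately show False
      using unit_addD[of "coeff (f * u) 0" "coeff s 0"] s[of 0] coeff_polys[OF polys(4)[OF f(1) u]]
      by (auto simp: mult.commute)
  qed
  have fin: "finite {k. unit (coeff u k)}"
    by (rule finite_subset[of _ "{..degree u}"]) (auto simp: coeff_eq_0 intro!: leI)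
  \<comment> \<open>\<open>e\<close> is the degree of \<open>u\<close> over the residue field. The
    coefficient of \<open>f * u\<close> at \<open>degree f + e\<close> is then a unit, but in
    \<open>f * u + s = 1\<close> it would have to cancel against a non-unit coefficient of
    \<open>s\<close>.\<close>
  define e where "e = Max {k. unit (coeff u k)}"
  have e: "unit (coeff u e)" "\<And>k. k > e \<Longrightarrow> \<not> unit (coeff u k)"
    using Max_in[OF fin] Max_ge[OF fin] ex unfolding e_def by fastforce+
  let ?n = "degree f + e"
  have "coeff (f * u) ?n = lead_coeff f * coeff u e + (\<Sum>k\<in>{..?n} - {degree f}. coeff f k * coeff u (?n - k))"
    by (simp add: coeff_mult sum.remove[of "{..?n}" "degree f"])
  moreover have "\<not> unit (\<Sum>k\<in>{..?n} - {degree f}. coeff f k * coeff u (?n - k))"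
  proof (rule nonunit_sum)
    fix k assume k: "k \<in> {..?n} - {degree f}"
    show "coeff f k * coeff u (?n - k) \<in> S" using u f by (intro S coeff_polys)
    show "\<not> unit (coeff f k * coeff u (?n - k))"
    proof (cases "k < degree f")
      case True
      then have "\<not> unit (coeff u (?n - k))" using e(2) by simp
      then show ?thesis using unit_multD[of "coeff u (?n - k)" "coeff f k"] u f
        by (auto simp: mult.commute coeff_polys)
    next
      case False
      then show ?thesis using k by (simp add: coeff_eq_0)
    qed
  qed
  moreover have "(\<Sum>k\<in>{..?n} - {degree f}. coeff f k * coeff u (?n - k)) \<in> S"
    using u f by (intro sum_S S coeff_polys)
  ultimately have "unit (coeff (f * u) ?n)"
    using f(2) e(1) by (auto intro: unit_add_nonunit unit_mult)
  then have "unit (coeff (f * u) ?n + coeff s ?n)"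
    using s by (intro unit_add_nonunit)
  moreover have "coeff (f * u) ?n + coeff s ?n = 0"
    using fu f(3) by (metis add_gr_0 coeff_add coeff_eq_0 degree_1)
  ultimately show False by simp
qed

text \<open>Division by the entry at \<open>i\<close> pushes all others below its degree. One of
  them, at \<open>j\<close>, has a unit coefficient, so \<open>exists_lower_degree\<close> yields a
  combination of degree one less with a unit as leading coefficient. It is added to a third entry
  \<open>m\<close>, which takes the place of \<open>i\<close> in the next round.\<close>

lemma reach_axis_polys:
  fixes v :: "'l poly ^ 'n::finite"
  assumes "card I \<ge> 3" "i \<in> I" "k \<in> I" "\<And>l. v $ l \<in> polys" "\<And>l. l \<notin> I \<Longrightarrow> v $ l = 0"
    "unit (lead_coeff (v $ i))" "unimodular polys v"
  shows "reach I polys v (axis k 1)"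
  using assms(2,4-7)
proof (induction "degree (v $ i)" arbitrary: v i)
  case 0
  then obtain c where c: "v $ i = [:c:]" by (metis degree_0_id of_nat_0 degree_eq_zeroE)
  show ?case
    using 0 c assms(1,3)
    by (intro reach_axis_of_unit[of i I k v "[:inverse c:]"] subring_polys)
       (auto intro: const_polys simp: unit_S one_pCons)
next
  case (Suc d)
  let ?f = "v $ i"
  have "\<forall>l. \<exists>h. h \<in> polys \<and> (\<forall>k\<ge>degree ?f. coeff (v $ l + ?f * h) k = 0)"
    using polys_division[of ?f] Suc.prems by metis
  then obtain r where r: "\<And>l. r l \<in> polys" "\<And>l k. k \<ge> degree ?f \<Longrightarrow> coeff (v $ l + ?f * r l) k = 0"
    by metis
  define w where "w = (\<chi> l. v $ l + (if l \<in> I - {i} then ?f * r l else 0))"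
  have vw: "reach I polys v w"
    unfolding w_def using Suc.prems r by (intro reach_add_multiples) auto
  have wi: "w $ i = ?f" by (simp add: w_def)
  have w: "w $ l \<in> polys" for l
    using Suc.prems(2) r(1) by (auto simp: w_def intro!: polys(4,6))
  have w0: "w $ l = 0" if "l \<notin> I" for l using that Suc.prems by (simp add: w_def)
  have wd: "coeff (w $ l) k = 0" if "l \<noteq> i" "k \<ge> degree ?f" for l k
    using that r(2)[of k l] Suc.prems(3)[of l] by (auto simp: w_def)
  have "unimodular polys w"
    using unimodular_reach[OF vw Suc.prems(5) subring_polys] .
  then obtain j n where j: "j \<noteq> i" "unit (coeff (w $ j) n)"
    using exists_unit_coeff[of w i] w wi Suc by auto
  then have "j \<in> I" using w0 by fastforce
  obtain a b where ab: "a \<in> polys" "b \<in> polys"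
    "\<And>k. k \<ge> degree ?f \<Longrightarrow> coeff (?f * a + w $ j * b) k = 0"
    "unit (coeff (?f * a + w $ j * b) (degree ?f - 1))"
    using exists_lower_degree[of ?f "w $ j" n] Suc.prems w wd[OF j(1)] j(2) by metis
  have "\<not> I \<subseteq> {i, j}"
    using card_mono[of "{i, j}" I] assms(1) j by auto
  then obtain m where m: "m \<in> I" "m \<noteq> i" "m \<noteq> j" by blast
  define h where "h = ?f * a + w $ j * b"
  have d: "degree ?f - 1 = d" using Suc(2) by simp
  have h: "h \<in> polys" "unit (coeff h d)"
    using ab Suc.prems w unfolding h_def d by (auto intro!: polys(4,6))
  \<comment> \<open>This multiple of \<open>h\<close> makes the coefficient of \<open>y $ m\<close>
    at \<open>d\<close> equal to 1, whatever \<open>w $ m\<close> contributes.\<close>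
  define c where "c = (1 - coeff (w $ m) d) / coeff h d"
  have c: "c \<in> S"
    unfolding c_def using h w by (intro divide_S S(1,3) coeff_polys)
  define x where "x = (\<chi> l. w $ l + (if l = m then w $ i * smult c a else 0))"
  define y where "y = (\<chi> l. x $ l + (if l = m then x $ j * smult c b else 0))"
  note vw
  also have "reach I polys w x"
    unfolding x_def using Suc.prems m c ab by (intro reach_elementary smult_polys) auto
  also have "reach I polys x y"
    unfolding y_def using \<open>j \<in> I\<close> m c ab by (intro reach_elementary smult_polys) auto
  finally have vy: "reach I polys v y" .
  have ym: "y $ m = w $ m + smult c h"
    using m by (simp add: y_def x_def wi h_def smult_add_right algebra_simps)
  have y: "y $ l = w $ l" if "l \<noteq> m" for l
    using that by (simp add: y_def x_def)
  have "coeff (y $ m) d = 1"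
    using unit_S(3)[OF h(2)] by (simp add: ym c_def)
  moreover have "coeff (y $ m) k = 0" if "k > d" for k
    using ab(3)[of k, folded h_def] wd[OF m(2), of k] that Suc(2) by (simp add: ym)
  ultimately have deg: "degree (y $ m) = d" "lead_coeff (y $ m) = 1"
    using degree_le[of d "y $ m"] le_degree[of "y $ m" d] by (auto dest!: antisym)
  have "w $ m + smult c h \<in> polys"
    using w c h by (intro polys(6) smult_polys)
  then have "y $ l \<in> polys" for l
    using y[of l] ym w[of l] by (cases "l = m") auto
  moreover have "y $ l = 0" if "l \<notin> I" for l
    using y[of l] w0[of l] that m by (cases "l = m") auto
  moreover have "unimodular polys y"
    using unimodular_reach[OF vy Suc.prems(5) subring_polys] .
  ultimately have "reach I polys y (axis k 1)"
    using Suc.hyps(1)[of y m] deg m(1) by simp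
  with vy show ?case by (rule reach_trans)
qed

text \<open>Induction on the degree of \<open>f\<close>.  If \<open>g\<close> has a unit as constant term, a multiple of \<open>g\<close> makes
  \<open>f\<close> divisible by the variable, and the symbol is multiplicative.  Otherwise the sum of both rows
  of a completion of \<open>(f, g)\<close> has such a second entry.\<close>

lemma trivial_symbol_polys:
  fixes I :: "'n::finite set"
  assumes "card I \<ge> 3" "f \<in> polys" "g \<in> polys" "unit (lead_coeff f)"
  shows "trivial_symbol I polys f g"
  using assms(2-4)
proof (induction "degree f" arbitrary: f g)
  case 0
  then obtain c where c: "f = [:c:]" by (metis degree_eq_zeroE)
  then show ?case
    using 0 by (intro trivial_symbol_unit_left[of f "[:inverse c:]"] subring_polys)
      (auto intro: const_polys simp: unit_S one_pCons)
next
  case (Suc d)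
  have unit_const: "trivial_symbol I polys f g"
    if f: "degree f = Suc d" "f \<in> polys" "g \<in> polys" "unit (lead_coeff f)"
      and g: "\<And>k. k \<ge> degree f \<Longrightarrow> coeff g k = 0" "unit (coeff g 0)" for f g
  proof -
    \<comment> \<open>This multiple of \<open>g\<close> kills the constant term of \<open>f\<close>
      and leaves its leading term alone, because all coefficients of \<open>g\<close> from
      \<open>degree f\<close> on vanish.\<close>
    let ?r = "- (coeff f 0 / coeff g 0)"
    define F where "F = f + g * [:?r:]"
    have r: "?r \<in> S" using f g by (intro S divide_S coeff_polys)
    obtain f0 f1 where f01: "F = pCons f0 f1" by (cases F)
    have "coeff F 0 = 0" using unit_S[OF g(2)] by (simp add: F_def)
    then have "f0 = 0" using f01 by simp
    then have f1: "F = [:0, 1:] * f1" using f01 by simp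
    have cf1: "coeff f1 k = coeff F (Suc k)" for k unfolding f01 by simp
    have "F \<in> polys" unfolding F_def using f r by (intro polys const_polys)
    then have "f1 \<in> polys" unfolding polys_def using cf1 by auto
    have "coeff f1 k = coeff f (Suc k)" if "k \<ge> d" for k
      unfolding cf1 F_def using g(1)[of "Suc k"] f(1) that by simp
    then have "degree f1 = d" "lead_coeff f1 = lead_coeff f"
      using f(1,4) unit_S(3) degree_le[of d f1] le_degree[of f1 d]
      by (auto simp: coeff_eq_0 dest!: antisym)
    then have "trivial_symbol I polys f1 g"
      using Suc.hyps(1)[of f1 g] \<open>f1 \<in> polys\<close> f by simp
    moreover have "trivial_symbol I polys [:0, 1:] g"
    proof -
      \<comment> \<open>Modulo the variable, \<open>g\<close> is its constant term, a unit.\<close>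
      obtain g0 g1 where g01: "g = pCons g0 g1" by (cases g)
      then have "g1 \<in> polys" using f(3) unfolding polys_def by (auto dest: spec[of _ "Suc _"])
      have "trivial_symbol I polys [:0, 1:] [:g0:]"
        using g(2) g01
        by (intro trivial_symbol_unit_right[of _ "[:inverse g0:]"] subring_polys const_polys pCons_polys)
           (auto simp: unit_S one_pCons intro: S)
      moreover have "g + [:0, 1:] * (- g1) = [:g0:]" using g01 by simp
      ultimately show ?thesis
        using \<open>g1 \<in> polys\<close> polys by (intro trivial_symbol_shift_right[of I polys _ g "- g1"] subring_polys) simp_all
    qed
    ultimately have "trivial_symbol I polys F g"
      unfolding f1 using f \<open>f1 \<in> polys\<close> assms(1)
      by (intro trivial_symbol_mult subring_polys pCons_polys) (auto intro: S polys)
    then show ?thesis unfolding F_def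
      by (rule trivial_symbol_shift_left) (use r in \<open>auto intro: const_polys subring_polys\<close>)
  qed
  have reduced: "trivial_symbol I polys f g" if g: "g \<in> polys" "\<And>k. k \<ge> degree f \<Longrightarrow> coeff g k = 0" for g
  proof (cases "unit (coeff g 0)")
    case True
    then show ?thesis using unit_const[of f g] Suc g by simp
  next
    case False
    show ?thesis
      unfolding trivial_symbol_def
    proof (intro ballI impI)
      fix i j q p assume *: "i \<in> I" "j \<in> I" "q \<in> polys" "p \<in> polys" "i \<noteq> j" "f * p - g * q = 1"
      \<comment> \<open>Reducing \<open>q\<close> modulo \<open>f\<close> keeps the leading term of
        \<open>f\<close> intact in \<open>q' + f\<close>; together with the determinant it also
        bounds the degree of \<open>p'\<close>, so that \<open>unit_const\<close> becomes applicable
        to the sum of the rows.\<close>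
      obtain r where r: "r \<in> polys" "\<And>k. k \<ge> degree f \<Longrightarrow> coeff (q + f * r) k = 0"
        using polys_division[of f q] Suc.prems * by blast
      define q' where "q' = q + f * r"
      define p' where "p' = p + g * r"
      have q'p': "q' \<in> polys" "p' \<in> polys"
        unfolding q'_def p'_def using * r Suc.prems g by (auto intro: polys)
      have det: "f * p' - g * q' = 1"
        using *(6) by (simp add: q'_def p'_def algebra_simps)
      have deg_q': "degree q' \<le> d" and deg_g: "degree g \<le> d"
        using r(2) g(2) Suc(2) by (auto intro!: degree_le simp: q'_def)
      have p'd: "degree p' \<le> d"
      proof (cases "p' = 0")
        case False
        have "f \<noteq> 0" using Suc(2) by auto
        then have "Suc d + degree p' = degree (f * p')"
          using False Suc(2) by (simp add: degree_mult_eq)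
        also have "f * p' = 1 + g * q'" using det by (simp add: algebra_simps)
        also have "degree \<dots> \<le> d + d"
          using degree_mult_le[of g q'] deg_q' deg_g
          by (intro degree_add_le) auto
        finally show ?thesis by simp
      qed simp
      \<comment> \<open>Constant terms of the determinant: as \<open>coeff g 0\<close> is a
        non-unit, \<open>coeff p' 0\<close> must be a unit, and so is the constant term of
        \<open>p' + g\<close>.\<close>
      have "coeff f 0 * coeff p' 0 + - (coeff g 0 * coeff q' 0) = 1"
        using arg_cong[OF det, of "\<lambda>x. coeff x 0"] by (simp add: coeff_mult_0)
      then have "unit (coeff f 0 * coeff p' 0) \<or> unit (- (coeff g 0 * coeff q' 0))"
        using Suc.prems g q'p' by (intro unit_addD) (auto intro: S coeff_polys)
      then have "unit (coeff p' 0)"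
        using False Suc.prems g q'p' unit_multD[of "coeff g 0" "coeff q' 0"]
          unit_multD[of "coeff p' 0" "coeff f 0"] by (auto simp: coeff_polys mult.commute)
      then have u: "unit (coeff (p' + g) 0)"
        using False g by (simp add: unit_add_nonunit coeff_polys)
      have v: "coeff (p' + g) k = 0" if "k \<ge> Suc d" for k
        using p'd deg_g that by (simp add: coeff_eq_0)
      have deg: "degree (q' + f) = Suc d"
        using deg_q' Suc(2) by (simp add: degree_add_eq_right)
      have "coeff q' (Suc d) = 0"
        using deg_q' by (simp add: coeff_eq_0)
      then have "lead_coeff (q' + f) = lead_coeff f"
        by (simp only: deg Suc(2)[symmetric] coeff_add add_0)
      then have "trivial_symbol I polys (q' + f) (p' + g)"
        using Suc.prems g q'p' deg u v by (intro unit_const polys(6)) (simp_all only:)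
      moreover have "(q' + f) * (- g) - (p' + g) * (- f) = 1"
        using det by (simp add: algebra_simps)
      ultimately have "block i j (q' + f) (p' + g) (- f) (- g) \<in> El I polys"
        unfolding trivial_symbol_def using * Suc.prems g polys by blast
      moreover have "block i j (q' + f) (p' + g) (- f) (- g) =
        elementary_matrix i j 1 ** (elementary_matrix j i (- 1) ** (elementary_matrix i j 1 **
          (elementary_matrix j i 1 ** (elementary_matrix j i r ** block i j f g q p))))"
        using * by (simp add: block_left_elementary q'_def p'_def algebra_simps)
      ultimately have "(elementary_matrix i j 1 ** elementary_matrix j i (- 1) ** elementary_matrix i j 1 **
          elementary_matrix j i 1 ** elementary_matrix j i r) ** block i j f g q p ** mat 1 \<in> El I polys"
        by (simp add: matrix_mul_assoc)
      then show "block i j f g q p \<in> El I polys"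
        by (rule El_cancel[rotated 2])
          (use * r in \<open>auto intro!: El_mult El_elementary El.one subring_polys intro: polys\<close>)
    qed
  qed
  obtain r where r: "r \<in> polys" "\<And>k. k \<ge> degree f \<Longrightarrow> coeff (g + f * r) k = 0"
    using polys_division[of f g] Suc.prems by blast
  then have "trivial_symbol I polys f (g + f * r)"
    using Suc.prems by (intro reduced) (auto intro: polys)
  then show ?case using r(1) subring_polys by (rule trivial_symbol_shift_right)
qed

end

section \<open>Localization and patching\<close>

text \<open>\<open>\<pi>\<close> generates a maximal ideal; invertibility in the quotient is spelled
  out by divisibility.\<close>

locale maximal_element =
  fixes \<pi> :: "'r::idom"
  assumes not_unit: "\<not> \<pi> dvd 1"
    and inverse_mod: "\<not> \<pi> dvd u \<Longrightarrow> \<exists>w. \<pi> dvd w * u - 1"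
begin

lemma not_dvd_mult: "\<not> \<pi> dvd u \<Longrightarrow> \<not> \<pi> dvd v \<Longrightarrow> \<not> \<pi> dvd u * v"
proof
  assume uv: "\<not> \<pi> dvd u" "\<not> \<pi> dvd v" "\<pi> dvd u * v"
  obtain w where "\<pi> dvd w * u - 1" using inverse_mod uv by blast
  then have "\<pi> dvd w * (u * v) - (w * u - 1) * v" using uv by (intro dvd_diff) auto
  also have "w * (u * v) - (w * u - 1) * v = v" by (simp add: algebra_simps)
  finally show False using uv by simp
qed

lemma not_dvd_nonzero: "\<not> \<pi> dvd u \<Longrightarrow> u \<noteq> 0"
  by auto

definition localization :: "'r fract set"
  where "localization = {to_fract a / to_fract u | a u. \<not> \<pi> dvd u}"

lemma localizationI: "\<not> \<pi> dvd u \<Longrightarrow> to_fract a / to_fract u \<in> localization"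
  unfolding localization_def by blast

lemma localizationE:
  assumes "x \<in> localization"
  obtains a u where "\<not> \<pi> dvd u" "x = to_fract a / to_fract u"
  using assms unfolding localization_def by blast

lemma to_fract_localization: "to_fract a \<in> localization"
  using localizationI[OF not_unit, of a] by simp

lemma subring_localization: "unital_subring localization"
  unfolding unital_subring_def
proof (intro conjI ballI)
  show "1 \<in> localization" using to_fract_localization[of 1] by simp
  fix x y assume "x \<in> localization" "y \<in> localization"
  then obtain a u b v where *: "\<not> \<pi> dvd u" "x = to_fract a / to_fract u"
    "\<not> \<pi> dvd v" "y = to_fract b / to_fract v" by (auto elim!: localizationE)
  have "u \<noteq> 0" "v \<noteq> 0" using * by auto
  then have "x - y = to_fract (a * v - b * u) / to_fract (u * v)"
    "x * y = to_fract (a * b) / to_fract (u * v)"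
    unfolding *(2,4) by (simp_all add: field_simps)
  then show "x - y \<in> localization" "x * y \<in> localization"
    by (simp_all only: localizationI not_dvd_mult[OF *(1,3)] not_False_eq_True)
qed

lemma inverse_localization:
  assumes "\<not> \<pi> dvd a" "\<not> \<pi> dvd u"
  shows "inverse (to_fract a / to_fract u) \<in> localization"
  using localizationI[OF assms(1), of u] by simp

sublocale local_subring localization
proof
  show "unital_subring localization" by (rule subring_localization)
  fix x y assume *: "x \<in> localization" "y \<in> localization" "x + y \<noteq> 0" "inverse (x + y) \<in> localization"
  obtain a u b v where xy: "\<not> \<pi> dvd u" "x = to_fract a / to_fract u"
    "\<not> \<pi> dvd v" "y = to_fract b / to_fract v" using * by (auto elim!: localizationE)
  obtain e f where ef: "\<not> \<pi> dvd f" "inverse (x + y) = to_fract e / to_fract f"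
    using * by (auto elim!: localizationE)
  have nz: "u \<noteq> 0" "v \<noteq> 0" "f \<noteq> 0" using xy ef by auto
  have "x + y = to_fract (a * v + b * u) / to_fract (u * v)"
    unfolding xy(2,4) using nz by (simp add: field_simps)
  then have "to_fract (a * v + b * u) / to_fract (u * v) * (to_fract e / to_fract f) = 1"
    using *(3) ef(2) by (metis right_inverse)
  then have "to_fract ((a * v + b * u) * e) = to_fract (u * v * f)"
    using nz by (simp add: field_simps)
  then have "(a * v + b * u) * e = u * v * f" by (simp only: to_fract_eq_iff)
  then have "\<not> \<pi> dvd (a * v + b * u) * e"
    using not_dvd_mult xy ef by simp
  then have "\<not> \<pi> dvd a \<or> \<not> \<pi> dvd b" by auto
  then show "x \<noteq> 0 \<and> inverse x \<in> localization \<or> y \<noteq> 0 \<and> inverse y \<in> localization"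
    using inverse_localization[of a u] inverse_localization[of b v] xy nz by auto
qed

lemma fract_poly_polys: "fract_poly p \<in> polys"
  by (simp add: polys_def coeff_map_poly to_fract_localization)

lemma polys_common_denominator:
  assumes "p \<in> polys"
  obtains u c where "\<not> \<pi> dvd u" "smult (to_fract u) p = fract_poly c"
proof -
  have "\<exists>u c. \<not> \<pi> dvd u \<and> smult (to_fract u) p = fract_poly c"
    using assms
  proof (induction p)
    case 0
    show ?case using not_unit by (intro exI[of _ 1] exI[of _ 0]) simp
  next
    case (pCons x p)
    have "p \<in> polys" "x \<in> localization"
      using pCons.prems unfolding polys_def by (auto dest: spec[of _ "Suc _"] spec[of _ 0])
    then obtain u c a v where "\<not> \<pi> dvd u" "smult (to_fract u) p = fract_poly c"
        "\<not> \<pi> dvd v" "x = to_fract a / to_fract v"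
      using pCons.IH by (auto elim!: localizationE)
    moreover from this have "smult (to_fract (u * v)) (pCons x p) = fract_poly (pCons (u * a) (smult v c))"
      by (auto simp: map_poly_pCons mult.commute[of u] simp flip: smult_smult)
    ultimately show ?case using not_dvd_mult by blast
  qed
  then show ?thesis using that by blast
qed

end

section \<open>Elementary matrices near the identity and congruent substitutions\<close>

lemma unital_ring_hom_pcompose: "unital_ring_hom (\<lambda>p. pcompose p q)"
  by (simp add: unital_ring_hom_def pcompose_1 pcompose_add pcompose_mult)

lemma unital_ring_hom_fract_poly: "unital_ring_hom fract_poly"
  by (simp add: unital_ring_hom_def)

lemma fract_poly_pcompose:
  "fract_poly (pcompose p q) = pcompose (fract_poly p) (fract_poly q)"
  by (induction p) (simp_all add: pcompose_pCons map_poly_pCons)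

lemma dvd_pcompose_diff: "a - b dvd pcompose c a - pcompose c b"
  for c :: "'r::comm_ring_1 poly"
proof (induction c)
  case (pCons x c)
  have "pcompose (pCons x c) a - pcompose (pCons x c) b =
      a * (pcompose c a - pcompose c b) + (a - b) * pcompose c b"
    by (simp add: pcompose_pCons algebra_simps)
  then show ?case using pCons by (simp add: dvd_add)
qed simp

text \<open>The ideal \<open>t R[y]\<close> of \<open>R[y]\<close>, placed inside the polynomials
  over the fraction field so that its elements can be multiplied by polynomials with
  denominators.\<close>

definition multiples :: "'r::idom \<Rightarrow> 'r fract poly set"
  where "multiples t = range (\<lambda>h. fract_poly (smult t h))"

lemma multiplesI: "x = fract_poly (smult t h) \<Longrightarrow> x \<in> multiples t"
  by (auto simp: multiples_def)

lemma multiples_mono: "x \<in> multiples (t * u) \<Longrightarrow> x \<in> multiples t"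
  unfolding multiples_def by (auto simp del: fract_poly_smult simp flip: smult_smult)

lemma multiples_uminus: "x \<in> multiples t \<Longrightarrow> - x \<in> multiples t"
proof -
  assume "x \<in> multiples t"
  then obtain h where "x = fract_poly (smult t h)" by (auto simp: multiples_def)
  then have "- x = fract_poly (smult t (- h))"
    using unital_ring_homD(5)[OF unital_ring_hom_fract_poly, of "smult t h"] by simp
  then show ?thesis by (rule multiplesI)
qed

lemma multiples_mult:
  assumes "x \<in> multiples (t * u)" "smult (to_fract u) r = fract_poly c"
  shows "x * r \<in> multiples t" "r * x \<in> multiples t"
proof -
  obtain h where "x = fract_poly (smult (t * u) h)" using assms(1) by (auto simp: multiples_def)
  then have "x * r = fract_poly (smult t h) * smult (to_fract u) r"
    by (simp add: mult.commute)
  also have "\<dots> = fract_poly (smult t (h * c))" by (simp add: assms(2))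
  finally show "x * r \<in> multiples t" by (rule multiplesI)
  then show "r * x \<in> multiples t" by (simp add: mult.commute)
qed

text \<open>Steinberg relations. The opposite position \<open>(k, l) = (j, i)\<close> is left out:
  there the conjugate is not such a product, and \<open>elementary_commutator\<close> is used to
  avoid it.\<close>

lemma elementary_conj:
  fixes r s :: "'r::comm_ring_1"
  assumes "i \<noteq> j" "k \<noteq> l"
  shows "l \<noteq> i \<Longrightarrow> k \<noteq> j \<Longrightarrow> elementary_matrix i j (- r) ** elementary_matrix k l s ** elementary_matrix i j r =
      elementary_matrix k l s"
    and "l = i \<Longrightarrow> k \<noteq> j \<Longrightarrow> elementary_matrix i j (- r) ** elementary_matrix k l s ** elementary_matrix i j r =
      elementary_matrix k l s ** elementary_matrix k j (s * r)"
    and "l \<noteq> i \<Longrightarrow> k = j \<Longrightarrow> elementary_matrix i j (- r) ** elementary_matrix k l s ** elementary_matrix i j r =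
      elementary_matrix k l s ** elementary_matrix i l (- (r * s))"
  using assms
  by (auto simp: vec_eq_iff matrix_mult_elementary_nth elementary_mult_matrix_nth elementary_matrix_nth)

lemma elementary_commutator:
  fixes a b :: "'r::comm_ring_1"
  assumes "i \<noteq> j" "i \<noteq> m" "j \<noteq> m"
  shows "elementary_matrix j i (a * b) = elementary_matrix j m a ** elementary_matrix m i b **
    elementary_matrix j m (- a) ** elementary_matrix m i (- b)"
  using assms by (auto simp: vec_eq_iff matrix_mult_elementary_nth elementary_matrix_nth)

lemma conj_mult:
  fixes M N :: "'r::comm_ring_1 ^ 'n::finite ^ 'n"
  assumes "e' ** e = mat 1" "e ** e' = mat 1"
  shows "e' ** (M ** N) ** e = (e' ** M ** e) ** (e' ** N ** e)"
proof -
  have "(e' ** M ** e) ** (e' ** N ** e) = e' ** M ** (e ** e') ** N ** e"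
    by (simp only: matrix_mul_assoc)
  then show ?thesis by (simp add: assms matrix_mul_assoc)
qed

text \<open>A conjugating matrix may have a denominator \<open>u\<close>: the multiples of \<open>(t u)\<^sup>2\<close> absorb it, because
  \<open>e\<^sub>j\<^sub>i\<close> of such a multiple is a commutator of matrices that avoid the position \<open>(j, i)\<close>.\<close>

lemma El_conj_multiples:
  fixes N :: "'r::idom fract poly ^ 'n::finite ^ 'n"
  assumes "N \<in> El I (multiples ((t * u) * (t * u)))" "i \<in> I" "j \<in> I" "i \<noteq> j" "card I \<ge> 3"
    "smult (to_fract u) r = fract_poly c"
  shows "elementary_matrix i j (- r) ** N ** elementary_matrix i j r \<in> El I (multiples t)"
proof -
  let ?e = "elementary_matrix i j" and ?E = "El I (multiples t) :: ('r fract poly ^ 'n ^ 'n) set"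
  have e: "?e (- r) ** ?e r = mat 1" "?e r ** ?e (- r) = mat 1"
    using assms(4) by (simp_all add: elementary_matrix_add)
  have avoid: "?e (- r) ** elementary_matrix k l s ** ?e r \<in> ?E"
    if "k \<in> I" "l \<in> I" "k \<noteq> l" "(k, l) \<noteq> (j, i)" "s \<in> multiples (t * u)" for k l s
  proof -
    have m: "s \<in> multiples t" "s * r \<in> multiples t" "- (r * s) \<in> multiples t"
      using multiples_mono multiples_mult[OF that(5) assms(6)] that(5) multiples_uminus by blast+
    from \<open>(k, l) \<noteq> (j, i)\<close>
    consider "l \<noteq> i" "k \<noteq> j" | "l = i" "k \<noteq> j" | "l \<noteq> i" "k = j" by auto
    then show ?thesis
      using m that assms(2-4) elementary_conj[OF assms(4) that(3), of r s]
      by cases (simp_all add: El_mult El_elementary)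
  qed
  have gen: "?e (- r) ** elementary_matrix k l s ** ?e r \<in> ?E"
    if "k \<in> I" "l \<in> I" "k \<noteq> l" "s \<in> multiples ((t * u) * (t * u))" for k l s
  proof (cases "(k, l) = (j, i)")
    case False
    then show ?thesis using that multiples_mono by (intro avoid) blast+
  next
    case True
    have "\<not> I \<subseteq> {i, j}"
      using card_mono[of "{i, j}" I] assms(4,5) by auto
    then obtain m where m: "m \<in> I" "m \<noteq> i" "m \<noteq> j" by blast
    obtain h where "s = fract_poly (smult ((t * u) * (t * u)) h)"
      using \<open>s \<in> multiples ((t * u) * (t * u))\<close> unfolding multiples_def by blast
    then have s: "s = fract_poly (smult (t * u) h) * fract_poly (smult (t * u) 1)"
      by (simp del: fract_poly_smult fract_poly_mult add: smult_smult flip: fract_poly_mult)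
    define a b where "a = fract_poly (smult (t * u) h)" and "b = fract_poly (smult (t * u) 1)"
    have ab: "a \<in> multiples (t * u)" "b \<in> multiples (t * u)"
      "- a \<in> multiples (t * u)" "- b \<in> multiples (t * u)"
      unfolding a_def b_def by (intro multiples_uminus multiplesI[OF refl])+
    have "elementary_matrix k l s = elementary_matrix j m a ** elementary_matrix m i b **
        elementary_matrix j m (- a) ** elementary_matrix m i (- b)"
      using True m assms(4) elementary_commutator[of i j m a b] by (auto simp: s a_def b_def)
    then show ?thesis
      by (simp only: conj_mult[OF e]) (intro El_mult avoid; use assms(2,3) m ab in simp)
  qed
  show ?thesis
    using assms(1)
  proof induction
    case one
    then show ?case by (simp add: e El.one)
  next
    case (step N k l s)
    show ?case unfolding conj_mult[OF e]
      by (rule El_mult[OF step.IH gen]) (rule step.hyps)+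
  qed
qed

context maximal_element
begin

text \<open>Induction over the factors. From \<open>\<gamma>(a) = \<gamma>(b) N\<close>, a further
  factor \<open>e(r)\<close> gives \<open>\<gamma>(a) e(r(a)) = \<gamma>(b) e(r(b)) N'\<close> with
  \<open>N' = e(- r(b)) N e(r(b)) e(r(a) - r(b))\<close>. A denominator \<open>u\<close> of
  \<open>r\<close> endangers both parts of \<open>N'\<close>: for the conjugate, \<open>N\<close> is
  taken with entries in a smaller ideal; for the difference, \<open>s\<close> gets the additional
  factor \<open>t * u\<close>.\<close>

lemma El_polys_congruent:
  fixes \<gamma> :: "'r fract poly ^ 'n::finite ^ 'n"
  assumes "\<gamma> \<in> El I polys" "card I \<ge> 3" "\<not> \<pi> dvd t"
  obtains s where "\<not> \<pi> dvd s" "\<And>a b. [:s:] dvd a - b \<Longrightarrow> \<exists>N\<in>El I (multiples t).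
    map_matrix (\<lambda>p. pcompose p (fract_poly a)) \<gamma> = map_matrix (\<lambda>p. pcompose p (fract_poly b)) \<gamma> ** N"
proof -
  let ?sub = "\<lambda>a. map_matrix (\<lambda>p. pcompose p (fract_poly a)) :: 'r fract poly ^ 'n ^ 'n \<Rightarrow> _"
  have "\<exists>s. \<not> \<pi> dvd s \<and> (\<forall>a b. [:s:] dvd a - b \<longrightarrow> (\<exists>N\<in>El I (multiples t). ?sub a \<gamma> = ?sub b \<gamma> ** N))"
    using assms(1,3)
  proof (induction arbitrary: t)
    case one
    show ?case
      using not_unit
      by (intro exI[of _ 1] conjI allI impI bexI[OF _ El.one])
        (simp_all add: map_matrix_one unital_ring_hom_pcompose)
  next
    case (step \<gamma> i j r)
    obtain u c where u: "\<not> \<pi> dvd u" "smult (to_fract u) r = fract_poly c"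
      using polys_common_denominator step.hyps by blast
    have "\<not> \<pi> dvd (t * u) * (t * u)"
      using step.prems u(1) not_dvd_mult by blast
    from step.IH[OF this] obtain s where s: "\<not> \<pi> dvd s"
      and congruent: "\<forall>a b. [:s:] dvd a - b \<longrightarrow>
        (\<exists>N\<in>El I (multiples ((t * u) * (t * u))). ?sub a \<gamma> = ?sub b \<gamma> ** N)"
      by (elim exE conjE)
    have "\<exists>N\<in>El I (multiples t). ?sub a (\<gamma> ** elementary_matrix i j r) =
        ?sub b (\<gamma> ** elementary_matrix i j r) ** N"
      if ab: "[:s * (t * u):] dvd a - b" for a b
    proof -
      have "[:s:] dvd [:s * (t * u):]" by (intro dvdI[of _ _ "[:t * u:]"]) simp
      from congruent[rule_format, OF dvd_trans[OF this ab]]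
      obtain N where N: "N \<in> El I (multiples ((t * u) * (t * u)))" "?sub a \<gamma> = ?sub b \<gamma> ** N"
        by (elim bexE)
      define ra rb where "ra = pcompose r (fract_poly a)" and "rb = pcompose r (fract_poly b)"
      have ra: "smult (to_fract u) ra = fract_poly (pcompose c a)"
        and rb: "smult (to_fract u) rb = fract_poly (pcompose c b)"
        by (simp_all add: ra_def rb_def fract_poly_pcompose u(2)[symmetric] pcompose_smult)
      obtain h where h: "pcompose c a - pcompose c b = [:s * (t * u):] * h"
        using dvd_trans[OF ab dvd_pcompose_diff] by (rule dvdE)
      have "smult (to_fract u) (ra - rb) = fract_poly ([:s * (t * u):] * h)"
        unfolding h[symmetric] by (simp add: smult_diff_right ra rb)
      also have "\<dots> = smult (to_fract u) (fract_poly (smult t (smult s h)))"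
        by (simp add: mult_ac)
      finally have "ra - rb = fract_poly (smult t (smult s h))"
        using not_dvd_nonzero[OF u(1)] by (metis smult_cancel to_fract_eq_0_iff)
      then have d: "ra - rb \<in> multiples t" by (rule multiplesI)
      let ?e = "elementary_matrix i j"
      have e: "?e rb ** ?e (- rb) = mat 1" "?e rb ** ?e (ra - rb) = ?e ra"
        using step.hyps by (simp_all add: elementary_matrix_add)
      let ?N = "(?e (- rb) ** N ** ?e rb) ** ?e (ra - rb)"
      have "?N \<in> El I (multiples t)"
        using N(1) step.hyps assms(2) rb d
        by (intro El_mult El_conj_multiples El_elementary)
      moreover have "?sub b \<gamma> ** ?e rb ** ?N = ?sub b \<gamma> ** (?e rb ** ?e (- rb)) ** N ** (?e rb ** ?e (ra - rb))"
        by (simp only: matrix_mul_assoc)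
      then have "?sub b \<gamma> ** ?e rb ** ?N = ?sub a \<gamma> ** ?e ra"
        by (simp add: e N(2))
      ultimately show ?thesis
        by (intro bexI[of _ ?N])
          (simp_all add: map_matrix_mult map_matrix_elementary unital_ring_hom_pcompose
            flip: ra_def rb_def)
    qed
    moreover have "\<not> \<pi> dvd s * (t * u)"
      using s u(1) step.prems not_dvd_mult by blast
    ultimately show ?case by blast
  qed
  then show ?thesis using that by blast
qed

end

lemma El_image:
  assumes "unital_ring_hom h" "N \<in> El I (range h)"
  obtains N' where "N' \<in> El I UNIV" "N = map_matrix h N'"
proof -
  have "\<exists>N'\<in>El I UNIV. N = map_matrix h N'"
    using assms(2)
  proof induction
    case one
    show ?case by (intro bexI[of _ "mat 1"]) (simp_all add: map_matrix_one assms(1) El.one)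
  next
    case (step N i j r)
    then obtain N' r' where "N' \<in> El I UNIV" "N = map_matrix h N'" "r = h r'" by blast
    with step.hyps show ?case
      by (intro bexI[of _ "N' ** elementary_matrix i j r'"])
        (simp_all add: map_matrix_mult map_matrix_elementary assms(1) El.step)
  qed
  then show ?thesis using that by blast
qed

section \<open>Maximal ideals of \<open>K[x]\<close> and the local-global principle\<close>

lemma poly_ideal_principal:
  fixes J :: "'k::field poly set"
  assumes "0 \<in> J" "\<And>a b. a \<in> J \<Longrightarrow> b \<in> J \<Longrightarrow> a + b \<in> J" "\<And>a b. a \<in> J \<Longrightarrow> a * b \<in> J"
  obtains g where "g \<in> J" "\<And>a. a \<in> J \<Longrightarrow> g dvd a"
proof (cases "J = {0}")
  case False
  then obtain g where g: "g \<in> J" "g \<noteq> 0" "\<And>h. h \<in> J \<Longrightarrow> h \<noteq> 0 \<Longrightarrow> degree g \<le> degree h"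
    using assms(1) ex_has_least_nat[of "\<lambda>g. g \<in> J \<and> g \<noteq> 0" _ degree] by (metis insertI1 singletonD subsetI subset_antisym)
  have "g dvd a" if "a \<in> J" for a
  proof -
    have "a + g * - (a div g) \<in> J" using assms g that by blast
    then have "a mod g \<in> J" by (simp add: minus_mult_div_eq_mod)
    then have "a mod g = 0" using g degree_mod_less[of g a] by (meson not_le)
    then show ?thesis by auto
  qed
  with g that show ?thesis by blast
qed (use that in auto)

text \<open>A nonconstant common divisor of \<open>J\<close> of least degree generates a maximal
  ideal: if it does not divide \<open>u\<close>, a generator of the ideal spanned by both is a
  divisor of smaller degree, hence constant.\<close>

lemma exists_maximal_element:
  fixes J :: "'k::field poly set"
  assumes "0 \<in> J" "\<And>a b. a \<in> J \<Longrightarrow> b \<in> J \<Longrightarrow> a + b \<in> J" "\<And>a b. a \<in> J \<Longrightarrow> a * b \<in> J" "1 \<notin> J"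
  obtains \<pi> where "maximal_element \<pi>" "\<And>a. a \<in> J \<Longrightarrow> \<pi> dvd a"
proof -
  define D where "D = {p. degree p > 0 \<and> (\<forall>a\<in>J. p dvd a)}"
  have "\<exists>p. p \<in> D"
  proof -
    obtain g where g: "g \<in> J" "\<And>a. a \<in> J \<Longrightarrow> g dvd a"
      using poly_ideal_principal[of J] assms by blast
    show ?thesis
    proof (cases "g = 0")
      case True
      \<comment> \<open>For the zero ideal any nonconstant polynomial will do.\<close>
      then have "[:0, 1:] \<in> D" using g by (auto simp: D_def)
      then show ?thesis ..
    next
      case False
      have "degree g > 0"
      proof (rule ccontr)
        assume "\<not> degree g > 0"
        then have "is_unit g" using False by (simp add: is_unit_iff_degree)
        then obtain h where "1 = g * h" by (auto elim: dvdE)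
        then show False using assms(3,4) g(1) by metis
      qed
      with g show ?thesis by (auto simp: D_def)
    qed
  qed
  then obtain p where p: "p \<in> D" "\<And>q. q \<in> D \<Longrightarrow> degree p \<le> degree q"
    using ex_has_least_nat[of "\<lambda>p. p \<in> D" _ degree] by blast
  have "maximal_element p"
  proof
    show "\<not> p dvd 1" using p by (cases "p = 0") (auto simp: D_def is_unit_iff_degree)
    fix u assume u: "\<not> p dvd u"
    define L where "L = {w * u + v * p | w v. True}"
    have L: "w * u + v * p \<in> L" for w v by (auto simp: L_def)
    obtain g where g: "g \<in> L" "\<And>a. a \<in> L \<Longrightarrow> g dvd a"
    proof (rule poly_ideal_principal[of L])
      show "0 \<in> L" using L[of 0 0] by simp
      fix a b assume "a \<in> L"
      then obtain w v where a: "a = w * u + v * p" by (auto simp: L_def)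
      show "a * b \<in> L" using L[of "w * b" "v * b"] by (simp add: a algebra_simps)
      assume "b \<in> L"
      then obtain w' v' where b: "b = w' * u + v' * p" by (auto simp: L_def)
      show "a + b \<in> L" using L[of "w + w'" "v + v'"] by (simp add: a b algebra_simps)
    qed blast
    have gu: "g dvd u" and gp: "g dvd p" using g(2)[OF L[of 1 0]] g(2)[OF L[of 0 1]] by simp_all
    have "p \<noteq> 0" using p(1) by (auto simp: D_def)
    then have "g \<noteq> 0" using gp by auto
    have "degree g = 0"
    proof (rule ccontr)
      assume "degree g \<noteq> 0"
      then have "g \<in> D" using p(1) gp by (auto simp: D_def intro: dvd_trans)
      then have "degree p \<le> degree g" by (rule p(2))
      moreover obtain q where q: "p = g * q" using gp by (auto elim: dvdE)
      ultimately have "degree q = 0" using \<open>p \<noteq> 0\<close> by (auto simp: degree_mult_eq)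
      then have "is_unit q" using \<open>p \<noteq> 0\<close> q by (auto simp: is_unit_iff_degree)
      then have "p dvd g" using q by (metis dvd_refl mult_unit_dvd_iff)
      then show False using gu u dvd_trans by blast
    qed
    then obtain h where h: "g * h = 1" using \<open>g \<noteq> 0\<close> by (metis dvdE is_unit_iff_degree)
    obtain w v where wv: "g = w * u + v * p" using g(1) by (auto simp: L_def)
    have "(h * w) * u - 1 = p * (- v * h)" using h unfolding wv by (simp add: algebra_simps)
    then show "\<exists>w. p dvd w * u - 1" by (metis dvd_triv_left)
  qed
  with p(1) that show ?thesis by (auto simp: D_def)
qed

text \<open>The elements \<open>s\<close> such that \<open>M(a)\<close> and \<open>M(b)\<close> are equivalent whenever \<open>a\<close> and \<open>b\<close> are congruent
  modulo \<open>s\<close> form an ideal, which by the local hypothesis lies in no maximal ideal.\<close>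

lemma local_global:
  fixes M :: "'k::field poly poly ^ 'n::finite ^ 'n"
  assumes "card I \<ge> 3"
    and locally: "\<And>\<pi>::'k poly. maximal_element \<pi> \<Longrightarrow>
      \<exists>\<gamma>\<in>El I (local_subring.polys (maximal_element.localization \<pi>)). \<exists>C.
        map_matrix fract_poly M = map_matrix (\<lambda>c. [:c:]) C ** \<gamma>"
  obtains \<epsilon> where "\<epsilon> \<in> El I UNIV" "M = map_matrix (\<lambda>p. [:coeff p 0:]) M ** \<epsilon>"
proof -
  let ?sub = "\<lambda>a. map_matrix (\<lambda>p. pcompose p a) M"
  define J where "J = {s. \<forall>a b. [:s:] dvd a - b \<longrightarrow> (\<exists>\<epsilon>\<in>El I UNIV. ?sub a = ?sub b ** \<epsilon>)}"
  have "1 \<in> J"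
  proof (rule ccontr)
    assume J1: "1 \<notin> J"
    have J0: "0 \<in> J"
      unfolding J_def by (auto intro!: bexI[OF _ El.one])
    have J2: "s * r \<in> J" if "s \<in> J" for s r
    proof -
      have "[:s:] dvd [:s * r:]" by (intro dvdI[of _ _ "[:r:]"]) simp
      then show ?thesis using that dvd_trans unfolding J_def by blast
    qed
    have J3: "s + t \<in> J" if st: "s \<in> J" "t \<in> J" for s t
      unfolding J_def
    proof (intro CollectI allI impI)
      fix a b assume "[:s + t:] dvd a - b"
      then obtain h where h: "a - b = [:s + t:] * h" by (auto elim: dvdE)
      \<comment> \<open>The intermediate point \<open>b + t h\<close> is congruent to
        \<open>a\<close> modulo \<open>s\<close> and to \<open>b\<close> modulo
        \<open>t\<close>.\<close>
      have "a - (b + [:t:] * h) = [:s:] * h" "(b + [:t:] * h) - b = [:t:] * h"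
        using h by (simp_all add: algebra_simps flip: smult_add_left)
      then have "[:s:] dvd a - (b + [:t:] * h)" "[:t:] dvd (b + [:t:] * h) - b"
        by (simp_all only: dvd_triv_left)
      then obtain \<epsilon> \<epsilon>' where "\<epsilon> \<in> El I UNIV" "\<epsilon>' \<in> El I UNIV"
        "?sub a = ?sub (b + [:t:] * h) ** \<epsilon>" "?sub (b + [:t:] * h) = ?sub b ** \<epsilon>'"
        using st unfolding J_def by blast
      then show "\<exists>\<epsilon>\<in>El I UNIV. ?sub a = ?sub b ** \<epsilon>"
        by (intro bexI[of _ "\<epsilon>' ** \<epsilon>"]) (simp_all add: matrix_mul_assoc El_mult)
    qed
    obtain \<pi> where \<pi>: "maximal_element \<pi>" "\<And>a. a \<in> J \<Longrightarrow> \<pi> dvd a"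
      using exists_maximal_element[OF J0 J3 J2 J1] by blast
    interpret maximal_element \<pi> by (rule \<pi>)
    obtain \<gamma> C where \<gamma>: "\<gamma> \<in> El I polys" "map_matrix fract_poly M = map_matrix (\<lambda>c. [:c:]) C ** \<gamma>"
      using locally[OF \<pi>(1)] by blast
    obtain s where s: "\<not> \<pi> dvd s" "\<And>a b. [:s:] dvd a - b \<Longrightarrow> \<exists>N\<in>El I (multiples 1).
        map_matrix (\<lambda>p. pcompose p (fract_poly a)) \<gamma> = map_matrix (\<lambda>p. pcompose p (fract_poly b)) \<gamma> ** N"
      using El_polys_congruent[OF \<gamma>(1) assms(1) not_unit] by blast
    \<comment> \<open>\<open>C\<close> has entries free of the variable, so substitutions do not
      affect it, and \<open>M(a) = C \<gamma>(a) = C \<gamma>(b) N = M(b) N\<close> holds without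
      inverting \<open>C\<close>.\<close>
    have sub: "map_matrix fract_poly (?sub a) =
        map_matrix (\<lambda>c. [:c:]) C ** map_matrix (\<lambda>p. pcompose p (fract_poly a)) \<gamma>" for a
    proof -
      have "map_matrix fract_poly (?sub a) =
          map_matrix (\<lambda>p. pcompose p (fract_poly a)) (map_matrix fract_poly M)"
        by (simp add: vec_eq_iff fract_poly_pcompose)
      also have "\<dots> = map_matrix (\<lambda>p. pcompose p (fract_poly a)) (map_matrix (\<lambda>c. [:c:]) C) **
          map_matrix (\<lambda>p. pcompose p (fract_poly a)) \<gamma>"
        unfolding \<gamma>(2) by (rule map_matrix_mult[OF unital_ring_hom_pcompose])
      also have "map_matrix (\<lambda>p. pcompose p (fract_poly a)) (map_matrix (\<lambda>c. [:c:]) C) =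
          map_matrix (\<lambda>c. [:c:]) C"
        by (simp add: vec_eq_iff)
      finally show ?thesis .
    qed
    have "s \<in> J"
      unfolding J_def
    proof (intro CollectI allI impI)
      fix a b assume "[:s:] dvd a - b"
      then obtain N where N: "N \<in> El I (multiples 1)" "map_matrix (\<lambda>p. pcompose p (fract_poly a)) \<gamma> =
          map_matrix (\<lambda>p. pcompose p (fract_poly b)) \<gamma> ** N"
        using s(2) by blast
      \<comment> \<open>For \<open>t = 1\<close> the entries of the factors of \<open>N\<close> are
        free of denominators, so \<open>N\<close> descends to \<open>K[x][y]\<close>.\<close>
      have "multiples 1 = range fract_poly" by (simp add: multiples_def)
      then obtain \<epsilon> where \<epsilon>: "\<epsilon> \<in> El I UNIV" "N = map_matrix fract_poly \<epsilon>"
        using El_image[OF unital_ring_hom_fract_poly] N(1) by metis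
      have "map_matrix fract_poly (?sub a) = map_matrix fract_poly (?sub b ** \<epsilon>)"
        unfolding sub map_matrix_mult[OF unital_ring_hom_fract_poly] N(2) \<epsilon>(2)
        by (simp only: matrix_mul_assoc)
      then have "?sub a = ?sub b ** \<epsilon>"
        by (simp add: vec_eq_iff)
      with \<epsilon>(1) show "\<exists>\<epsilon>\<in>El I UNIV. ?sub a = ?sub b ** \<epsilon>" by blast
    qed
    then show False using \<pi>(2) s(1) by blast
  qed
  \<comment> \<open>Any two points are congruent modulo 1, in particular \<open>y\<close> and 0:
    \<open>M(y) = M(0) \<epsilon>\<close>.\<close>
  then obtain \<epsilon> where "\<epsilon> \<in> El I UNIV" "?sub [:0, 1:] = ?sub 0 ** \<epsilon>"
    unfolding J_def by (auto simp: one_pCons[symmetric])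
  with that show ?thesis by (simp add: pcompose_0' map_matrix_def)
qed

section \<open>Nagata's substitution\<close>

lemma unital_ring_hom_comp:
  "unital_ring_hom g \<Longrightarrow> unital_ring_hom h \<Longrightarrow> unital_ring_hom (\<lambda>x. g (h x))"
  by (simp add: unital_ring_hom_def)

lemma unital_ring_hom_const: "unital_ring_hom (\<lambda>c. [:c:])"
  by (simp add: unital_ring_hom_def one_pCons)

lemma unital_ring_hom_poly: "unital_ring_hom (\<lambda>p. poly p x)"
  by (simp add: unital_ring_hom_def)

lemma unital_ring_hom_map_poly:
  assumes "unital_ring_hom h"
  shows "unital_ring_hom (map_poly h)"
proof -
  note h = unital_ring_homD[OF assms]
  have "map_poly h (p * q) = map_poly h p * map_poly h q" for p q
    by (rule poly_eqI) (simp add: coeff_map_poly coeff_mult h)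
  moreover have "map_poly h (p + q) = map_poly h p + map_poly h q" for p q
    by (rule poly_eqI) (simp add: coeff_map_poly h)
  ultimately show ?thesis
    by (simp add: unital_ring_hom_def h)
qed

text \<open>The endomorphism of \<open>K[x][y]\<close> with \<open>x \<mapsto> q\<close> and \<open>y \<mapsto> y\<close>.\<close>

definition substitute_x :: "'k::field poly poly \<Rightarrow> 'k poly poly \<Rightarrow> 'k poly poly"
  where "substitute_x q p = poly (map_poly (\<lambda>a. pcompose (map_poly (\<lambda>c. [:c:]) a) q) p) [:0, 1:]"

lemma unital_ring_hom_substitute_x: "unital_ring_hom (substitute_x q)"
  unfolding substitute_x_def
  by (intro unital_ring_hom_comp[OF unital_ring_hom_poly] unital_ring_hom_map_poly
    unital_ring_hom_comp[OF unital_ring_hom_pcompose] unital_ring_hom_const)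

lemma substitute_x_generators:
  "substitute_x q [:[:c:]:] = [:[:c:]:]" "substitute_x q [:[:0, 1:]:] = q" "substitute_x q [:0, 1:] = [:0, 1:]"
  by (simp_all add: substitute_x_def map_poly_pCons pcompose_pCons pcompose_1 flip: one_pCons)

lemma poly_poly_hom_eqI:
  fixes f g :: "'k::field poly poly \<Rightarrow> 'r::comm_ring_1"
  assumes f: "unital_ring_hom f" and g: "unital_ring_hom g"
    and "\<And>c. f [:[:c:]:] = g [:[:c:]:]" "f [:[:0, 1:]:] = g [:[:0, 1:]:]" "f [:0, 1:] = g [:0, 1:]"
  shows "f p = g p"
proof -
  note f = unital_ring_homD[OF f] and g = unital_ring_homD[OF g]
  have c: "f [:a:] = g [:a:]" for a
  proof (induction a)
    case 0
    show ?case by (simp add: f g)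
  next
    case (pCons c a)
    have "[:pCons c a:] = [:[:c:]:] + [:[:0, 1:]:] * [:a:]" by simp
    then show ?case using pCons assms by (simp only: f g)
  qed
  show ?thesis
  proof (induction p)
    case 0
    show ?case by (simp add: f g)
  next
    case (pCons a p)
    have "pCons a p = [:a:] + [:0, 1:] * p" by simp
    then show ?case using pCons assms c by (simp only: f g)
  qed
qed

lemma substitute_x_inverse:
  "substitute_x ([:[:0, 1:]:] - monom 1 N) (substitute_x ([:[:0, 1:]:] + monom 1 N) p) = p"
proof -
  let ?q = "[:[:0, 1:]:] + monom 1 N :: 'a poly poly" and ?q' = "[:[:0, 1:]:] - monom 1 N :: 'a poly poly"
  note h = unital_ring_homD[OF unital_ring_hom_substitute_x]
  have "substitute_x ?q' ([:0, 1:] ^ m) = [:0, 1:] ^ m" for m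
    by (induction m) (simp_all only: power_0 power_Suc h substitute_x_generators)
  moreover have "(monom 1 N :: 'a poly poly) = [:0, 1:] ^ N" by (simp add: monom_altdef)
  ultimately have "substitute_x ?q' (monom 1 N) = monom 1 N" by metis
  then have "substitute_x ?q' ?q = ?q' + monom 1 N"
    by (simp only: h(3) substitute_x_generators)
  also have "\<dots> = [:[:0, 1:]:]" by (rule diff_add_cancel)
  finally have q: "substitute_x ?q' ?q = [:[:0, 1:]:]" .
  show ?thesis
  proof (rule poly_poly_hom_eqI[of "\<lambda>p. substitute_x ?q' (substitute_x ?q p)" "\<lambda>p. p"])
    show "unital_ring_hom (\<lambda>p. substitute_x ?q' (substitute_x ?q p))"
      by (rule unital_ring_hom_comp[OF unital_ring_hom_substitute_x unital_ring_hom_substitute_x])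
  qed (simp_all only: unital_ring_hom_def substitute_x_generators q simp_thms)
qed

text \<open>The summand of highest degree cannot be cancelled. The clause on the degree of the sum
  is there for the induction: it shows that the next summand has a different degree from the sum so
  far.\<close>

lemma lead_coeff_sum_distinct_degrees:
  fixes f :: "'a \<Rightarrow> 'r::comm_ring_1 poly"
  assumes "finite A" "A \<noteq> {}" "\<And>x. x \<in> A \<Longrightarrow> lead_coeff (f x) \<in> U" "inj_on (\<lambda>x. degree (f x)) A"
  shows "lead_coeff (sum f A) \<in> U \<and> degree (sum f A) \<in> (\<lambda>x. degree (f x)) ` A"
  using assms
proof (induction rule: finite_ne_induct)
  case (insert x A)
  then have IH: "lead_coeff (sum f A) \<in> U" "degree (sum f A) \<in> (\<lambda>x. degree (f x)) ` A"
    by auto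
  moreover have "degree (f x) \<notin> (\<lambda>x. degree (f x)) ` A"
    using insert.prems(2) insert.hyps by (auto simp: inj_on_def)
  ultimately have "degree (f x) \<noteq> degree (sum f A)" by metis
  then consider "degree (f x) < degree (sum f A)" | "degree (sum f A) < degree (f x)" by linarith
  then show ?case
  proof cases
    case 1
    then have "degree (f x + sum f A) = degree (sum f A)" "lead_coeff (f x + sum f A) = lead_coeff (sum f A)"
      by (rule degree_add_eq_right, rule lead_coeff_add_le)
    then show ?thesis using IH insert.hyps by (simp only: sum.insert image_insert insert_iff simp_thms)
  next
    case 2
    then have "degree (f x + sum f A) = degree (f x)" "lead_coeff (f x + sum f A) = lead_coeff (f x)"
      by (simp_all add: degree_add_eq_left coeff_eq_0)
    then show ?thesis using insert by auto
  qed
qed auto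

text \<open>With \<open>N > deg\<^sub>y p\<close> the summands \<open>a\<^sub>j(x + y\<^sup>N) y\<^sup>j\<close> have pairwise different degrees in \<open>y\<close>.\<close>

lemma lead_coeff_substitute_x:
  fixes p :: "'k::field poly poly"
  assumes "p \<noteq> 0" "N > degree p"
  shows "\<exists>c\<noteq>0. lead_coeff (substitute_x ([:[:0, 1:]:] + monom 1 N) p) = [:c:]"
proof -
  let ?q = "[:[:0, 1:]:] + monom 1 N :: 'k poly poly"
  let ?a = "\<lambda>j. pcompose (map_poly (\<lambda>c. [:c:]) (coeff p j)) ?q"
  let ?T = "\<lambda>j. ?a j * [:0, 1:] ^ j"
  define A where "A = {j. coeff p j \<noteq> 0}"
  have N: "N > 0" using assms by simp
  have q: "degree ?q = N" "lead_coeff ?q = 1"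
    using N by (simp_all add: degree_add_eq_right degree_monom_eq coeff_pCons split: nat.split)
  have "A \<subseteq> {..degree p}" "degree p \<in> A"
    using assms by (auto simp: A_def intro: le_degree)
  then have A: "A \<subseteq> {..degree p}" "A \<noteq> {}" "finite A"
    by (auto intro: finite_subset[of _ "{..degree p}"])
  have deg: "degree (?T j) = degree (coeff p j) * N + j" and lead: "lead_coeff (?T j) = [:lead_coeff (coeff p j):]"
    if "j \<in> A" for j
  proof -
    have *: "degree (map_poly (\<lambda>c. [:c:]) (coeff p j)) = degree (coeff p j)"
      by (simp add: degree_map_poly)
    have a: "degree (?a j) = degree (coeff p j) * N" by (simp add: degree_pcompose * q)
    have l: "lead_coeff (?a j) = [:lead_coeff (coeff p j):]"
      using N q by (subst lead_coeff_comp) (simp_all add: * coeff_map_poly)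
    then have nz: "?a j \<noteq> 0" using that by (auto simp: A_def)
    have y1: "degree ([:0, 1:] ^ j :: 'k poly poly) = j" by (rule degree_linear_power)
    have y2: "lead_coeff ([:0, 1:] ^ j :: 'k poly poly) = 1" by (simp only: lead_coeff_power) simp
    have y3: "[:0, 1:] ^ j \<noteq> (0 :: 'k poly poly)" by simp
    show "degree (?T j) = degree (coeff p j) * N + j"
      by (simp only: degree_mult_eq[OF nz y3] a y1)
    show "lead_coeff (?T j) = [:lead_coeff (coeff p j):]"
      by (simp only: lead_coeff_mult l y2 mult_1_right)
  qed
  have deg_map: "degree (map_poly h p) = degree p" if "\<And>c. h c = 0 \<longleftrightarrow> c = 0" for h :: "'k poly \<Rightarrow> 'k poly poly"
    using that by (intro degree_map_poly) simp
  have "pcompose (map_poly (\<lambda>c. [:c:]) a) ?q = 0 \<longleftrightarrow> a = 0" for a :: "'k poly"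
    using pcompose_eq_0[of "map_poly (\<lambda>c. [:c:]) a" ?q] N q by (auto simp: map_poly_eq_0_iff)
  then have "substitute_x ?q p = (\<Sum>j\<le>degree p. ?T j)"
    unfolding substitute_x_def poly_altdef by (simp add: deg_map coeff_map_poly)
  also have "\<dots> = sum ?T A"
    using A by (intro sum.mono_neutral_right) (auto simp: A_def)
  finally have eq: "substitute_x ?q p = sum ?T A" .
  have "lead_coeff (sum ?T A) \<in> {[:c:] | c. c \<noteq> 0} \<and> degree (sum ?T A) \<in> (\<lambda>j. degree (?T j)) ` A"
  proof (rule lead_coeff_sum_distinct_degrees[OF A(3,2)])
    \<comment> \<open>The degrees are \<open>deg(a_j) * N + j\<close> with \<open>j < N\<close>, so
      the remainder modulo \<open>N\<close> recovers \<open>j\<close>.\<close>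
    show "inj_on (\<lambda>j. degree (?T j)) A"
    proof (rule inj_onI)
      fix i j assume ij: "i \<in> A" "j \<in> A" "degree (?T i) = degree (?T j)"
      then have e: "degree (coeff p i) * N + i = degree (coeff p j) * N + j"
        by (simp only: deg)
      have lt: "i < N" "j < N" using ij(1,2) A(1) assms(2) by auto
      have mod: "(d * N + k) mod N = k" if "k < N" for d k
        using that by simp
      show "i = j" using arg_cong[OF e, of "\<lambda>x. x mod N"] unfolding mod[OF lt(1)] mod[OF lt(2)] .
    qed
    show "lead_coeff (?T j) \<in> {[:c:] | c. c \<noteq> 0}" if "j \<in> A" for j
      using that unfolding lead[OF that] by (auto simp: A_def)
  qed
  then show ?thesis unfolding eq by blast
qed

section \<open>Suslin's theorem for \<open>K[x, y]\<close>\<close>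

lemma reach_image:
  assumes "unital_ring_hom h" "reach I UNIV v w"
  shows "reach I UNIV (\<chi> i. h (v $ i)) (\<chi> i. h (w $ i))"
proof -
  obtain M where M: "M \<in> El I UNIV" "v v* M = w" using assms(2) by (auto simp: reach_def)
  have "(\<chi> i. h (v $ i)) v* map_matrix h M = (\<chi> i. h (w $ i))"
    unfolding M(2)[symmetric]
    by (simp add: vec_eq_iff vector_matrix_mult_def unital_ring_homD[OF assms(1)])
  then show ?thesis
    unfolding reach_def using map_matrix_El[OF assms(1) M(1)] El_mono by blast
qed

lemma axis_image:
  assumes "unital_ring_hom h"
  shows "(\<chi> i. h (axis k 1 $ i)) = axis k 1"
  by (simp add: vec_eq_iff axis_def unital_ring_homD[OF assms])

lemma unimodular_image:
  assumes "unital_ring_hom h" "unimodular UNIV v" "range h \<subseteq> S"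
  shows "unimodular S (\<chi> i. h (v $ i))"
proof -
  note h = unital_ring_homD[OF assms(1)]
  obtain w where "(\<Sum>i\<in>UNIV. v $ i * w $ i) = 1" using assms(2) by (auto simp: unimodular_def)
  then have "(\<Sum>i\<in>UNIV. h (v $ i) * h (w $ i)) = 1" by (metis (no_types, lifting) h(1,4,7) sum.cong)
  then show ?thesis using assms(3) unfolding unimodular_def by (intro exI[of _ "\<chi> i. h (w $ i)"]) auto
qed

lemma (in maximal_element) unit_to_fract_const:
  fixes c :: 'r
  assumes "c dvd 1"
  shows "unit (to_fract c)"
proof -
  obtain d where d: "1 = c * d" using assms by (rule dvdE)
  have "to_fract c * to_fract d = 1" by (simp flip: to_fract_mult d)
  then have "inverse (to_fract c) = to_fract d" "to_fract c \<noteq> 0" by (auto simp: inverse_unique)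
  then show ?thesis unfolding unit_def by (simp add: to_fract_localization)
qed

lemma lead_coeff_fract_poly: "lead_coeff (fract_poly p) = to_fract (lead_coeff p)"
  by (simp add: coeff_map_poly degree_map_poly)

lemma unital_ring_hom_const_coeff: "unital_ring_hom (\<lambda>p. coeff p 0)"
  by (simp add: unital_ring_hom_def coeff_mult_0)

lemma reach_unimodular_poly_poly:
  fixes v :: "'k::field poly poly ^ 'n::finite"
  assumes "card I \<ge> 3" "k \<in> I" "\<And>l. l \<notin> I \<Longrightarrow> v $ l = 0" "unimodular UNIV v"
  shows "reach I UNIV v (axis k 1)"
proof -
  have "\<exists>i. v $ i \<noteq> 0"
  proof (rule ccontr)
    assume "\<nexists>i. v $ i \<noteq> 0"
    with assms(4) show False by (simp add: unimodular_def)
  qed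
  then obtain i where i: "v $ i \<noteq> 0" by blast
  define N where "N = Suc (degree (v $ i))"
  define \<sigma> where "\<sigma> = (substitute_x ([:[:0, 1:]:] + monom 1 N) :: 'k poly poly \<Rightarrow> _)"
  define \<sigma>' where "\<sigma>' = (substitute_x ([:[:0, 1:]:] - monom 1 N) :: 'k poly poly \<Rightarrow> _)"
  have \<sigma>: "unital_ring_hom \<sigma>" "unital_ring_hom \<sigma>'" "\<And>p. \<sigma>' (\<sigma> p) = p"
    by (simp_all add: \<sigma>_def \<sigma>'_def unital_ring_hom_substitute_x substitute_x_inverse)
  define w where "w = (\<chi> i. \<sigma> (v $ i))"
  obtain c where c: "c \<noteq> 0" "lead_coeff (w $ i) = [:c:]"
    using lead_coeff_substitute_x[OF i, of N] by (auto simp: w_def \<sigma>_def N_def)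
  have w0: "w $ l = 0" if "l \<notin> I" for l
    using assms(3)[OF that] unital_ring_homD(2)[OF \<sigma>(1)] by (simp add: w_def)
  have w: "unimodular UNIV w"
    unfolding w_def using \<sigma>(1) assms(4) by (rule unimodular_image) simp
  \<comment> \<open>\<open>local_global\<close> speaks of square matrices, so the row is repeated.
    Locally every row is a unit vector times \<open>\<gamma>\<close>; the resulting \<open>C\<close>
    has equal rows, which the principle permits since it never inverts \<open>C\<close>.\<close>
  define M :: "'k poly poly ^ 'n ^ 'n" where "M = (\<chi> r. w)"
  have "\<exists>\<gamma>\<in>El I (local_subring.polys (maximal_element.localization \<pi>)). \<exists>C.
      map_matrix fract_poly M = map_matrix (\<lambda>c. [:c:]) C ** \<gamma>"
    if "maximal_element \<pi>" for \<pi> :: "'k poly"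
  proof -
    interpret maximal_element \<pi> by (rule that)
    let ?w = "\<chi> i. fract_poly (w $ i)"
    have "reach I polys ?w (axis k 1)"
    proof (rule reach_axis_polys[OF assms(1) _ assms(2)])
      show "i \<in> I" using i assms(3) by blast
      show "unit (lead_coeff (?w $ i))"
        using c by (simp add: lead_coeff_fract_poly unit_to_fract_const is_unit_iff_degree)
      show "unimodular polys ?w"
        by (rule unimodular_image[OF unital_ring_hom_fract_poly w]) (auto simp: fract_poly_polys)
    qed (auto simp: fract_poly_polys w0)
    then obtain \<gamma>' where \<gamma>': "\<gamma>' \<in> El I polys" "?w v* \<gamma>' = axis k 1" by (auto simp: reach_def)
    obtain \<gamma> where \<gamma>: "\<gamma> \<in> El I polys" "\<gamma>' ** \<gamma> = mat 1"
      using El_inverse[OF \<gamma>'(1)] polys(5) by metis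
    have "?w = ?w v* (\<gamma>' ** \<gamma>)" by (simp add: \<gamma>)
    then have e: "?w = axis k 1 v* \<gamma>" by (simp add: \<gamma>' flip: vector_matrix_mult_assoc)
    have "map_matrix fract_poly M = map_matrix (\<lambda>c. [:c:]) (\<chi> r. axis k 1) ** \<gamma>"
    proof -
      have "map_matrix fract_poly M $ r = (map_matrix (\<lambda>c. [:c:]) (\<chi> r. axis k 1) ** \<gamma>) $ r" for r
      proof -
        have "map_matrix (\<lambda>c. [:c:]) (\<chi> r. axis k 1) $ r = (axis k 1 :: 'k poly fract poly ^ 'n)"
          by (simp add: vec_eq_iff axis_def one_pCons)
        moreover have "map_matrix fract_poly M $ r = ?w" by (simp add: vec_eq_iff M_def)
        ultimately show ?thesis by (simp only: row_matrix_mult e)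
      qed
      then show ?thesis by (simp add: vec_eq_iff)
    qed
    with \<gamma>(1) show ?thesis by blast
  qed
  from local_global[OF assms(1) this] obtain \<epsilon>
    where \<epsilon>: "\<epsilon> \<in> El I UNIV" "M = map_matrix (\<lambda>p. [:coeff p 0:]) M ** \<epsilon>" by blast
  let ?w0 = "\<chi> i. coeff (w $ i) 0"
  let ?w1 = "\<chi> i. [:coeff (w $ i) 0:]"
  have "M $ k = map_matrix (\<lambda>p. [:coeff p 0:]) M $ k v* \<epsilon>"
    using arg_cong[OF \<epsilon>(2), of "\<lambda>M. M $ k"] by (simp only: row_matrix_mult)
  moreover have "map_matrix (\<lambda>p. [:coeff p 0:]) M $ k = ?w1" by (simp add: vec_eq_iff M_def)
  ultimately have w1: "w = ?w1 v* \<epsilon>" by (simp add: M_def)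
  have "reach I UNIV ?w0 (axis k 1)"
    using assms(1,2) w0 unimodular_image[OF unital_ring_hom_const_coeff w]
    by (intro reach_unimodular_poly) auto
  then have "reach I UNIV (\<chi> i. [:?w0 $ i:]) (\<chi> i. [:axis k 1 $ i:])"
    by (rule reach_image[OF unital_ring_hom_const])
  then have r: "reach I UNIV ?w1 (axis k 1)"
    by (simp add: axis_image[OF unital_ring_hom_const])
  obtain \<epsilon>' where \<epsilon>': "\<epsilon>' \<in> El I UNIV" "\<epsilon> ** \<epsilon>' = mat 1"
    using El_inverse[OF \<epsilon>(1)] by auto
  have "w v* \<epsilon>' = ?w1"
    using arg_cong[OF w1, of "\<lambda>x. x v* \<epsilon>'"]
    by (simp only: vector_matrix_mult_assoc \<epsilon>' vector_matrix_mul_rid)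
  then have "reach I UNIV w ?w1" using \<epsilon>'(1) unfolding reach_def by blast
  also note r
  finally have "reach I UNIV (\<chi> i. \<sigma>' (w $ i)) (\<chi> i. \<sigma>' (axis k 1 $ i))"
    by (rule reach_image[OF \<sigma>(2)])
  moreover have "(\<chi> i. \<sigma>' (w $ i)) = v" by (simp add: vec_eq_iff w_def \<sigma>(3))
  ultimately show ?thesis by (simp add: axis_image[OF \<sigma>(2)])
qed

lemma map_matrix_block:
  assumes "unital_ring_hom h"
  shows "map_matrix h (block i j a b c d) = block i j (h a) (h b) (h c) (h d)"
  by (simp add: vec_eq_iff block_def unital_ring_homD[OF assms])

lemma invertible_block:
  assumes "a * d - b * c = 1" "i \<noteq> j"
  shows "invertible (block i j a b c d)"
proof -
  have d: "a * d - c * b = 1" "d * a - b * c = 1" "d * a - c * b = 1" using assms(1) by (simp_all add: mult.commute)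
  have "block i j a b c d ** block i j d (- b) (- c) a = mat 1"
    "block i j d (- b) (- c) a ** block i j a b c d = mat 1"
    unfolding vec_eq_iff block_mult_nth[OF assms(2)]
    using assms d by (auto simp: block_def mat_def algebra_simps)
  then show ?thesis by (auto simp: invertible_def)
qed

text \<open>Locally the block is a product of elementary matrices because its symbol is trivial, so
  the principle applies with the identity as \<open>C\<close>. The block at \<open>y = 0\<close>
  lives over \<open>K[x]\<close> and is factored by \<open>GL_poly_eq_GE\<close>, possibly with
  diagonal factors; hence the conclusion is membership in \<open>GE\<close>.\<close>

lemma block_in_GE:
  fixes f g p q :: "'k::field poly poly"
  assumes "CARD('n::finite) \<ge> 3" "i \<noteq> j" "f * p - g * q = 1"
  shows "(block i j f g q p :: 'k poly poly ^ 'n ^ 'n) \<in> GE"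
proof -
  have main: "(block i j f g q p :: 'k poly poly ^ 'n ^ 'n) \<in> GE"
    if f0: "f \<noteq> 0" and det: "f * p - g * q = 1" for f g p q :: "'k poly poly"
  proof -
    define N where "N = Suc (degree f)"
    define \<sigma> where "\<sigma> = (substitute_x ([:[:0, 1:]:] + monom 1 N) :: 'k poly poly \<Rightarrow> _)"
    define \<sigma>' where "\<sigma>' = (substitute_x ([:[:0, 1:]:] - monom 1 N) :: 'k poly poly \<Rightarrow> _)"
    have \<sigma>: "unital_ring_hom \<sigma>" "unital_ring_hom \<sigma>'" "\<And>p. \<sigma>' (\<sigma> p) = p"
      by (simp_all add: \<sigma>_def \<sigma>'_def unital_ring_hom_substitute_x substitute_x_inverse)
    obtain c where c: "c \<noteq> 0" "lead_coeff (\<sigma> f) = [:c:]"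
      using lead_coeff_substitute_x[OF f0, of N] by (auto simp: \<sigma>_def N_def)
    have det': "\<sigma> f * \<sigma> p - \<sigma> g * \<sigma> q = 1"
      using arg_cong[OF det, of \<sigma>] by (simp only: unital_ring_homD[OF \<sigma>(1)])
    define M :: "'k poly poly ^ 'n ^ 'n" where "M = block i j (\<sigma> f) (\<sigma> g) (\<sigma> q) (\<sigma> p)"
    have card: "card (UNIV :: 'n set) \<ge> 3" using assms(1) by simp
    have "\<exists>\<gamma>\<in>El UNIV (local_subring.polys (maximal_element.localization \<pi>)). \<exists>C.
        map_matrix fract_poly M = map_matrix (\<lambda>c. [:c:]) C ** \<gamma>"
      if "maximal_element \<pi>" for \<pi> :: "'k poly"
    proof -
      interpret maximal_element \<pi> by (rule that)
      have "trivial_symbol (UNIV :: 'n set) polys (fract_poly (\<sigma> f)) (fract_poly (\<sigma> g))"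
        using c by (intro trivial_symbol_polys card fract_poly_polys)
          (simp add: lead_coeff_fract_poly unit_to_fract_const is_unit_iff_degree)
      moreover have "fract_poly (\<sigma> f) * fract_poly (\<sigma> p) - fract_poly (\<sigma> g) * fract_poly (\<sigma> q) = 1"
        using arg_cong[OF det', of fract_poly] by simp
      ultimately have "map_matrix fract_poly M \<in> El UNIV polys"
        unfolding trivial_symbol_def using assms(2)
        by (simp add: M_def map_matrix_block unital_ring_hom_fract_poly fract_poly_polys)
      then show ?thesis
        by (intro bexI[of _ "map_matrix fract_poly M"] exI[of _ "mat 1"])
          (simp_all add: map_matrix_one unital_ring_hom_const)
    qed
    from local_global[OF card this] obtain \<epsilon>
      where \<epsilon>: "\<epsilon> \<in> El UNIV UNIV" "M = map_matrix (\<lambda>p. [:coeff p 0:]) M ** \<epsilon>" by blast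
    have "invertible M" unfolding M_def using det' assms(2) by (rule invertible_block)
    then have "map_matrix (\<lambda>p. coeff p 0) M \<in> GE"
      by (intro GL_poly_eq_GE invertible_map_matrix unital_ring_hom_const_coeff)
    then have "map_matrix (\<lambda>c. [:c:]) (map_matrix (\<lambda>p. coeff p 0) M) \<in> GE"
      by (rule map_matrix_GE[OF unital_ring_hom_const])
    moreover have "map_matrix (\<lambda>c. [:c:]) (map_matrix (\<lambda>p. coeff p 0) M) = map_matrix (\<lambda>p. [:coeff p 0:]) M"
      by (simp add: vec_eq_iff)
    ultimately have "M \<in> GE"
      using \<epsilon> El_subset_GE GE_mult by (metis subsetD)
    then have "map_matrix \<sigma>' M \<in> GE" by (rule map_matrix_GE[OF \<sigma>(2)])
    then show ?thesis by (simp add: M_def map_matrix_block \<sigma>)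
  qed
  show ?thesis
  proof (cases "f = 0")
    case False
    then show ?thesis using main assms by blast
  next
    case True
    let ?M = "block i j f g q p :: 'k poly poly ^ 'n ^ 'n"
    have e: "elementary_matrix j i 1 \<in> El UNIV (UNIV :: 'k poly poly set)"
      using assms(2) by (intro El_elementary) auto
    \<comment> \<open>If \<open>f = 0\<close>, the determinant forces \<open>g\<close> to be
      nonzero; adding the second column to the first puts \<open>g\<close> into the corner.\<close>
    have "mat 1 ** ?M ** elementary_matrix j i 1 = block i j (f + g * 1) g (q + p * 1) p"
      using assms(2) by (simp add: block_right_elementary)
    also have "\<dots> \<in> GE"
      using True assms(3) by (intro main) (auto simp: algebra_simps)
    finally show ?thesis by (rule GE_cancel[OF El.one e])
  qed
qed

theorem GL_poly_poly_eq_GE: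
  fixes M :: "'k::field poly poly ^ 'n::finite ^ 'n"
  assumes "CARD('n) \<ge> 3" "invertible M"
  shows "M \<in> GE"
proof -
  have rows: "reach J UNIV v (axis k 1)"
    if "3 \<le> card J" "k \<in> J" "\<And>l. l \<notin> J \<Longrightarrow> v $ l = 0" "unimodular UNIV v"
    for J k and v :: "'k poly poly ^ 'n"
    using that by (rule reach_unimodular_poly_poly)
  obtain P Q J where PQ: "P \<in> El UNIV UNIV" "Q \<in> El UNIV UNIV" "card J < 3"
      "supported_on J (P ** M ** Q)"
    by (rule reduce_support[OF rows assms(2) one_le_numeral])
  define N where "N = P ** M ** Q"
  have "invertible N"
    unfolding N_def using PQ(1,2) assms(2) by (intro invertible_mult) (auto intro: invertible_El)
  obtain i j where ij: "i \<noteq> j" "J \<subseteq> {i, j}"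
  proof -
    \<comment> \<open>\<open>J\<close> may have fewer than two elements and is enlarged to a
      pair.\<close>
    obtain J' where "J \<subseteq> J'" "card J' = 2"
      using PQ(3) assms(1) exists_subset_between[of J 2 UNIV] by auto
    then show ?thesis using that by (auto simp: card_2_iff)
  qed
  define a b c d where abcd: "a = N $ i $ i" "b = N $ i $ j" "c = N $ j $ i" "d = N $ j $ j"
  have "N $ k $ l = (if k = l then 1 else 0)" if "k \<notin> {i, j} \<or> l \<notin> {i, j}" for k l
    using PQ(4) ij(2) that unfolding N_def[symmetric] supported_on_def by blast
  then have "N $ k $ l = block i j a b c d $ k $ l" for k l
    using ij(1) by (cases "k = i"; cases "k = j"; cases "l = i"; cases "l = j") (simp_all add: block_def abcd)
  then have N: "N = block i j a b c d"
    unfolding vec_eq_iff by blast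
  obtain L where "N ** L = mat 1" using \<open>invertible N\<close> by (auto simp: invertible_def)
  then have "(block i j a b c d ** L) $ k $ l = (if k = l then 1 else 0)" for k l
    unfolding N by (simp add: mat_def)
  note this[of i i] this[of i j] this[of j i] this[of j j]
  then have "a * L $ i $ i + b * L $ j $ i = 1" "a * L $ i $ j + b * L $ j $ j = 0"
    "c * L $ i $ i + d * L $ j $ i = 0" "c * L $ i $ j + d * L $ j $ j = 1"
    using ij by (simp_all add: block_mult_nth)
  then have det: "(a * d - b * c) * (L $ i $ i * L $ j $ j - L $ i $ j * L $ j $ i) = 1" (is "?u * ?w = 1")
    by algebra
  \<comment> \<open>The block has the unit \<open>?u\<close> as determinant, with inverse
    \<open>?w\<close> coming from the corner of \<open>L\<close>. Splitting \<open>?u\<close> off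
    row \<open>j\<close> leaves a block of determinant one.\<close>
  define D :: "'k poly poly \<Rightarrow> 'k poly poly ^ 'n ^ 'n"
    where "D = (\<lambda>u. \<chi> k l. if k = l then (if k = j then u else 1) else 0)"
  have D: "(D u ** B) $ k $ l = (if k = j then u * B $ k $ l else B $ k $ l)" for u B k l
  proof -
    have "(D u ** B) $ k $ l = (\<Sum>m\<in>UNIV. if m = k then (if k = j then u * B $ k $ l else B $ k $ l) else 0)"
      unfolding matrix_matrix_mult_def vec_lambda_beta by (intro sum.cong) (auto simp: D_def)
    then show ?thesis by simp
  qed
  have "D ?u ** D ?w = mat 1" "D ?w ** D ?u = mat 1"
    using det by (auto simp: vec_eq_iff D) (auto simp: D_def mat_def mult.commute)
  then have "D ?u \<in> GE"
    by (intro diagonal_in_GE) (auto simp: invertible_def diagonal_matrices_def D_def)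
  moreover have "block i j a b (?w * c) (?w * d) \<in> GE"
    using det assms(1) ij by (intro block_in_GE) (auto simp: algebra_simps)
  moreover have "N = D ?u ** block i j a b (?w * c) (?w * d)"
  proof -
    have "?u * (?w * x) = x" for x using det by (simp flip: mult.assoc)
    then show ?thesis
      unfolding N by (simp add: vec_eq_iff D) (auto simp: block_def)
  qed
  ultimately have "N \<in> GE" using GE_mult by metis
  then show ?thesis unfolding N_def by (rule GE_cancel[OF PQ(1,2)])
qed

section \<open>Homomorphisms of monoid algebras\<close>

lemma const_0 [simp]: "const 0 = 0"
  by (simp add: const_def)

lemma const_1 [simp]: "const 1 = 1"
  by (simp add: const_def)

lemma const_add: "const (a + b) = const a + const b"
  by (simp add: const_def single_add)

lemma const_mult: "const (a * b) = const a * const b"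
  by (simp add: const_def mult_single)

lemma const_mult_single: "const c * Poly_Mapping.single m d = Poly_Mapping.single m (c * d)"
  by (simp add: const_def mult_single)

lemma single_mult_const: "Poly_Mapping.single m d * const c = Poly_Mapping.single m (c * d)"
  by (simp add: const_def mult_single mult.commute)

lemma monoid_algebra_induct [case_names zero single add]:
  fixes p :: "'a \<Rightarrow>\<^sub>0 'b::comm_monoid_add"
  assumes "P 0" "\<And>m c. P (Poly_Mapping.single m c)" "\<And>p q. P p \<Longrightarrow> P q \<Longrightarrow> P (p + q)"
  shows "P p"
proof -
  have "P (\<Sum>m\<in>A. Poly_Mapping.single m (Poly_Mapping.lookup p m))" for A
    by (induction A rule: infinite_finite_induct) (simp_all add: assms)
  from this[of "Poly_Mapping.keys p"] show ?thesis
    by (simp flip: free_algebra_sum_singles)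
qed

lemma const_commute: "const c * p = p * const c"
  by (induction p rule: monoid_algebra_induct)
    (simp_all add: const_mult_single single_mult_const distrib_left distrib_right)

lemma alg_homD:
  assumes "alg_hom \<phi>"
  shows "\<phi> (p + q) = \<phi> p + \<phi> q" "\<phi> (p * q) = \<phi> p * \<phi> q" "\<phi> (const c) = const c"
    "\<phi> 0 = 0" "\<phi> 1 = 1" "\<phi> (sum f A) = (\<Sum>x\<in>A. \<phi> (f x))"
proof -
  show add: "\<phi> (p + q) = \<phi> p + \<phi> q" for p q using assms by (auto simp: alg_hom_def)
  show "\<phi> (p * q) = \<phi> p * \<phi> q" using assms by (auto simp: alg_hom_def)
  show c: "\<phi> (const c) = const c" for c using assms by (auto simp: alg_hom_def)
  show z: "\<phi> 0 = 0" using c[of 0] by simp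
  show "\<phi> 1 = 1" using c[of 1] by simp
  show "\<phi> (sum f A) = (\<Sum>x\<in>A. \<phi> (f x))"
    by (induction A rule: infinite_finite_induct) (simp_all add: z add)
qed

lemma alg_hom_id: "alg_hom id"
  by (simp add: alg_hom_def)

lemma alg_hom_comp: "alg_hom \<phi> \<Longrightarrow> alg_hom \<psi> \<Longrightarrow> alg_hom (\<phi> \<circ> \<psi>)"
  by (simp add: alg_hom_def)

lemma alg_hom_eqI:
  assumes "alg_hom \<phi>" "alg_hom \<psi>" "\<And>m. \<phi> (Poly_Mapping.single m 1) = \<psi> (Poly_Mapping.single m 1)"
  shows "\<phi> = \<psi>"
proof
  fix p
  show "\<phi> p = \<psi> p"
  proof (induction p rule: monoid_algebra_induct)
    case (single m c)
    have "Poly_Mapping.single m c = const c * Poly_Mapping.single m 1"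
      by (simp add: const_mult_single)
    then show ?case using assms(3) by (simp only: alg_homD[OF assms(1)] alg_homD[OF assms(2)])
  qed (simp_all add: alg_homD[OF assms(1)] alg_homD[OF assms(2)])
qed

lemma single_Word_Cons: "Poly_Mapping.single (Word (v # vs)) 1 = fvar v * Poly_Mapping.single (Word vs) 1"
  by (simp add: fvar_def mult_single plus_free_monoid_def)

lemma single_Word_Nil: "Poly_Mapping.single (Word []) 1 = 1"
  by (simp flip: single_one add: zero_free_monoid_def)

lemma free_alg_hom_eqI:
  assumes "alg_hom \<phi>" "alg_hom \<psi>" "\<And>v. \<phi> (fvar v) = \<psi> (fvar v)"
  shows "\<phi> = \<psi>"
proof (rule alg_hom_eqI[OF assms(1,2)])
  fix w :: "'a free_monoid"
  have "\<phi> (Poly_Mapping.single (Word vs) 1) = \<psi> (Poly_Mapping.single (Word vs) 1)" for vs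
    using assms(3)
    by (induction vs)
      (simp_all only: single_Word_Cons single_Word_Nil alg_homD[OF assms(1)] alg_homD[OF assms(2)])
  then show "\<phi> (Poly_Mapping.single w 1) = \<psi> (Poly_Mapping.single w 1)" by (cases w) simp
qed

lemma abelianization_surj: "surj abelianization"
proof -
  have exp: "\<exists>w. m = (\<Sum>v\<leftarrow>letters w. Poly_Mapping.single v 1)" for m :: "'a \<Rightarrow>\<^sub>0 nat"
  proof (induction m rule: monoid_algebra_induct)
    case zero
    show ?case by (intro exI[of _ "Word []"]) simp
  next
    case (single v n)
    show ?case
    proof (intro exI[of _ "Word (replicate n v)"])
      show "Poly_Mapping.single v n = (\<Sum>v\<leftarrow>letters (Word (replicate n v)). Poly_Mapping.single v 1)"
      proof (induction n)
        case (Suc n)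
        then show ?case using single_add[of v "Suc 0" n] by simp
      qed simp
    qed
  next
    case (add p q)
    then obtain u w where "p = (\<Sum>v\<leftarrow>letters u. Poly_Mapping.single v 1)"
      "q = (\<Sum>v\<leftarrow>letters w. Poly_Mapping.single v 1)" by blast
    then show ?case by (intro exI[of _ "Word (letters u @ letters w)"]) simp
  qed
  have "\<exists>q. p = abelianization q" for p :: "('a, 'b) poly_algebra"
  proof (induction p rule: monoid_algebra_induct)
    case zero
    show ?case by (intro exI[of _ 0]) (simp add: abelianization_zero)
  next
    case (single m c)
    show ?case using exp[of m] abelianization_single by metis
  next
    case (add p q)
    then show ?case by (metis abelianization_add)
  qed
  then show ?thesis by (simp add: surj_def)
qed

text \<open>Composed with the surjection \<open>abelianization\<close>, both maps become
  homomorphisms on the free algebra, where the variables determine them.\<close>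

lemma poly_alg_hom_eqI:
  fixes \<phi> \<psi> :: "('v, 'k::field) poly_algebra \<Rightarrow> ('b::monoid_add \<Rightarrow>\<^sub>0 'k)"
  assumes "alg_hom \<phi>" "alg_hom \<psi>" "\<And>v. \<phi> (pvar v) = \<psi> (pvar v)"
  shows "\<phi> = \<psi>"
proof
  fix p :: "('v, 'k) poly_algebra"
  have "\<phi> \<circ> abelianization = \<psi> \<circ> abelianization"
    using assms
    by (intro free_alg_hom_eqI alg_hom_comp alg_hom_abelianization) (simp_all add: abelianization_fvar)
  moreover obtain q where "p = abelianization q" using abelianization_surj by (metis surjD)
  ultimately show "\<phi> p = \<psi> p" by (metis comp_apply)
qed

text \<open>The embedding \<open>C\<close> of the scalars is a parameter because the target is not
  always a monoid algebra: \<open>eval_z\<close> takes values in \<open>K[z]\<close>, and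
  \<open>fox_derivative\<close> in \<open>K[z\<^sub>1, z\<^sub>2]\<close>.\<close>

definition linear_extension ::
    "('k \<Rightarrow> 'r::semiring_0) \<Rightarrow> ('m \<Rightarrow> 'r) \<Rightarrow> ('m \<Rightarrow>\<^sub>0 'k::zero) \<Rightarrow> 'r"
  where "linear_extension C h p = (\<Sum>m\<in>Poly_Mapping.keys p. C (Poly_Mapping.lookup p m) * h m)"

lemma linear_extension_superset:
  assumes "C 0 = 0" "finite A" "Poly_Mapping.keys p \<subseteq> A"
  shows "linear_extension C h p = (\<Sum>m\<in>A. C (Poly_Mapping.lookup p m) * h m)"
  unfolding linear_extension_def
  by (rule sum.mono_neutral_left) (use assms in \<open>auto simp: in_keys_iff\<close>)

lemma linear_extension_simps:
  assumes "C 0 = 0" "\<And>a b. C (a + b) = C a + C b"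
  shows "linear_extension C h 0 = 0"
    "linear_extension C h (p + q) = linear_extension C h p + linear_extension C h q"
    "linear_extension C h (Poly_Mapping.single m c) = C c * h m"
proof -
  show "linear_extension C h 0 = 0" by (simp add: linear_extension_def)
  show "linear_extension C h (p + q) = linear_extension C h p + linear_extension C h q"
    using keys_add[of p q]
    by (simp add: linear_extension_superset[of C "Poly_Mapping.keys p \<union> Poly_Mapping.keys q"]
        assms lookup_add distrib_right sum.distrib)
  show "linear_extension C h (Poly_Mapping.single m c) = C c * h m"
    by (subst linear_extension_superset[of C "{m}"]) (auto simp: assms)
qed

lemma alg_hom_linear_extension:
  assumes "h 0 = 1" "\<And>u v. h (u + v) = h u * h v"
  shows "alg_hom (linear_extension const h)"
proof -
  note e = linear_extension_simps[of const, OF const_0 const_add]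
  have "linear_extension const h (p * q) = linear_extension const h p * linear_extension const h q" for p q
  proof (induction p rule: monoid_algebra_induct)
    case (single m c)
    show ?case
    proof (induction q rule: monoid_algebra_induct)
      case (single n d)
      have "const c * const d * (h m * h n) = const c * (const d * h m) * h n"
        by (simp only: mult.assoc)
      also have "const d * h m = h m * const d" by (rule const_commute)
      finally show ?case
        by (simp add: mult_single e assms const_mult mult.assoc)
    qed (simp_all add: e distrib_left)
  qed (simp_all add: e distrib_right)
  then show ?thesis
    unfolding alg_hom_def using e(3)[of h 0] assms(1) by (simp add: e(2)) (simp add: const_def)
qed

definition free_subst :: "('v \<Rightarrow> ('b::monoid_add \<Rightarrow>\<^sub>0 'k::field)) \<Rightarrow> ('v, 'k) free_algebra \<Rightarrow> ('b \<Rightarrow>\<^sub>0 'k)"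
  where "free_subst f = linear_extension const (\<lambda>w. prod_list (map f (letters w)))"

lemma alg_hom_free_subst: "alg_hom (free_subst f)"
  unfolding free_subst_def
  by (rule alg_hom_linear_extension) (simp_all add: zero_free_monoid_def plus_free_monoid_def)

lemma free_subst_fvar: "free_subst f (fvar v) = f v"
  by (simp add: free_subst_def fvar_def linear_extension_simps const_add)

definition poly_subst :: "('v::finite \<Rightarrow> ('v, 'k::field) poly_algebra) \<Rightarrow> ('v, 'k) poly_algebra \<Rightarrow> ('v, 'k) poly_algebra"
  where "poly_subst f = linear_extension const (\<lambda>m. \<Prod>v\<in>UNIV. f v ^ Poly_Mapping.lookup m v)"

lemma alg_hom_poly_subst: "alg_hom (poly_subst f)"
  unfolding poly_subst_def
  by (rule alg_hom_linear_extension) (simp_all add: lookup_add power_add prod.distrib)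

lemma poly_subst_pvar: "poly_subst f (pvar v) = f v"
proof -
  have "(\<Prod>u\<in>UNIV. f u ^ Poly_Mapping.lookup (Poly_Mapping.single v 1) u) =
    (\<Prod>u\<in>UNIV. if u = v then f u else 1)"
    by (intro prod.cong) (auto simp: lookup_single when_def)
  also have "\<dots> = f v" by simp
  finally show ?thesis
    by (simp add: poly_subst_def pvar_def linear_extension_simps const_add)
qed

lemma alg_automorphismI:
  assumes "alg_hom \<phi>" "\<phi> \<circ> \<psi> = id" "\<psi> \<circ> \<phi> = id"
  shows "alg_automorphism \<phi>"
  using assms o_bij by (auto simp: alg_automorphism_def)

section \<open>The bimodule structure\<close>

lemma at_z_bound:
  assumes "degree p \<le> n"
  shows "at_z p = (\<Sum>k\<le>n. const (coeff p k) * fvar Z ^ k)"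
  unfolding at_z_def using assms
  by (intro sum.mono_neutral_left) (auto simp: coeff_eq_0)

lemma at_z_0 [simp]: "at_z 0 = 0"
  by (simp add: at_z_def)

lemma at_z_pCons: "at_z (pCons a p) = const a + at_z p * fvar Z"
proof -
  have "at_z (pCons a p) = (\<Sum>k\<le>Suc (degree p). const (coeff (pCons a p) k) * fvar Z ^ k)"
    by (rule at_z_bound) (simp add: degree_pCons_le)
  also have "\<dots> = const a + (\<Sum>k\<le>degree p. const (coeff p k) * fvar Z ^ Suc k)"
    by (simp only: sum.atMost_Suc_shift) simp
  finally show ?thesis
    by (simp add: at_z_def sum_distrib_right mult.assoc power_commutes)
qed

lemma at_z_add: "at_z (p + q) = at_z p + at_z q"
  using degree_add_le_max[of p q]
  by (simp add: at_z_bound[of _ "max (degree p) (degree q)"] const_add distrib_right sum.distrib)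

lemma at_z_smult: "at_z (smult a p) = const a * at_z p"
  by (simp add: at_z_bound[of "smult a p" "degree p"] at_z_def const_mult sum_distrib_left mult.assoc)

lemma at_z_commute: "fvar Z * at_z p = at_z p * fvar Z"
  by (induction p) (simp_all add: at_z_pCons distrib_left distrib_right const_commute flip: mult.assoc)

lemma at_z_mult: "at_z (p * q) = (at_z p * at_z q :: ('n gvar, 'k::field) free_algebra)"
proof (induction p)
  case (pCons a p)
  have "at_z (pCons a p * q) = (const a * at_z q + at_z p * (at_z q * fvar Z) :: ('n gvar, 'k) free_algebra)"
    using pCons by (simp add: at_z_add at_z_smult at_z_pCons mult.assoc)
  then show ?case by (simp add: at_z_pCons distrib_right mult.assoc at_z_commute)
qed simp

lemma at_z_1 [simp]: "at_z 1 = 1"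
  by (simp add: one_pCons at_z_pCons)

lemma alg_hom_at_z:
  assumes "alg_hom \<phi>" "\<phi> (fvar Z) = fvar Z"
  shows "\<phi> (at_z p) = at_z p"
  by (induction p) (simp_all add: at_z_pCons alg_homD[OF assms(1)] assms(2))

text \<open>The action of \<open>K[z\<^sub>1, z\<^sub>2]\<close> on the free algebra where \<open>z\<^sub>1\<close> and \<open>z\<^sub>2\<close> multiply by \<open>z\<close> from the left
  and from the right.\<close>

definition act :: "'k::field poly poly \<Rightarrow> ('n gvar, 'k) free_algebra \<Rightarrow> ('n gvar, 'k) free_algebra"
  where "act p w = (\<Sum>l\<le>degree p. at_z (coeff p l) * w * fvar Z ^ l)"

lemma act_bound:
  assumes "degree p \<le> n"
  shows "act p w = (\<Sum>l\<le>n. at_z (coeff p l) * w * fvar Z ^ l)"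
  unfolding act_def using assms
  by (intro sum.mono_neutral_left) (auto simp: coeff_eq_0)

lemma act_0 [simp]: "act 0 w = 0"
  by (simp add: act_def)

lemma act_pCons: "act (pCons a p) w = at_z a * w + act p w * fvar Z"
proof -
  have "act (pCons a p) w = (\<Sum>l\<le>Suc (degree p). at_z (coeff (pCons a p) l) * w * fvar Z ^ l)"
    by (rule act_bound) (simp add: degree_pCons_le)
  also have "\<dots> = at_z a * w + (\<Sum>l\<le>degree p. at_z (coeff p l) * w * fvar Z ^ Suc l)"
    by (simp only: sum.atMost_Suc_shift) simp
  finally show ?thesis
    by (simp add: act_def sum_distrib_right mult.assoc power_commutes)
qed

lemma act_add_left: "act (p + q) w = act p w + act q w"
  using degree_add_le_max[of p q]
  by (simp add: act_bound[of _ "max (degree p) (degree q)"] at_z_add distrib_right sum.distrib)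

lemma act_sum_left: "act (sum f A) w = (\<Sum>x\<in>A. act (f x) w)"
  by (induction A rule: infinite_finite_induct) (simp_all add: act_add_left)

lemma act_add_right: "act p (v + w) = act p v + act p w"
  by (simp add: act_def distrib_left distrib_right sum.distrib)

lemma act_zero_right [simp]: "act p 0 = 0"
  by (simp add: act_def)

lemma act_sum_right: "act p (sum f A) = (\<Sum>x\<in>A. act p (f x))"
  by (induction A rule: infinite_finite_induct) (simp_all add: act_add_right)

lemma act_smult: "act (smult a p) w = at_z a * act p w"
  by (simp add: act_bound[of "smult a p" "degree p"] act_def at_z_mult sum_distrib_left mult.assoc)

lemma act_mult: "act (p * q) w = act p (act q w)"
  by (induction p) (simp_all add: act_pCons act_add_left act_smult)

lemma act_1 [simp]: "act 1 w = w"
  by (simp add: one_pCons act_pCons at_z_pCons)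

lemma act_at_z1: "act (at_z1 b) w = at_z b * w"
  by (simp add: at_z1_def act_pCons)

lemma at_z2_pCons: "at_z2 (pCons a c) = pCons [:a:] (at_z2 c)"
  by (simp add: at_z2_def map_poly_pCons)

lemma act_at_z2: "act (at_z2 c) w = w * at_z c"
proof (induction c)
  case (pCons a c)
  then show ?case
    by (simp add: at_z2_pCons act_pCons at_z_pCons const_commute distrib_left mult.assoc)
qed (simp add: at_z2_def)

lemma alg_hom_act:
  assumes "alg_hom \<phi>" "\<phi> (fvar Z) = fvar Z"
  shows "\<phi> (act p w) = act p (\<phi> w)"
  by (induction p) (simp_all add: act_pCons alg_homD[OF assms(1)] alg_hom_at_z[OF assms] assms(2))

text \<open>Replaces the lists of \<open>represents\<close> by the matrix that they determine, so
  that composition becomes a matrix product. Column \<open>j\<close> holds the coefficients of the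
  image of \<open>X j\<close>.\<close>

definition linear_with :: "'k::field poly poly ^ 'n::finite ^ 'n \<Rightarrow>
    (('n gvar, 'k) free_algebra \<Rightarrow> ('n gvar, 'k) free_algebra) \<Rightarrow> bool"
  where "linear_with M \<phi> \<longleftrightarrow> (\<forall>j. \<phi> (fvar (X j)) = (\<Sum>i\<in>UNIV. act (M $ i $ j) (fvar (X i))))"

lemma represents_linear_with:
  assumes "represents B \<phi>"
  shows "linear_with (jacobian_of B) \<phi>"
proof -
  have "act (\<Sum>(b, c)\<leftarrow>xs. at_z1 b * at_z2 c) w = (\<Sum>(b, c)\<leftarrow>xs. at_z b * w * at_z c)" for xs and w :: "('a gvar, 'b) free_algebra"
    by (induction xs) (auto simp: act_add_left act_mult act_at_z1 act_at_z2 mult.assoc)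
  with assms show ?thesis
    by (simp add: linear_with_def represents_def jacobian_of_def)
qed

text \<open>\<open>\<phi>\<close> fixes \<open>z\<close> and therefore commutes with the action of
  the entries of \<open>N\<close>; with images in the columns, the matrices multiply in the order of
  the maps.\<close>

lemma linear_with_comp:
  assumes "linear_with M \<phi>" "linear_with N \<psi>" "alg_hom \<phi>" "\<phi> (fvar Z) = fvar Z"
  shows "linear_with (M ** N) (\<phi> \<circ> \<psi>)"
  unfolding linear_with_def
proof
  fix j
  have "(\<phi> \<circ> \<psi>) (fvar (X j)) =
      (\<Sum>i\<in>UNIV. act (N $ i $ j) (\<Sum>k\<in>UNIV. act (M $ k $ i) (fvar (X k))))"
    using assms(1,2)
    by (simp add: linear_with_def alg_homD[OF assms(3)] alg_hom_act[OF assms(3,4)])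
  also have "\<dots> = (\<Sum>k\<in>UNIV. \<Sum>i\<in>UNIV. act (N $ i $ j) (act (M $ k $ i) (fvar (X k))))"
    by (simp only: act_sum_right) (rule sum.swap)
  also have "\<dots> = (\<Sum>k\<in>UNIV. act ((M ** N) $ k $ j) (fvar (X k)))"
    by (simp add: matrix_matrix_mult_def act_sum_left mult.commute flip: act_mult)
  finally show "(\<phi> \<circ> \<psi>) (fvar (X j)) = (\<Sum>k\<in>UNIV. act ((M ** N) $ k $ j) (fvar (X k)))" .
qed

lemma linear_with_unique:
  assumes "linear_with M \<phi>" "linear_with M \<psi>" "Kz_automorphism \<phi>" "Kz_automorphism \<psi>"
  shows "\<phi> = \<psi>"
proof (rule free_alg_hom_eqI)
  show "\<phi> (fvar v) = \<psi> (fvar v)" for v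
    using assms by (cases v) (simp_all add: linear_with_def Kz_automorphism_def)
qed (use assms in \<open>simp_all add: Kz_automorphism_def alg_automorphism_def\<close>)

section \<open>Automorphisms with Jacobian matrix in \<open>GE\<close> are tame\<close>

lemma Kz_aut_group_simps [simp]:
  "\<phi> \<otimes>\<^bsub>Kz_aut_group\<^esub> \<psi> = \<phi> \<circ> \<psi>" "\<one>\<^bsub>Kz_aut_group\<^esub> = id" "\<phi> \<in> carrier Kz_aut_group \<longleftrightarrow> Kz_automorphism \<phi>"
  by (simp_all add: Kz_aut_group_def)

lemma elementary_linear_Kz_automorphism:
  assumes "\<phi> \<in> elementary_linear_Kz_automorphisms"
  shows "Kz_automorphism \<phi>"
proof -
  have "diagonal_Kz_automorphisms \<union> transvection_Kz_automorphisms \<subseteq> carrier Kz_aut_group"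
    by (auto simp: diagonal_Kz_automorphisms_def transvection_Kz_automorphisms_def)
  from group.generate_in_carrier[OF group_Kz_aut_group this]
  show ?thesis using assms by (simp add: elementary_linear_Kz_automorphisms_def)
qed

lemma tame_Kz_automorphism:
  assumes "\<phi> \<in> tame_Kz_automorphisms"
  shows "Kz_automorphism \<phi>"
proof -
  have "elementary_linear_Kz_automorphisms \<union> triangular_Kz_automorphisms \<subseteq> carrier Kz_aut_group"
    by (auto simp: triangular_Kz_automorphisms_def elementary_linear_Kz_automorphism)
  from group.generate_in_carrier[OF group_Kz_aut_group this]
  show ?thesis using assms by (simp add: tame_Kz_automorphisms_def)
qed

lemma tame_comp:
  "\<phi> \<in> tame_Kz_automorphisms \<Longrightarrow> \<psi> \<in> tame_Kz_automorphisms \<Longrightarrow> \<phi> \<circ> \<psi> \<in> tame_Kz_automorphisms"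
  unfolding tame_Kz_automorphisms_def by (metis Kz_aut_group_simps(1) generate.eng)

lemma tame_generators:
  assumes "\<phi> \<in> diagonal_Kz_automorphisms \<union> transvection_Kz_automorphisms"
  shows "\<phi> \<in> tame_Kz_automorphisms"
  unfolding tame_Kz_automorphisms_def elementary_linear_Kz_automorphisms_def
  using assms by (intro generate.incl) (auto intro: generate.incl)

lemma Kz_automorphism_subst:
  assumes "f Z = fvar Z" "g Z = fvar Z" "\<And>v. free_subst f (g v) = fvar v" "\<And>v. free_subst g (f v) = fvar v"
  shows "Kz_automorphism (free_subst f)"
proof -
  have "free_subst f \<circ> free_subst g = id" "free_subst g \<circ> free_subst f = id"
    using assms
    by (intro free_alg_hom_eqI alg_hom_comp alg_hom_free_subst alg_hom_id; simp add: free_subst_fvar)+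
  then have "alg_automorphism (free_subst f)"
    by (intro alg_automorphismI alg_hom_free_subst)
  then show ?thesis using assms(1) by (simp add: Kz_automorphism_def free_subst_fvar)
qed

lemma exists_transvection:
  fixes i j :: "'n::{finite,linorder}"
  assumes "i \<noteq> j"
  shows "\<exists>\<phi>\<in>tame_Kz_automorphisms. linear_with (elementary_matrix i j (at_z1 a * at_z2 b)) \<phi>"
proof -
  define f :: "'a poly \<Rightarrow> 'n gvar \<Rightarrow> ('n gvar, 'a) free_algebra"
    where "f = (\<lambda>a v. fvar v + (if v = X j then at_z a * fvar (X i) * at_z b else 0))"
  have fZ: "f a Z = fvar Z" and fX: "f a (X l) = fvar (X l) + (if l = j then at_z a * fvar (X i) * at_z b else 0)" for a l
    by (simp_all add: f_def)
  have s: "free_subst (f a) (at_z p) = at_z p" for a p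
    by (rule alg_hom_at_z[OF alg_hom_free_subst]) (simp add: free_subst_fvar fZ)
  have inv: "free_subst (f a) (f (- a) v) = fvar v" for a v
  proof -
    have "free_subst (f a) (f (- a) (X l)) = fvar (X l)" for l
    proof -
      have "at_z a * fvar (X i) * at_z b + at_z (- a) * fvar (X i) * at_z b = at_z (a + - a) * fvar (X i) * at_z b"
        by (simp only: at_z_add distrib_right)
      then have "at_z a * fvar (X i) * at_z b + at_z (- a) * fvar (X i) * at_z b = 0" by simp
      then show ?thesis
        using assms by (simp add: fX alg_homD[OF alg_hom_free_subst] free_subst_fvar s add.assoc)
    qed
    then show ?thesis by (cases v) (simp_all add: fZ free_subst_fvar)
  qed
  let ?\<phi> = "free_subst (f a)"
  have "Kz_automorphism ?\<phi>"
    using inv[of a] inv[of "- a"] by (intro Kz_automorphism_subst[of _ "f (- a)"]) (simp_all add: fZ)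
  then have "?\<phi> \<in> transvection_Kz_automorphisms"
    unfolding transvection_Kz_automorphisms_def using assms
    by (intro CollectI conjI exI[of _ i] exI[of _ j] exI[of _ a] exI[of _ b])
      (simp_all add: free_subst_fvar fX)
  moreover have "linear_with (elementary_matrix i j (at_z1 a * at_z2 b)) ?\<phi>"
    unfolding linear_with_def
  proof
    fix l
    have "(\<Sum>k\<in>UNIV. act (elementary_matrix i j (at_z1 a * at_z2 b) $ k $ l) (fvar (X k))) =
      (\<Sum>k\<in>UNIV. (if k = l then fvar (X k) else 0) +
        (if k = i then (if l = j then act (at_z1 a * at_z2 b) (fvar (X k)) else 0) else 0))"
      by (intro sum.cong) (auto simp: elementary_matrix_nth act_add_left)
    then show "?\<phi> (fvar (X l)) = (\<Sum>k\<in>UNIV. act (elementary_matrix i j (at_z1 a * at_z2 b) $ k $ l) (fvar (X k)))"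
      by (simp add: sum.distrib free_subst_fvar fX act_mult act_at_z1 act_at_z2 mult.assoc)
  qed
  ultimately show ?thesis using tame_generators by blast
qed

lemma id_tame: "id \<in> tame_Kz_automorphisms"
  unfolding tame_Kz_automorphisms_def using generate.one[of Kz_aut_group] by simp

lemma linear_with_id: "linear_with (mat 1 :: 'k::field poly poly ^ 'n::finite ^ 'n) id"
proof -
  have "act (mat 1 $ i $ j) w = (if i = j then w else 0)"
    for i j :: 'n and w :: "('n gvar, 'k) free_algebra"
    by (simp add: mat_def)
  then show ?thesis by (simp add: linear_with_def)
qed

text \<open>A transvection only produces an entry of the form
  \<open>b(z\<^sub>1) c(z\<^sub>2)\<close>. An arbitrary \<open>r\<close> is a sum of such products,
  one for each power of \<open>z\<^sub>2\<close>, and elementary matrices at the same position add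
  up.\<close>

lemma exists_elementary:
  fixes i j :: "'n::{finite,linorder}"
  assumes "i \<noteq> j"
  shows "\<exists>\<phi>\<in>tame_Kz_automorphisms. linear_with (elementary_matrix i j r) \<phi>"
proof -
  have "\<exists>\<phi>\<in>tame_Kz_automorphisms. linear_with (elementary_matrix i j (\<Sum>l\<in>A. monom (coeff r l) l)) \<phi>" for A
  proof (induction A rule: infinite_finite_induct)
    case (insert l A)
    have "monom (coeff r l) l = at_z1 (coeff r l) * at_z2 (monom 1 l)"
      by (simp add: at_z1_def at_z2_def map_poly_monom smult_monom flip: one_pCons)
    then obtain \<phi> \<psi> where *: "\<phi> \<in> tame_Kz_automorphisms" "\<psi> \<in> tame_Kz_automorphisms"
      "linear_with (elementary_matrix i j (monom (coeff r l) l)) \<phi>"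
      "linear_with (elementary_matrix i j (\<Sum>l\<in>A. monom (coeff r l) l)) \<psi>"
      using insert.IH exists_transvection[OF assms, of "coeff r l" "monom 1 l"] by auto
    have "linear_with (elementary_matrix i j (\<Sum>l\<in>insert l A. monom (coeff r l) l)) (\<phi> \<circ> \<psi>)"
      using linear_with_comp[OF *(3,4)] tame_Kz_automorphism[OF *(1)] insert.hyps assms
      by (simp add: Kz_automorphism_def alg_automorphism_def elementary_matrix_add)
    then show ?case using * tame_comp by blast
  qed (use id_tame linear_with_id in auto)
  from this[of "{..degree r}"] show ?thesis by (simp add: poly_as_sum_of_monoms)
qed

text \<open>The diagonal entries are units of \<open>K[z\<^sub>1, z\<^sub>2]\<close>, that is,
  nonzero constants, just as a diagonal automorphism requires.\<close>

lemma exists_diagonal: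
  fixes D :: "'k::field poly poly ^ 'n::{finite,linorder} ^ 'n::{finite,linorder}"
  assumes "D \<in> diagonal_matrices" "invertible D"
  shows "\<exists>\<phi>\<in>tame_Kz_automorphisms. linear_with D \<phi>"
proof -
  obtain E where E: "E \<in> diagonal_matrices" "D ** E = mat 1"
    using diagonal_inverse[OF assms] by metis
  have "\<exists>c. c \<noteq> 0 \<and> D $ j $ j = [:[:c:]:]" for j
  proof -
    have "(D ** E) $ j $ j = D $ j $ j * E $ j $ j"
      unfolding matrix_matrix_mult_def using assms(1)
      by (simp, subst sum.remove[of _ j]) (auto simp: diagonal_matrices_def intro!: sum.neutral)
    then have "D $ j $ j * E $ j $ j = 1" using E(2) by (simp add: mat_def)
    then have "D $ j $ j dvd 1" by (metis dvd_triv_left)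
    then show ?thesis by (auto simp: is_unit_poly_iff)
  qed
  then obtain c where c: "\<And>j. c j \<noteq> 0" "\<And>j. D $ j $ j = [:[:c j:]:]" by metis
  define f :: "('n \<Rightarrow> 'k) \<Rightarrow> 'n gvar \<Rightarrow> ('n gvar, 'k) free_algebra"
    where "f = (\<lambda>c v. case v of X j \<Rightarrow> const (c j) * fvar (X j) | Z \<Rightarrow> fvar Z)"
  have f: "f c Z = fvar Z" "f c (X j) = const (c j) * fvar (X j)" for c j
    by (simp_all add: f_def)
  have inv: "free_subst (f c) (f d v) = fvar v" if "\<And>j. d j * c j = 1" for c d v
    using that by (cases v) (simp_all add: f alg_homD[OF alg_hom_free_subst] free_subst_fvar flip: mult.assoc const_mult)
  let ?\<phi> = "free_subst (f c)"
  have "Kz_automorphism ?\<phi>"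
    using c by (intro Kz_automorphism_subst[of _ "f (\<lambda>j. inverse (c j))"] inv) (simp_all add: f)
  then have "?\<phi> \<in> diagonal_Kz_automorphisms"
    unfolding diagonal_Kz_automorphisms_def using c(1)
    by (auto simp: free_subst_fvar f intro!: exI[of _ c])
  moreover have "linear_with D ?\<phi>"
    unfolding linear_with_def
  proof
    fix j
    have "(\<Sum>i\<in>UNIV. act (D $ i $ j) (fvar (X i))) = act (D $ j $ j) (fvar (X j))"
      using assms(1) by (subst sum.remove[of _ j]) (auto simp: diagonal_matrices_def intro!: sum.neutral)
    then show "?\<phi> (fvar (X j)) = (\<Sum>i\<in>UNIV. act (D $ i $ j) (fvar (X i)))"
      by (simp add: c(2) act_pCons at_z_pCons free_subst_fvar f)
  qed
  ultimately show ?thesis using tame_generators by blast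
qed

text \<open>A factorization of \<open>M\<close> yields some tame automorphism with the matrix
  \<open>M\<close>; it equals \<open>\<phi>\<close> because the matrix determines the images of all
  variables.\<close>

lemma GE_imp_tame:
  fixes \<phi> :: "('n::{finite,linorder} gvar, 'k::field) free_algebra \<Rightarrow> ('n gvar, 'k) free_algebra"
  assumes "Kz_automorphism \<phi>" "linear_with M \<phi>" "M \<in> GE"
  shows "\<phi> \<in> tame_Kz_automorphisms"
proof -
  from assms(3) have "\<exists>\<psi>\<in>tame_Kz_automorphisms. linear_with M \<psi>"
  proof (induction rule: GE_induct)
    case (elementary i j r)
    then show ?case by (rule exists_elementary)
  next
    case (diagonal D)
    then show ?case by (rule exists_diagonal)
  next
    case (mult A B)
    then obtain \<phi> \<psi> where *: "\<phi> \<in> tame_Kz_automorphisms" "\<psi> \<in> tame_Kz_automorphisms"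
      "linear_with A \<phi>" "linear_with B \<psi>" by blast
    then have "linear_with (A ** B) (\<phi> \<circ> \<psi>)"
      using tame_Kz_automorphism[OF *(1)]
      by (intro linear_with_comp) (simp_all add: Kz_automorphism_def alg_automorphism_def)
    then show ?case using * tame_comp by blast
  qed
  then obtain \<psi> where "\<psi> \<in> tame_Kz_automorphisms" "linear_with M \<psi>" by blast
  then show ?thesis using linear_with_unique assms tame_Kz_automorphism by metis
qed

section \<open>Fox derivatives at a point\<close>

definition point :: "('n \<Rightarrow> 'k::field poly) \<Rightarrow> 'n gvar \<Rightarrow> 'k poly"
  where "point a v = (case v of X j \<Rightarrow> a j | Z \<Rightarrow> [:0, 1:])"

definition eval_z :: "('n \<Rightarrow> 'k::field poly) \<Rightarrow> ('n gvar, 'k) free_algebra \<Rightarrow> 'k poly"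
  where "eval_z a = linear_extension (\<lambda>c. [:c:]) (\<lambda>w. prod_list (map (point a) (letters w)))"

text \<open>Unfolded, this is a sum over the occurrences of \<open>X i\<close> in the word: the
  value of the prefix in \<open>z\<^sub>1\<close> times the value of the suffix in
  \<open>z\<^sub>2\<close>.\<close>

fun word_derivative :: "('n \<Rightarrow> 'k::field poly) \<Rightarrow> 'n \<Rightarrow> 'n gvar list \<Rightarrow> 'k poly poly" where
  "word_derivative a i [] = 0"
| "word_derivative a i (v # vs) = at_z1 (point a v) * word_derivative a i vs +
    (if v = X i then at_z2 (prod_list (map (point a) vs)) else 0)"

text \<open>The coefficient of \<open>x\<^sub>i\<close> in the part linear in \<open>X\<close> of the expansion at the point
  \<open>x\<^sub>j = a\<^sub>j(z)\<close>; \<open>z\<close> becomes \<open>z\<^sub>1\<close> to the left of \<open>x\<^sub>i\<close> and \<open>z\<^sub>2\<close> to its right.\<close>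

definition fox_derivative :: "('n \<Rightarrow> 'k::field poly) \<Rightarrow> 'n \<Rightarrow> ('n gvar, 'k) free_algebra \<Rightarrow> 'k poly poly"
  where "fox_derivative a i = linear_extension (\<lambda>c. [:[:c:]:]) (\<lambda>w. word_derivative a i (letters w))"

lemma unital_ring_hom_at_z1: "unital_ring_hom at_z1"
  unfolding at_z1_def by (rule unital_ring_hom_const)

lemma unital_ring_hom_at_z2: "unital_ring_hom at_z2"
  unfolding at_z2_def by (intro unital_ring_hom_map_poly unital_ring_hom_const)

lemmas at_z1_simps = unital_ring_homD[OF unital_ring_hom_at_z1]
lemmas at_z2_simps = unital_ring_homD[OF unital_ring_hom_at_z2]

lemma at_z12_const: "at_z1 [:c:] = [:[:c:]:]" "at_z2 [:c:] = [:[:c:]:]" "at_z2 [:0, 1:] = [:0, 1:]"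
  by (simp_all add: at_z1_def at_z2_def map_poly_pCons flip: one_pCons)

lemma word_derivative_append:
  "word_derivative a i (u @ v) = at_z1 (prod_list (map (point a) u)) * word_derivative a i v +
    word_derivative a i u * at_z2 (prod_list (map (point a) v))"
  by (induction u) (simp_all add: at_z1_simps at_z2_simps algebra_simps)

lemma eval_z_linear:
  "eval_z a 0 = 0" "eval_z a (p + q) = eval_z a p + eval_z a q"
  "eval_z a (Poly_Mapping.single w c) = [:c:] * prod_list (map (point a) (letters w))"
  unfolding eval_z_def by (subst linear_extension_simps; simp)+

lemma fox_derivative_linear:
  "fox_derivative a i 0 = 0" "fox_derivative a i (p + q) = fox_derivative a i p + fox_derivative a i q"
  "fox_derivative a i (Poly_Mapping.single w c) = [:[:c:]:] * word_derivative a i (letters w)"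
  unfolding fox_derivative_def by (subst linear_extension_simps; simp)+

lemma eval_z_mult: "eval_z a (p * q) = eval_z a p * eval_z a q"
proof (induction p rule: monoid_algebra_induct)
  case (single m c)
  show ?case
    by (induction q rule: monoid_algebra_induct)
      (simp_all add: mult_single eval_z_linear plus_free_monoid_def distrib_left smult_add_right mult.assoc mult.commute)
qed (simp_all add: eval_z_linear distrib_right)

text \<open>The Leibniz rule for the bimodule \<open>K[z\<^sub>1, z\<^sub>2]\<close>, on which
  values act from the left through \<open>z\<^sub>1\<close> and from the right through
  \<open>z\<^sub>2\<close>.\<close>

lemma fox_derivative_mult:
  "fox_derivative a i (p * q) =
    at_z1 (eval_z a p) * fox_derivative a i q + fox_derivative a i p * at_z2 (eval_z a q)"
proof (induction p rule: monoid_algebra_induct)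
  case (single m c)
  show ?case
  proof (induction q rule: monoid_algebra_induct)
    case (single n d)
    have "[:[:c * d:]:] = [:[:c:]:] * [:[:d:]:]" by simp
    then show ?case
      unfolding mult_single eval_z_linear fox_derivative_linear plus_free_monoid_def
      by (simp only: free_monoid.sel word_derivative_append at_z1_simps at_z2_simps at_z12_const)
        (simp only: algebra_simps)
  qed (simp_all only: eval_z_linear fox_derivative_linear distrib_left distrib_right at_z2_simps
        mult_zero_right add_0 add_ac)
qed (simp_all only: eval_z_linear fox_derivative_linear distrib_right at_z1_simps mult_zero_left add_0 add_ac)

lemma eval_z_fvar: "eval_z a (fvar v) = point a v"
  by (simp add: fvar_def eval_z_linear)

lemma fox_derivative_fvar: "fox_derivative a i (fvar v) = (if v = X i then 1 else 0)"
  by (simp add: fvar_def fox_derivative_linear at_z2_simps flip: one_pCons)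

lemma eval_z_const: "eval_z a (const c) = [:c:]"
  by (simp add: const_def eval_z_linear zero_free_monoid_def)

lemma fox_derivative_const: "fox_derivative a i (const c) = 0"
  by (simp add: const_def fox_derivative_linear zero_free_monoid_def)

lemma eval_z_1: "eval_z a 1 = 1" and fox_derivative_1: "fox_derivative a i 1 = 0"
  using eval_z_const[of a 1] fox_derivative_const[of a i 1] by (simp_all add: one_pCons)

lemma eval_z_at_z: "eval_z a (at_z p) = p"
  by (induction p)
    (simp_all add: at_z_pCons eval_z_linear eval_z_mult eval_z_const eval_z_fvar point_def)

lemma fox_derivative_at_z: "fox_derivative a i (at_z p) = 0"
  by (induction p)
    (simp_all add: at_z_pCons fox_derivative_linear fox_derivative_mult fox_derivative_const fox_derivative_fvar)

text \<open>Polynomials in \<open>z\<close> have derivative 0, so multiplying by \<open>z\<close>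
  from either side only multiplies the derivative by \<open>z\<^sub>1\<close> or
  \<open>z\<^sub>2\<close>. Hence the Fox matrix of a linear automorphism is its Jacobian matrix at
  every point.\<close>

lemma fox_derivative_act: "fox_derivative a i (act p w) = p * fox_derivative a i w"
proof (induction p)
  case (pCons b p)
  then have "fox_derivative a i (act (pCons b p) w) =
      at_z1 b * fox_derivative a i w + p * fox_derivative a i w * [:0, 1:]"
    by (simp only: act_pCons fox_derivative_linear fox_derivative_mult eval_z_at_z fox_derivative_at_z
        eval_z_fvar point_def gvar.case fox_derivative_fvar at_z12_const gvar.distinct if_False
        mult_zero_left mult_zero_right add_0_left add_0_right)
  also have "\<dots> = (at_z1 b + p * [:0, 1:]) * fox_derivative a i w"
    by (simp only: distrib_right distrib_left mult_ac)
  also have "at_z1 b + p * [:0, 1:] = pCons b p" by (simp add: at_z1_def)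
  finally show ?case .
qed (simp add: fox_derivative_linear)

lemma fox_derivative_sum: "fox_derivative a i (sum f A) = (\<Sum>x\<in>A. fox_derivative a i (f x))"
  by (induction A rule: infinite_finite_induct) (simp_all add: fox_derivative_linear)

lemma eval_z_chain:
  assumes "alg_hom \<phi>" "\<phi> (fvar Z) = fvar Z"
  shows "eval_z a (\<phi> p) = eval_z (\<lambda>j. eval_z a (\<phi> (fvar (X j)))) p"
proof -
  note h = alg_homD[OF assms(1)]
  define a' where "a' = (\<lambda>j. eval_z a (\<phi> (fvar (X j))))"
  have v: "eval_z a (\<phi> (fvar v)) = point a' v" for v
    by (cases v) (simp_all add: point_def assms(2) eval_z_fvar a'_def)
  have w: "eval_z a (\<phi> (Poly_Mapping.single (Word vs) 1)) = prod_list (map (point a') vs)" for vs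
  proof (induction vs)
    case Nil
    show ?case by (simp add: single_Word_Nil h eval_z_1)
  next
    case (Cons u vs)
    then show ?case by (simp only: single_Word_Cons h eval_z_mult v list.map prod_list.Cons)
  qed
  have "eval_z a (\<phi> p) = eval_z a' p"
  proof (induction p rule: monoid_algebra_induct)
    case (single m c)
    have "Poly_Mapping.single m c = const c * Poly_Mapping.single (Word (letters m)) 1"
      by (simp add: const_mult_single)
    then show ?case by (simp only: h eval_z_mult eval_z_const w) (simp add: eval_z_linear)
  qed (simp_all add: h eval_z_linear)
  then show ?thesis by (simp only: a'_def)
qed

text \<open>Both sides satisfy the same Leibniz rule in \<open>p\<close>, with values taken after
  \<open>\<phi>\<close>, and agree on the variables. The derivatives of \<open>p\<close> are taken
  at the image of the point \<open>a\<close>.\<close>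

lemma fox_derivative_chain:
  fixes \<phi> :: "('n::finite gvar, 'k::field) free_algebra \<Rightarrow> ('n gvar, 'k) free_algebra"
  assumes "alg_hom \<phi>" "\<phi> (fvar Z) = fvar Z"
  shows "fox_derivative a i (\<phi> p) =
    (\<Sum>k\<in>UNIV. fox_derivative a i (\<phi> (fvar (X k))) *
      fox_derivative (\<lambda>j. eval_z a (\<phi> (fvar (X j)))) k p)"
proof -
  note h = alg_homD[OF assms(1)]
  define a' where "a' = (\<lambda>j. eval_z a (\<phi> (fvar (X j))))"
  define d where "d = (\<lambda>k. fox_derivative a i (\<phi> (fvar (X k))))"
  have ev: "eval_z a (\<phi> (Poly_Mapping.single (Word vs) 1)) = prod_list (map (point a') vs)" for vs
    using eval_z_chain[OF assms, of a "Poly_Mapping.single (Word vs) 1", folded a'_def]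
    by (simp add: eval_z_linear flip: one_pCons)
  have v: "fox_derivative a i (\<phi> (fvar v)) = (\<Sum>k\<in>UNIV. if v = X k then d k else 0)" for v
    by (cases v) (simp_all add: assms(2) fox_derivative_fvar d_def)
  have pv: "eval_z a (\<phi> (fvar v)) = point a' v" for v
    by (cases v) (simp_all add: point_def assms(2) eval_z_fvar a'_def)
  have w: "fox_derivative a i (\<phi> (Poly_Mapping.single (Word vs) 1)) =
      (\<Sum>k\<in>UNIV. d k * word_derivative a' k vs)" for vs
  proof (induction vs)
    case Nil
    show ?case by (simp add: single_Word_Nil h fox_derivative_1)
  next
    case (Cons u vs)
    have "fox_derivative a i (\<phi> (Poly_Mapping.single (Word (u # vs)) 1)) =
      at_z1 (point a' u) * (\<Sum>k\<in>UNIV. d k * word_derivative a' k vs) +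
      (\<Sum>k\<in>UNIV. if u = X k then d k else 0) * at_z2 (prod_list (map (point a') vs))"
      by (simp only: single_Word_Cons h fox_derivative_mult pv Cons v ev)
    also have "\<dots> = (\<Sum>k\<in>UNIV. d k * word_derivative a' k (u # vs))"
      by (simp add: sum_distrib_left sum_distrib_right algebra_simps flip: sum.distrib)
        (intro sum.cong; simp)
    finally show ?case .
  qed
  have "fox_derivative a i (\<phi> p) = (\<Sum>k\<in>UNIV. d k * fox_derivative a' k p)"
  proof (induction p rule: monoid_algebra_induct)
    case (single m c)
    have "Poly_Mapping.single m c = const c * Poly_Mapping.single (Word (letters m)) 1"
      by (simp add: const_mult_single)
    then have "fox_derivative a i (\<phi> (Poly_Mapping.single m c)) =
        [:[:c:]:] * (\<Sum>k\<in>UNIV. d k * word_derivative a' k (letters m))"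
      by (simp only: h fox_derivative_mult eval_z_const fox_derivative_const w at_z12_const
          mult_zero_left add_0_right)
    then show ?case
      by (simp only: fox_derivative_linear sum_distrib_left mult.left_commute)
  qed (simp_all add: h fox_derivative_linear distrib_left sum.distrib)
  then show ?thesis by (simp only: a'_def d_def)
qed

definition jacobian_at :: "('n::finite \<Rightarrow> 'k::field poly) \<Rightarrow>
    (('n gvar, 'k) free_algebra \<Rightarrow> ('n gvar, 'k) free_algebra) \<Rightarrow> 'k poly poly ^ 'n ^ 'n"
  where "jacobian_at a \<phi> = (\<chi> i j. fox_derivative a i (\<phi> (fvar (X j))))"

lemma jacobian_at_comp:
  assumes "Kz_automorphism \<phi>"
  shows "jacobian_at a (\<phi> \<circ> \<psi>) =
    jacobian_at a \<phi> ** jacobian_at (\<lambda>j. eval_z a (\<phi> (fvar (X j)))) \<psi>"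
proof -
  have "alg_hom \<phi>" "\<phi> (fvar Z) = fvar Z"
    using assms by (simp_all add: Kz_automorphism_def alg_automorphism_def)
  then show ?thesis
    unfolding vec_eq_iff jacobian_at_def matrix_matrix_mult_def vec_lambda_beta comp_apply
    by (intro allI fox_derivative_chain)
qed

lemma jacobian_at_id: "jacobian_at a id = mat 1"
  by (simp add: vec_eq_iff jacobian_at_def fox_derivative_fvar mat_def)

lemma jacobian_at_linear:
  assumes "linear_with M \<phi>"
  shows "jacobian_at a \<phi> = M"
proof -
  have "M $ k $ j * (if k = i then 1 else 0) = (if k = i then M $ k $ j else 0)" for i j k
    by simp
  with assms show ?thesis
    by (simp add: vec_eq_iff jacobian_at_def linear_with_def fox_derivative_sum fox_derivative_act
        fox_derivative_fvar)
qed

lemma fox_derivative_free_subalgebra: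
  assumes "p \<in> free_subalgebra S" "X i \<notin> S"
  shows "fox_derivative a i p = 0"
proof -
  have "word_derivative a i vs = 0" if "set vs \<subseteq> S" for vs
    using that assms(2) by (induction vs) auto
  then show ?thesis
    using assms(1) unfolding fox_derivative_def linear_extension_def free_subalgebra_def by auto
qed

lemma inverse_Kz_automorphism:
  assumes "Kz_automorphism \<phi>"
  defines "\<psi> \<equiv> inv\<^bsub>Kz_aut_group\<^esub> \<phi>"
  shows "Kz_automorphism \<psi>" "\<phi> \<circ> \<psi> = id" "\<psi> \<circ> \<phi> = id"
  using group.inv_closed[OF group_Kz_aut_group, of \<phi>] group.r_inv[OF group_Kz_aut_group, of \<phi>]
    group.l_inv[OF group_Kz_aut_group, of \<phi>] assms by simp_all

lemma invertible_of_inverses: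
  fixes A B C :: "'r::comm_ring_1 ^ 'n::finite ^ 'n"
  assumes "A ** B = mat 1" "C ** A = mat 1"
  shows "invertible A"
proof -
  have "C = C ** (A ** B)" using assms by simp
  also have "\<dots> = B" using assms(2) by (simp add: matrix_mul_assoc)
  finally show ?thesis using assms by (auto simp: invertible_def)
qed

text \<open>The inverse is not known to be linear. Its Fox matrices at two possibly different points
  are a right and a left inverse of \<open>M\<close>, because the matrix of \<open>\<phi>\<close> is
  \<open>M\<close> wherever it is taken.\<close>

lemma invertible_linear_with:
  assumes "Kz_automorphism \<phi>" "linear_with M \<phi>"
  shows "invertible M"
proof -
  note inv = inverse_Kz_automorphism[OF assms(1)]
  let ?\<psi> = "inv\<^bsub>Kz_aut_group\<^esub> \<phi>"
  show ?thesis
  proof (rule invertible_of_inverses)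
    show "M ** jacobian_at (\<lambda>j. eval_z (\<lambda>_. 0) (\<phi> (fvar (X j)))) ?\<psi> = mat 1"
      using jacobian_at_comp[OF assms(1), of "\<lambda>_. 0" ?\<psi>]
      by (simp add: inv jacobian_at_id jacobian_at_linear[OF assms(2)])
    show "jacobian_at (\<lambda>_. 0) ?\<psi> ** M = mat 1"
      using jacobian_at_comp[OF inv(1), of "\<lambda>_. 0" \<phi>]
      by (simp add: inv jacobian_at_id jacobian_at_linear[OF assms(2)])
  qed
qed

section \<open>Jacobian matrices of tame automorphisms\<close>

lemma diagonal_mult:
  "(\<chi> k l. if k = l then f k else 0) ** (\<chi> k l. if k = l then g k else 0) =
    (\<chi> k l. if k = l then f k * g k else (0 :: 'r::comm_ring_1)) "
proof -
  have "(if k = m then f k else 0) * (if m = l then g m else 0) =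
    (if m = k then (if k = l then f k * g k else 0) else 0)" for k l m
    by simp
  then show ?thesis by (simp add: vec_eq_iff matrix_matrix_mult_def)
qed

lemma diagonal_const_in_GE:
  assumes "\<And>k. f k * g k = (1 :: 'r::comm_ring_1)"
  shows "(\<chi> k l. if k = l then f k else 0) \<in> GE"
proof (rule diagonal_in_GE)
  have "g k * f k = 1" for k using assms[of k] by (simp only: mult.commute)
  then have "(\<chi> k l. if k = l then f k else 0) ** (\<chi> k l. if k = l then g k else 0) = mat 1"
    "(\<chi> k l. if k = l then g k else 0) ** (\<chi> k l. if k = l then f k else 0) = mat 1"
    unfolding diagonal_mult by (simp_all add: vec_eq_iff mat_def assms)
  then show "invertible (\<chi> k l. if k = l then f k else 0)"
    unfolding invertible_def by blast
qed (simp add: diagonal_matrices_def)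

text \<open>All points are required because in a composition the second factor is differentiated at
  a moved point.\<close>

definition GE_jacobian :: "(('n::finite gvar, 'k::field) free_algebra \<Rightarrow> ('n gvar, 'k) free_algebra) \<Rightarrow> bool"
  where "GE_jacobian \<phi> \<longleftrightarrow> Kz_automorphism \<phi> \<and> (\<forall>a. jacobian_at a \<phi> \<in> GE)"

lemma GE_jacobian_comp: "GE_jacobian \<phi> \<Longrightarrow> GE_jacobian \<psi> \<Longrightarrow> GE_jacobian (\<phi> \<circ> \<psi>)"
  using group.is_monoid[OF group_Kz_aut_group, THEN monoid.m_closed, of \<phi> \<psi>]
  by (simp add: GE_jacobian_def jacobian_at_comp GE_mult)

lemma GE_jacobian_inv:
  assumes "GE_jacobian \<phi>"
  shows "GE_jacobian (inv\<^bsub>Kz_aut_group\<^esub> \<phi>)"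
proof -
  let ?\<psi> = "inv\<^bsub>Kz_aut_group\<^esub> \<phi>"
  have "Kz_automorphism \<phi>" using assms by (simp add: GE_jacobian_def)
  note inv = inverse_Kz_automorphism[OF this]
  have "jacobian_at a ?\<psi> \<in> GE" for a
  proof -
    \<comment> \<open>The Jacobian of \<open>\<phi>\<close> at the point to which
      \<open>?\<psi>\<close> moves \<open>a\<close>.\<close>
    define A where "A = jacobian_at (\<lambda>j. eval_z a (?\<psi> (fvar (X j)))) \<phi>"
    have A: "A \<in> GE" using assms by (simp add: A_def GE_jacobian_def)
    have l: "jacobian_at a ?\<psi> ** A = mat 1"
      using jacobian_at_comp[OF inv(1), of a \<phi>] by (simp add: inv jacobian_at_id A_def)
    obtain B where B: "A ** B = mat 1" "B ** A = mat 1"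
      using invertible_GE[OF A] by (auto simp: invertible_def)
    have "jacobian_at a ?\<psi> = jacobian_at a ?\<psi> ** (A ** B)" using B by simp
    also have "\<dots> = B" using l by (simp add: matrix_mul_assoc)
    finally show ?thesis using GE_inverse[OF A B] by simp
  qed
  with inv(1) show ?thesis by (simp add: GE_jacobian_def)
qed

lemma GE_jacobian_generate:
  assumes "\<phi> \<in> generate Kz_aut_group H" "\<And>\<psi>. \<psi> \<in> H \<Longrightarrow> GE_jacobian \<psi>"
  shows "GE_jacobian \<phi>"
  using assms(1)
proof induction
  case one
  have "Kz_automorphism id"
    by (simp add: Kz_automorphism_def alg_automorphism_def alg_hom_id)
  then have "GE_jacobian id" unfolding GE_jacobian_def jacobian_at_id by (simp only: one_in_GE simp_thms)
  then show ?case by (simp only: Kz_aut_group_simps)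
next
  case (incl \<psi>)
  then show ?case by (rule assms(2))
next
  case (inv \<psi>)
  then show ?case by (intro GE_jacobian_inv assms(2))
next
  case (eng \<psi> \<psi>')
  then show ?case unfolding Kz_aut_group_simps by (intro GE_jacobian_comp)
qed

lemma GE_jacobian_diagonal:
  assumes "\<phi> \<in> diagonal_Kz_automorphisms"
  shows "GE_jacobian \<phi>"
proof -
  obtain \<alpha> where \<alpha>: "Kz_automorphism \<phi>" "\<And>j. \<alpha> j \<noteq> 0" "\<And>j. \<phi> (fvar (X j)) = const (\<alpha> j) * fvar (X j)"
    using assms by (auto simp: diagonal_Kz_automorphisms_def)
  have "jacobian_at a \<phi> = (\<chi> k l. if k = l then [:[:\<alpha> k:]:] else 0)" for a
    by (simp add: vec_eq_iff jacobian_at_def \<alpha>(3) fox_derivative_mult eval_z_const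
        fox_derivative_const fox_derivative_fvar at_z12_const)
  moreover have "(\<chi> k l. if k = l then [:[:\<alpha> k:]:] else 0) \<in> GE"
    using \<alpha>(2) by (intro diagonal_const_in_GE[where g = "\<lambda>k. [:[:inverse (\<alpha> k):]:]"]) (simp add: one_pCons)
  ultimately show ?thesis using \<alpha>(1) by (simp add: GE_jacobian_def)
qed

lemma GE_jacobian_transvection:
  assumes "\<phi> \<in> transvection_Kz_automorphisms"
  shows "GE_jacobian \<phi>"
proof -
  obtain i j p q where *: "Kz_automorphism \<phi>" "i \<noteq> j"
    "\<phi> (fvar (X j)) = fvar (X j) + at_z p * fvar (X i) * at_z q"
    "\<And>l. l \<noteq> j \<Longrightarrow> \<phi> (fvar (X l)) = fvar (X l)"
    using assms by (auto simp: transvection_Kz_automorphisms_def)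
  have "jacobian_at a \<phi> $ k $ l = elementary_matrix i j (at_z1 p * at_z2 q) $ k $ l" for a k l
    using * by (cases "l = j") (simp_all add: jacobian_at_def elementary_matrix_nth fox_derivative_linear
        fox_derivative_mult fox_derivative_at_z eval_z_at_z fox_derivative_fvar)
  then have "jacobian_at a \<phi> = elementary_matrix i j (at_z1 p * at_z2 q)" for a
    by (simp add: vec_eq_iff)
  then show ?thesis using * by (simp add: GE_jacobian_def elementary_in_GE)
qed

text \<open>\<open>f j\<close> contains only variables after \<open>X j\<close>, so the matrix is
  triangular at every point, with nonzero constants on the diagonal. With two variables a single
  off-diagonal entry is left, and one elementary factor accounts for it.\<close>

lemma GE_jacobian_triangular:
  fixes \<phi> :: "('n::{finite,linorder} gvar, 'k::field) free_algebra \<Rightarrow> ('n gvar, 'k) free_algebra"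
  assumes "\<phi> \<in> triangular_Kz_automorphisms" "CARD('n) = 2"
  shows "GE_jacobian \<phi>"
proof -
  obtain \<alpha> f where \<phi>: "Kz_automorphism \<phi>" "\<And>j. \<alpha> j \<noteq> 0" "\<And>j. f j \<in> free_subalgebra (X ` {j<..} \<union> {Z})"
      "\<And>j. \<phi> (fvar (X j)) = const (\<alpha> j) * fvar (X j) + f j"
    using assms by (auto simp: triangular_Kz_automorphisms_def)
  obtain i j :: 'n where ij: "i < j" "UNIV = {i, j}"
  proof -
    obtain x y :: 'n where "UNIV = {x, y}" "x \<noteq> y" using assms(2) by (auto simp: card_2_iff)
    then show ?thesis using that[of x y] that[of y x] by (cases x y rule: linorder_cases) auto
  qed
  have "jacobian_at a \<phi> \<in> GE" for a
  proof -
    let ?J = "jacobian_at a \<phi>"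
    let ?D = "\<chi> k l. if k = l then [:[:\<alpha> k:]:] else (0 :: 'k poly poly)"
    have J: "?J $ k $ l = (if k = l then [:[:\<alpha> k:]:] else 0) + fox_derivative a k (f l)" for k l
      by (simp add: jacobian_at_def \<phi>(4) fox_derivative_linear fox_derivative_mult eval_z_const
        fox_derivative_const fox_derivative_fvar at_z12_const)
    have z: "fox_derivative a k (f l) = 0" if "k \<le> l" for k l
      using that by (intro fox_derivative_free_subalgebra[OF \<phi>(3)[of l]]) auto
    \<comment> \<open>Division by \<open>\<alpha> i\<close> compensates for the diagonal factor,
      which multiplies from the right.\<close>
    define s where "s = fox_derivative a j (f i) * [:[:inverse (\<alpha> i):]:]"
    have "[:[:inverse (\<alpha> i):]:] * [:[:\<alpha> i:]:] = 1" using \<phi>(2) by (simp add: one_pCons)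
    then have s: "s * [:[:\<alpha> i:]:] = fox_derivative a j (f i)"
      by (simp only: s_def mult.assoc mult_1_right)
    have "?J $ k $ l = (elementary_matrix j i s ** ?D) $ k $ l" for k l
    proof -
      have "k = i \<or> k = j" "l = i \<or> l = j" using ij(2) by blast+
      then show ?thesis
        unfolding elementary_mult_matrix_nth J using ij(1) s z[of i i] z[of i j] z[of j j] by auto
    qed
    then have "?J = elementary_matrix j i s ** ?D" by (simp only: vec_eq_iff) blast
    moreover have "?D \<in> GE"
      using \<phi>(2) by (intro diagonal_const_in_GE[where g = "\<lambda>k. [:[:inverse (\<alpha> k):]:]"]) (simp add: one_pCons)
    ultimately show ?thesis using ij(1) by (simp add: GE_mult elementary_in_GE)
  qed
  with \<phi>(1) show ?thesis by (simp add: GE_jacobian_def)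
qed

lemma tame_imp_GE_jacobian:
  fixes \<phi> :: "('n::{finite,linorder} gvar, 'k::field) free_algebra \<Rightarrow> ('n gvar, 'k) free_algebra"
  assumes "\<phi> \<in> tame_Kz_automorphisms" "CARD('n) = 2"
  shows "GE_jacobian \<phi>"
  using assms(1) unfolding tame_Kz_automorphisms_def
proof (rule GE_jacobian_generate)
  fix \<psi> :: "('n gvar, 'k) free_algebra \<Rightarrow> ('n gvar, 'k) free_algebra"
  assume "\<psi> \<in> elementary_linear_Kz_automorphisms \<union> triangular_Kz_automorphisms"
  then consider "\<psi> \<in> elementary_linear_Kz_automorphisms" | "\<psi> \<in> triangular_Kz_automorphisms" by blast
  then show "GE_jacobian \<psi>"
  proof cases
    case 1
    then show ?thesis
      unfolding elementary_linear_Kz_automorphisms_def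
      by (rule GE_jacobian_generate) (auto intro: GE_jacobian_diagonal GE_jacobian_transvection)
  next
    case 2
    then show ?thesis using assms(2) by (rule GE_jacobian_triangular)
  qed
qed

section \<open>Induced automorphisms of the polynomial algebra\<close>

definition poly_z :: "'k::field poly \<Rightarrow> ('n gvar, 'k) poly_algebra"
  where "poly_z p = abelianization (at_z p)"

lemmas abelianization_simps = alg_homD[OF alg_hom_abelianization]

lemma poly_z_simps:
  "poly_z 0 = 0" "poly_z 1 = 1" "poly_z (p + q) = poly_z p + poly_z q" "poly_z (p * q) = poly_z p * poly_z q"
  "poly_z (pCons a p) = const a + poly_z p * pvar Z"
  by (simp_all add: poly_z_def abelianization_simps at_z_add at_z_mult at_z_pCons abelianization_fvar)

lemma poly_z_sum: "poly_z (sum f A) = (\<Sum>x\<in>A. poly_z (f x))"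
  by (induction A rule: infinite_finite_induct) (simp_all add: poly_z_simps)

lemma alg_hom_poly_z:
  assumes "alg_hom \<psi>" "\<psi> (pvar Z) = pvar Z"
  shows "\<psi> (poly_z p) = poly_z p"
  by (induction p) (simp_all add: poly_z_simps alg_homD[OF assms(1)] assms(2))

text \<open>On the polynomial algebra the variables \<open>z\<^sub>1\<close> and \<open>z\<^sub>2\<close> act in the same way.\<close>

definition diagonal_eval :: "'k::field poly poly \<Rightarrow> 'k poly"
  where "diagonal_eval p = poly p [:0, 1:]"

lemma abelianization_act: "abelianization (act p w) = poly_z (diagonal_eval p) * abelianization w"
  by (induction p)
    (simp_all add: act_pCons diagonal_eval_def abelianization_simps abelianization_fvar poly_z_simps
      distrib_right mult_ac, simp add: poly_z_def distrib_left)

definition poly_linear_with :: "'k::field poly ^ 'n::finite ^ 'n \<Rightarrow>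
    (('n gvar, 'k) poly_algebra \<Rightarrow> ('n gvar, 'k) poly_algebra) \<Rightarrow> bool"
  where "poly_linear_with M \<psi> \<longleftrightarrow> \<psi> (pvar Z) = pvar Z \<and>
    (\<forall>j. \<psi> (pvar (X j)) = (\<Sum>i\<in>UNIV. poly_z (M $ i $ j) * pvar (X i)))"

lemma poly_linear_with_comp:
  assumes "poly_linear_with M \<phi>" "poly_linear_with N \<psi>" "alg_hom \<phi>"
  shows "poly_linear_with (M ** N) (\<phi> \<circ> \<psi>)"
proof -
  have Z: "\<phi> (pvar Z) = pvar Z" using assms(1) by (simp add: poly_linear_with_def)
  have "(\<phi> \<circ> \<psi>) (pvar (X j)) = (\<Sum>k\<in>UNIV. poly_z ((M ** N) $ k $ j) * pvar (X k))" for j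
  proof -
    have "(\<phi> \<circ> \<psi>) (pvar (X j)) =
        (\<Sum>i\<in>UNIV. poly_z (N $ i $ j) * (\<Sum>k\<in>UNIV. poly_z (M $ k $ i) * pvar (X k)))"
      using assms(1,2)
      by (simp add: poly_linear_with_def alg_homD[OF assms(3)] alg_hom_poly_z[OF assms(3) Z])
    also have "\<dots> = (\<Sum>k\<in>UNIV. \<Sum>i\<in>UNIV. poly_z (N $ i $ j) * (poly_z (M $ k $ i) * pvar (X k)))"
      by (simp only: sum_distrib_left) (rule sum.swap)
    also have "\<dots> = (\<Sum>k\<in>UNIV. poly_z ((M ** N) $ k $ j) * pvar (X k))"
      by (simp add: matrix_matrix_mult_def poly_z_sum poly_z_simps sum_distrib_left mult_ac)
    finally show ?thesis .
  qed
  with assms(2) Z show ?thesis by (simp add: poly_linear_with_def)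
qed

lemma alg_automorphism_poly_subst:
  assumes "\<And>v. poly_subst f (g v) = pvar v" "\<And>v. poly_subst g (f v) = pvar v"
  shows "alg_automorphism (poly_subst f)"
proof (rule alg_automorphismI[OF alg_hom_poly_subst])
  show "poly_subst f \<circ> poly_subst g = id" "poly_subst g \<circ> poly_subst f = id"
    using assms
    by (intro poly_alg_hom_eqI alg_hom_comp alg_hom_poly_subst alg_hom_id; simp add: poly_subst_pvar)+
qed

lemma poly_aut_group_simps [simp]:
  "\<phi> \<otimes>\<^bsub>poly_aut_group\<^esub> \<psi> = \<phi> \<circ> \<psi>" "\<one>\<^bsub>poly_aut_group\<^esub> = id"
  "\<phi> \<in> carrier poly_aut_group \<longleftrightarrow> alg_automorphism \<phi>"
  by (simp_all add: poly_aut_group_def)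

lemma tame_automorphisms_comp:
  "\<phi> \<in> tame_automorphisms \<Longrightarrow> \<psi> \<in> tame_automorphisms \<Longrightarrow> \<phi> \<circ> \<psi> \<in> tame_automorphisms"
  unfolding tame_automorphisms_def by (metis poly_aut_group_simps(1) generate.eng)

lemma tame_automorphisms_generators:
  "\<phi> \<in> affine_automorphisms \<union> triangular_automorphisms \<Longrightarrow> \<phi> \<in> tame_automorphisms"
  unfolding tame_automorphisms_def by (rule generate.incl)

lemma alg_hom_tame:
  assumes "\<phi> \<in> tame_automorphisms"
  shows "alg_hom \<phi>"
proof -
  have "affine_automorphisms \<union> triangular_automorphisms \<subseteq> carrier poly_aut_group"
    by (auto simp: affine_automorphisms_def triangular_automorphisms_def)
  from group.generate_in_carrier[OF group_poly_aut_group this assms[unfolded tame_automorphisms_def]]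
  show ?thesis by (simp add: alg_automorphism_def)
qed

lemma poly_subalgebra_closed:
  "0 \<in> poly_subalgebra S" "const c \<in> poly_subalgebra S" "v \<in> S \<Longrightarrow> pvar v \<in> poly_subalgebra S"
  "p \<in> poly_subalgebra S \<Longrightarrow> q \<in> poly_subalgebra S \<Longrightarrow> p + q \<in> poly_subalgebra S"
  "p \<in> poly_subalgebra S \<Longrightarrow> q \<in> poly_subalgebra S \<Longrightarrow> p * q \<in> poly_subalgebra S"
proof -
  show "0 \<in> poly_subalgebra S" "const c \<in> poly_subalgebra S" "v \<in> S \<Longrightarrow> pvar v \<in> poly_subalgebra S"
    by (simp_all add: poly_subalgebra_def const_def pvar_def)
  show "p + q \<in> poly_subalgebra S" if "p \<in> poly_subalgebra S" "q \<in> poly_subalgebra S"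
    using that keys_add[of p q] unfolding poly_subalgebra_def by blast
  show "p * q \<in> poly_subalgebra S" if "p \<in> poly_subalgebra S" "q \<in> poly_subalgebra S"
  proof -
    have "Poly_Mapping.keys (m + n) \<subseteq> S" if "Poly_Mapping.keys m \<subseteq> S" "Poly_Mapping.keys n \<subseteq> S"
      for m n :: "'a \<Rightarrow>\<^sub>0 nat"
      using keys_add[of m n] that by blast
    then show ?thesis
      using that keys_mult[of p q] unfolding poly_subalgebra_def by blast
  qed
qed

lemma poly_z_subalgebra: "Z \<in> S \<Longrightarrow> poly_z p \<in> poly_subalgebra S"
  by (induction p) (simp_all add: poly_z_simps poly_subalgebra_closed)

text \<open>Both \<open>X i\<close> and \<open>Z\<close> come after \<open>X j\<close>, so adding a
  multiple of \<open>X i\<close> with coefficient in \<open>K[z]\<close> to \<open>X j\<close> is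
  triangular.\<close>

lemma exists_poly_triangular:
  fixes i j :: "'n::{finite,linorder}"
  assumes "j < i"
  shows "\<exists>\<psi>\<in>tame_automorphisms. poly_linear_with (elementary_matrix i j (r :: 'k::field poly)) \<psi>"
proof -
  define g :: "'k poly \<Rightarrow> 'n gvar \<Rightarrow> ('n gvar, 'k) poly_algebra"
    where "g = (\<lambda>r v. if v = X j then poly_z r * pvar (X i) else 0)"
  define f where "f = (\<lambda>r v. pvar v + g r v)"
  have fZ: "f r Z = pvar Z" and fX: "f r (X l) = pvar (X l) + (if l = j then poly_z r * pvar (X i) else 0)" for r l
    by (simp_all add: f_def g_def)
  have s: "poly_subst (f r) (poly_z p) = poly_z p" for r p
    by (rule alg_hom_poly_z[OF alg_hom_poly_subst]) (simp add: poly_subst_pvar fZ)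
  have inv: "poly_subst (f r) (f (- r) v) = pvar v" for r v
  proof -
    have "poly_subst (f r) (f (- r) (X l)) = pvar (X l)" for l
    proof -
      have "poly_z r * pvar (X i) + poly_z (- r) * pvar (X i) = poly_z (r + - r) * pvar (X i)"
        by (simp only: poly_z_simps distrib_right)
      then have "poly_z r * pvar (X i) + poly_z (- r) * pvar (X i) = 0" by (simp add: poly_z_simps)
      moreover have "i \<noteq> j" using assms by simp
      ultimately show ?thesis
        by (simp add: fX alg_homD[OF alg_hom_poly_subst] poly_subst_pvar s add.assoc)
    qed
    then show ?thesis by (cases v) (simp_all add: fZ poly_subst_pvar)
  qed
  let ?\<psi> = "poly_subst (f r)"
  have "alg_automorphism ?\<psi>"
    using inv[of r] inv[of "- r"] by (intro alg_automorphism_poly_subst[of _ "f (- r)"]) simp_all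
  moreover have "g r v \<in> poly_subalgebra {v<..}" for v
    using assms
    by (auto simp: g_def less_gvar_def intro!: poly_subalgebra_closed poly_z_subalgebra)
  then have "\<exists>\<alpha> h. \<forall>v. \<alpha> v \<noteq> 0 \<and> h v \<in> poly_subalgebra {v<..} \<and> ?\<psi> (pvar v) = const (\<alpha> v) * pvar v + h v"
    by (intro exI[of _ "\<lambda>_. 1"] exI[of _ "g r"]) (simp add: poly_subst_pvar f_def)
  ultimately have "?\<psi> \<in> triangular_automorphisms"
    by (simp add: triangular_automorphisms_def)
  moreover have "poly_linear_with (elementary_matrix i j r) ?\<psi>"
  proof -
    have "poly_z (elementary_matrix i j r $ k $ l) * pvar (X k) =
      (if k = l then pvar (X k) else 0) + (if k = i then (if l = j then poly_z r * pvar (X k) else 0) else 0)"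
      for k l :: 'n
      by (simp add: elementary_matrix_nth poly_z_simps distrib_right)
    then show ?thesis
      by (simp add: poly_linear_with_def poly_subst_pvar fZ fX sum.distrib)
  qed
  ultimately show ?thesis using tame_automorphisms_generators by blast
qed

text \<open>A multiple of an earlier variable cannot be added by a triangular automorphism;
  conjugation by this affine one exchanges the roles of the two variables.\<close>

lemma exists_poly_swap:
  fixes i j :: "'n::{finite,linorder}"
  obtains \<tau> :: "('n gvar, 'k::field) poly_algebra \<Rightarrow> ('n gvar, 'k) poly_algebra"
  where "\<tau> \<in> tame_automorphisms" "\<And>v. \<tau> (pvar v) = pvar (Transposition.transpose (X i) (X j) v)"
proof -
  let ?t = "Transposition.transpose (X i) (X j)"
  define \<tau> :: "('n gvar, 'k) poly_algebra \<Rightarrow> ('n gvar, 'k) poly_algebra"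
    where "\<tau> = poly_subst (\<lambda>v. pvar (?t v))"
  have \<tau>: "\<tau> (pvar v) = pvar (?t v)" for v by (simp add: \<tau>_def poly_subst_pvar)
  have aut: "alg_automorphism \<tau>"
    unfolding \<tau>_def
    by (rule alg_automorphism_poly_subst[of _ "\<lambda>v. pvar (?t v)"]) (simp_all add: poly_subst_pvar)
  define A :: "'k ^ 'n gvar ^ 'n gvar" where "A = (\<chi> u v. if u = ?t v then 1 else 0)"
  have "A ** A = mat 1"
  proof -
    have "(if u = ?t w then 1 else 0) * (if w = ?t v then 1 else (0::'k)) =
        (if w = ?t v then (if u = v then 1 else 0) else 0)" for u v w
      by auto
    then show ?thesis by (simp add: A_def vec_eq_iff matrix_matrix_mult_def mat_def)
  qed
  then have inv: "invertible A" by (auto simp: invertible_def)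
  have eq: "\<tau> (pvar v) = (\<Sum>u\<in>UNIV. const (A $ u $ v) * pvar u) + const 0" for v
  proof -
    have "const (A $ u $ v) * pvar u = (if u = ?t v then pvar u else 0)" for u
      by (simp add: A_def)
    then show ?thesis by (simp add: \<tau>)
  qed
  have "\<tau> \<in> affine_automorphisms"
    unfolding affine_automorphisms_def
    by (intro CollectI conjI exI[of _ A] exI[of _ "\<lambda>_. 0"] allI) (rule aut inv eq)+
  then show ?thesis using that \<tau> tame_automorphisms_generators by blast
qed

lemma exists_poly_elementary:
  fixes i j :: "'n::{finite,linorder}"
  assumes "i \<noteq> j"
  shows "\<exists>\<psi>\<in>tame_automorphisms. poly_linear_with (elementary_matrix i j (r :: 'k::field poly)) \<psi>"
proof (cases "j < i")
  case True
  then show ?thesis by (rule exists_poly_triangular)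
next
  case False
  then have "i < j" using assms by simp
  from exists_poly_triangular[OF this] obtain \<psi> where \<psi>: "\<psi> \<in> tame_automorphisms"
    "poly_linear_with (elementary_matrix j i r) \<psi>" by blast
  obtain \<tau> :: "('n gvar, 'k) poly_algebra \<Rightarrow> ('n gvar, 'k) poly_algebra" where
    \<tau>: "\<tau> \<in> tame_automorphisms" "\<And>v. \<tau> (pvar v) = pvar (Transposition.transpose (X i) (X j) v)"
    by (rule exists_poly_swap) blast
  have Z: "\<tau> (pvar Z) = pvar Z" by (simp add: \<tau>(2) Transposition.transpose_def)
  have e: "poly_z (elementary_matrix m n r $ k $ l) * pvar (X k) =
      (if k = l then pvar (X k) else 0) + (if k = m then (if l = n then poly_z r * pvar (X k) else 0) else 0)"
    for m n k l :: 'n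
    by (simp add: elementary_matrix_nth poly_z_simps distrib_right)
  note h = alg_homD[OF alg_hom_tame[OF \<tau>(1)]]
  have \<psi>X: "\<psi> (pvar Z) = pvar Z" "\<psi> (pvar (X l)) = pvar (X l) + (if l = i then poly_z r * pvar (X j) else 0)" for l
    using \<psi>(2) by (simp_all add: poly_linear_with_def e sum.distrib)
  have "(\<tau> \<circ> (\<psi> \<circ> \<tau>)) (pvar (X l)) = pvar (X l) + (if l = j then poly_z r * pvar (X i) else 0)" for l
    using assms
    by (auto simp: \<tau>(2) \<psi>X h alg_hom_poly_z[OF alg_hom_tame[OF \<tau>(1)] Z] Transposition.transpose_def)
  then have "poly_linear_with (elementary_matrix i j r) (\<tau> \<circ> (\<psi> \<circ> \<tau>))"
    by (simp add: poly_linear_with_def e sum.distrib Z \<psi>X(1))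
  then show ?thesis using \<psi>(1) \<tau>(1) tame_automorphisms_comp by blast
qed

text \<open>Units of \<open>K[z]\<close> are nonzero constants; the automorphism is triangular with
  vanishing polynomial parts and leaves \<open>z\<close> alone.\<close>

lemma exists_poly_diagonal:
  fixes D :: "'k::field poly ^ 'n::{finite,linorder} ^ 'n::{finite,linorder}"
  assumes "D \<in> diagonal_matrices" "invertible D"
  shows "\<exists>\<psi>\<in>tame_automorphisms. poly_linear_with D \<psi>"
proof -
  obtain E where E: "E \<in> diagonal_matrices" "D ** E = mat 1"
    using diagonal_inverse[OF assms] by metis
  have "\<exists>c. c \<noteq> 0 \<and> D $ j $ j = [:c:]" for j
  proof -
    have "(D ** E) $ j $ j = D $ j $ j * E $ j $ j"
      unfolding matrix_matrix_mult_def using assms(1)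
      by (simp, subst sum.remove[of _ j]) (auto simp: diagonal_matrices_def intro!: sum.neutral)
    then have "D $ j $ j * E $ j $ j = 1" using E(2) by (simp add: mat_def)
    then have "D $ j $ j dvd 1" by (metis dvd_triv_left)
    then show ?thesis by (auto simp: is_unit_poly_iff)
  qed
  then obtain c where c: "\<And>j. c j \<noteq> 0" "\<And>j. D $ j $ j = [:c j:]" by metis
  define c' where "c' = (\<lambda>v. case v of X j \<Rightarrow> c j | Z \<Rightarrow> 1)"
  have c': "c' v \<noteq> 0" for v using c(1) by (cases v) (simp_all add: c'_def)
  define f :: "('n gvar \<Rightarrow> 'k) \<Rightarrow> 'n gvar \<Rightarrow> ('n gvar, 'k) poly_algebra"
    where "f = (\<lambda>c v. const (c v) * pvar v)"
  have inv: "poly_subst (f c) (f d v) = pvar v" if "\<And>j. d j * c j = 1" for c d v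
    using that by (simp add: f_def alg_homD[OF alg_hom_poly_subst] poly_subst_pvar flip: mult.assoc const_mult)
  let ?\<psi> = "poly_subst (f c')"
  have "alg_automorphism ?\<psi>"
    using c' by (intro alg_automorphism_poly_subst[of _ "f (\<lambda>v. inverse (c' v))"] inv) simp_all
  then have "?\<psi> \<in> triangular_automorphisms"
    unfolding triangular_automorphisms_def using c'
    by (auto simp: poly_subst_pvar f_def poly_subalgebra_closed intro!: exI[of _ c'] exI[of _ "\<lambda>_. 0 :: ('n gvar, 'k) poly_algebra"])
  moreover have "poly_linear_with D ?\<psi>"
  proof -
    have "(\<Sum>i\<in>UNIV. poly_z (D $ i $ j) * pvar (X i)) = poly_z (D $ j $ j) * pvar (X j)" for j
      using assms(1) by (subst sum.remove[of _ j]) (auto simp: diagonal_matrices_def poly_z_simps intro!: sum.neutral)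
    then show ?thesis
      by (simp add: poly_linear_with_def c(2) poly_z_simps poly_subst_pvar f_def c'_def)
  qed
  ultimately show ?thesis using tame_automorphisms_generators by blast
qed

lemma induces_tame:
  fixes \<phi> :: "('n::{finite,linorder} gvar, 'k::field) free_algebra \<Rightarrow> ('n gvar, 'k) free_algebra"
  assumes "Kz_automorphism \<phi>" "linear_with M \<phi>"
  shows "\<exists>\<psi>\<in>tame_automorphisms. induces \<phi> \<psi>"
proof -
  have hom: "unital_ring_hom (diagonal_eval :: 'k poly poly \<Rightarrow> _)"
    unfolding diagonal_eval_def by (rule unital_ring_hom_poly)
  have "map_matrix diagonal_eval M \<in> GE"
    by (intro GL_poly_eq_GE invertible_map_matrix hom invertible_linear_with[OF assms])
  then have "\<exists>\<psi>\<in>tame_automorphisms. poly_linear_with (map_matrix diagonal_eval M) \<psi>"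
  proof (induction rule: GE_induct)
    case (elementary i j r)
    then show ?case by (rule exists_poly_elementary)
  next
    case (diagonal D)
    then show ?case by (rule exists_poly_diagonal)
  next
    case (mult A B)
    then show ?case using poly_linear_with_comp tame_automorphisms_comp alg_hom_tame by meson
  qed
  then obtain \<psi> where \<psi>: "\<psi> \<in> tame_automorphisms" "poly_linear_with (map_matrix diagonal_eval M) \<psi>" by blast
  \<comment> \<open>\<open>\<psi>\<close> was built from the matrix alone; comparison on the
    variables of the free algebra identifies it as the map induced by \<open>\<phi>\<close>.\<close>
  have "\<psi> \<circ> abelianization = abelianization \<circ> \<phi>"
  proof (rule free_alg_hom_eqI)
    show "alg_hom (\<psi> \<circ> abelianization)" "alg_hom (abelianization \<circ> \<phi>)"
      using alg_hom_tame[OF \<psi>(1)] assms(1)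
      by (auto simp: Kz_automorphism_def alg_automorphism_def intro!: alg_hom_comp alg_hom_abelianization)
    show "(\<psi> \<circ> abelianization) (fvar v) = (abelianization \<circ> \<phi>) (fvar v)" for v
      using \<psi>(2) assms
      by (cases v) (simp_all add: poly_linear_with_def linear_with_def Kz_automorphism_def
          abelianization_simps abelianization_act abelianization_fvar)
  qed
  then have "induces \<phi> \<psi>" by (auto simp: induces_def fun_eq_iff)
  with \<psi>(1) show ?thesis by blast
qed

theorem theorem2:
  fixes \<phi> :: "('n::{finite,linorder} gvar, 'k::field) free_algebra \<Rightarrow> ('n gvar, 'k) free_algebra"
  assumes "linear_Kz_automorphism \<phi>"
  shows "(CARD('n) = 2 \<longrightarrow> (\<phi> \<in> tame_Kz_automorphisms \<longleftrightarrow> jacobian \<phi> \<in> GE)) \<and>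
         (CARD('n) = 2 \<longrightarrow> (\<exists>\<psi>\<in>tame_automorphisms. induces \<phi> \<psi>)) \<and>
         (CARD('n) > 2 \<longrightarrow> \<phi> \<in> tame_Kz_automorphisms)"
proof -
  obtain B where aut: "Kz_automorphism \<phi>" and B: "represents B \<phi>"
    using assms by (auto simp: linear_Kz_automorphism_def)
  have J: "linear_with (jacobian \<phi>) \<phi>"
    using represents_linear_with[OF B] by (simp add: jacobian_eq[OF B])
  \<comment> \<open>This implication serves (i) and (iii); for (iii) Suslin's theorem supplies its
    premise.\<close>
  have tame: "\<phi> \<in> tame_Kz_automorphisms" if "jacobian \<phi> \<in> GE"
    using aut J that by (rule GE_imp_tame)
  have "jacobian \<phi> \<in> GE" if "\<phi> \<in> tame_Kz_automorphisms" "CARD('n) = 2"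
    using tame_imp_GE_jacobian[OF that] jacobian_at_linear[OF J] by (simp add: GE_jacobian_def)
  moreover have "jacobian \<phi> \<in> GE" if "CARD('n) > 2"
    using that by (intro GL_poly_poly_eq_GE invertible_linear_with[OF aut J]) simp
  ultimately show ?thesis using tame induces_tame[OF aut J] by blast
qed

end
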